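(* Let $0<T<\infty$. For $k=1,2$, let $[u_0^k,u_{\Gamma,0}^k]\in\mathscr{W}$ be given initial data, let $[\theta^k,\theta_\Gamma^k]\in L^2(0,T;\mathscr{H})$ be a given source term, and let $[u^k,u_\Gamma^k]\in L^2(0,T;\mathscr{H})$ be a weak solution (in the sense defined in the context) of the singular diffusion system with dynamic boundary condition with initial data $[u_0,u_{\Gamma,0}]=[u_0^k,u_{\Gamma,0}^k]$ and source term $[\theta,\theta_\Gamma]=[\theta^k,\theta_\Gamma^k]$. Then, for all $t\in[0,T]$, $$\bigl|[u^1-u^2]^+(t)\bigr|_{L^2(\Omega)}^2+\bigl|[u_\Gamma^1-u_\Gamma^2]^+(t)\bigr|_{L^2(\Gamma)}^2\le e^t\Bigl(\bigl|[u_0^1-u_0^2]^+\bigr|_{L^2(\Omega)}^2+\bigl|[u_{\Gamma,0}^1-u_{\Gamma,0}^2]^+\bigr|_{L^2(\Gamma)}^2\Bigr)$$ $$+\int_0^t e^{t-\tau}\Bigl(\bigl|[\theta^1-\theta^2]^+(\tau)\bigr|_{L^2(\Omega)}^2+\bigl|[\theta_\Gamma^1-\theta_\Gamma^2]^+(\tau)\bigr|_{L^2(\Gamma)}^2\Bigr)d\tau.$$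
   Context: Fix $\varepsilon>0$ and $N\in\mathbb{N}$ with $N>1$. Let $\Omega\subset\mathbb{R}^N$ be a bounded domain with $C^\infty$-boundary $\Gamma:=\partial\Omega$ and unit outer normal $n_\Gamma$. Let $d\Gamma$ be the area element on $\Gamma$, $\nabla_\Gamma$ the surface gradient, $\Delta_\Gamma$ the Laplace–Beltrami operator, and $w_{|_\Gamma}$ the trace on $\Gamma$ of a function $w$ on $\Omega$ (in $L^1(\Gamma)$ for $w\in BV(\Omega)$). $|Dw|(\Omega)=\int_\Omega|Dw|$ denotes the total variation of $w\in BV(\Omega)$. $[a]^+:=\max\{a,0\}$. Set $\mathscr{H}:=L^2(\Omega)\times L^2(\Gamma)$ (product Hilbert space) and $\mathscr{W}:=(BV(\Omega)\cap L^2(\Omega))\times H^1(\Gamma)$. The singular diffusion system with dynamic boundary condition is, formally: $\partial_t u-\mathrm{div}\bigl(\frac{Du}{|Du|}\bigr)=\theta$ in $(0,T)\times\Omega$; $\partial_t u_\Gamma-\varepsilon^2\Delta_\Gamma u_\Gamma+\bigl(\frac{Du}{|Du|}\bigr)_{|_\Gamma}\cdot n_\Gamma=\theta_\Gamma$ and $u_{|_\Gamma}=u_\Gamma$ on $(0,T)\times\Gamma$; $u(0)=u_0$ in $\Omega$, $u_\Gamma(0)=u_{\Gamma,0}$ on $\Gamma$. Weak solution: a pair $[u,u_\Gamma]\in L^2(0,T;\mathscr{H})$ is a weak solution of this system iff $u\in W^{1,2}(0,T;L^2(\Omega))$, $u(t)\in BV(\Omega)$ for a.e. $t$ with $|Du(\cdot)|(\Omega)\in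 L^\infty(0,T)$, $u_\Gamma\in W^{1,2}(0,T;L^2(\Gamma))\cap L^\infty(0,T;H^1(\Gamma))$, $u(0)=u_0$ in $L^2(\Omega)$, $u_\Gamma(0)=u_{\Gamma,0}$ in $L^2(\Gamma)$, and for a.e. $t\in(0,T)$ and every $[z,z_\Gamma]\in\mathscr{W}$, $$\int_\Omega(\partial_t u(t)-\theta(t))(u(t)-z)\,dx+\int_\Omega|Du(t)|+\int_\Gamma|u_{|_\Gamma}(t)-u_\Gamma(t)|\,d\Gamma$$ $$+\int_\Gamma(\partial_t u_\Gamma(t)-\theta_\Gamma(t))(u_\Gamma(t)-z_\Gamma)\,d\Gamma+\varepsilon^2\int_\Gamma\nabla_\Gamma u_\Gamma(t)\cdot\nabla_\Gamma(u_\Gamma(t)-z_\Gamma)\,d\Gamma\le\int_\Omega|Dz|+\int_\Gamma|z_{|_\Gamma}-z_\Gamma|\,d\Gamma.$$ Functions in $W^{1,2}(0,T;\cdot)$ are identified with their continuous representatives on $[0,T]$. *)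

theory Defs
  imports "HOL-Analysis.Analysis"
begin

subsection \<open>Differentiable functions and test functions\<close>

primrec Ck_on :: "nat \<Rightarrow> ('a::real_normed_vector \<Rightarrow> 'b::real_normed_vector) \<Rightarrow> 'a set \<Rightarrow> bool" where
  "Ck_on 0 f S \<longleftrightarrow> continuous_on S f"
| "Ck_on (Suc k) f S \<longleftrightarrow> (\<forall>x\<in>S. f differentiable (at x)) \<and>
     (\<forall>v. Ck_on k (\<lambda>x. frechet_derivative f (at x) v) S)"

definition smooth_on :: "('a::real_normed_vector \<Rightarrow> 'b::real_normed_vector) \<Rightarrow> 'a set \<Rightarrow> bool" where
  "smooth_on f S \<longleftrightarrow> (\<forall>k. Ck_on k f S)"

definition C1_compact_support ::
    "'a::euclidean_space set \<Rightarrow> ('a \<Rightarrow> 'b::real_normed_vector) \<Rightarrow> bool" where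
  "C1_compact_support U \<phi> \<longleftrightarrow>
     Ck_on 1 \<phi> UNIV \<and> compact (closure {x. \<phi> x \<noteq> 0}) \<and> closure {x. \<phi> x \<noteq> 0} \<subseteq> U"

definition gradient :: "('a::euclidean_space \<Rightarrow> real) \<Rightarrow> 'a \<Rightarrow> 'a" where
  "gradient f x = (\<Sum>b\<in>Basis. frechet_derivative f (at x) b *\<^sub>R b)"

definition divergence :: "('a::euclidean_space \<Rightarrow> 'a) \<Rightarrow> 'a \<Rightarrow> real" where
  "divergence \<phi> x = (\<Sum>b\<in>Basis. frechet_derivative \<phi> (at x) b \<bullet> b)"


subsection \<open>Domains with smooth boundary\<close>

text \<open>Near each boundary point, the domain is the region strictly above the graph of a smooth
  function \<open>\<gamma>\<close> on the hyperplane orthogonal to a unit vector \<open>e\<close>. The vector \<open>e\<close> plays the role of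
  the last coordinate axis, after a rotation of the coordinates; \<open>\<gamma>\<close> is evaluated only on the
  orthogonal complement of \<open>e\<close>.\<close>

definition smooth_boundary :: "'a::euclidean_space set \<Rightarrow> bool" where
  "smooth_boundary \<Omega> \<longleftrightarrow> (\<forall>p\<in>frontier \<Omega>. \<exists>r>0. \<exists>e. \<exists>\<gamma>::'a \<Rightarrow> real.
     norm e = 1 \<and> smooth_on \<gamma> UNIV \<and>
     \<Omega> \<inter> ball p r = {x \<in> ball p r. \<gamma> (x - (x \<bullet> e) *\<^sub>R e) < x \<bullet> e})"

definition smooth_bounded_domain :: "'a::euclidean_space set \<Rightarrow> bool" where
  "smooth_bounded_domain \<Omega> \<longleftrightarrow>
     open \<Omega> \<and> connected \<Omega> \<and> \<Omega> \<noteq> {} \<and> bounded \<Omega> \<and> smooth_boundary \<Omega>"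

text \<open>The unit vector orthogonal to the boundary at \<open>x\<close> that points out of the domain. The first limit
  says that the boundary is tangent to the orthogonal complement of \<open>n\<close> at \<open>x\<close>. For a domain with
  smooth boundary in dimension at least 2 these conditions determine \<open>n\<close>.\<close>

definition outer_normal :: "'a::euclidean_space set \<Rightarrow> 'a \<Rightarrow> 'a" where
  "outer_normal \<Omega> x = (THE n. norm n = 1 \<and>
     ((\<lambda>y. ((y - x) \<bullet> n) / norm (y - x)) \<longlongrightarrow> 0) (at x within frontier \<Omega>) \<and>
     (\<forall>\<^sub>F t in at_right 0. x - t *\<^sub>R n \<in> \<Omega> \<and> x + t *\<^sub>R n \<notin> \<Omega>))"


subsection \<open>The area element\<close>

text \<open>The area element on the boundary is the Hausdorff measure of codimension one, normalised so that
  it agrees with Lebesgue measure on flat pieces. The Hausdorff outer measure is a metric outer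
  measure, hence countably additive on the Borel sets (Caratheodory's criterion), so that
  \<^const>\<open>measure_of\<close> does not degenerate.\<close>

definition hausdorff_pre :: "nat \<Rightarrow> real \<Rightarrow> 'a::euclidean_space set \<Rightarrow> ennreal" where
  "hausdorff_pre s \<delta> A =
     (INF C \<in> {C :: nat \<Rightarrow> 'a set. A \<subseteq> (\<Union>j. C j) \<and> (\<forall>j. bounded (C j) \<and> diameter (C j) \<le> \<delta>)}.
        \<Sum>j. if C j = {} then 0 else ennreal (unit_ball_vol (real s) * (diameter (C j) / 2) ^ s))"

definition hausdorff_outer :: "nat \<Rightarrow> 'a::euclidean_space set \<Rightarrow> ennreal" where
  "hausdorff_outer s A = (SUP \<delta>\<in>{0<..}. hausdorff_pre s \<delta> A)"

definition hausdorff_measure :: "nat \<Rightarrow> 'a::euclidean_space measure" where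
  "hausdorff_measure s = measure_of UNIV (sets borel) (hausdorff_outer s)"

definition boundary_measure :: "'a::euclidean_space set \<Rightarrow> 'a measure" where
  "boundary_measure \<Omega> = restrict_space (hausdorff_measure (DIM('a) - 1)) (frontier \<Omega>)"


subsection \<open>Square-integrable functions\<close>

text \<open>Elements of function spaces are represented by functions, not by classes modulo null sets.\<close>

definition L2 :: "'a measure \<Rightarrow> ('a \<Rightarrow> 'b::real_normed_vector) set" where
  "L2 M = {f \<in> borel_measurable M. integrable M (\<lambda>x. (norm (f x))\<^sup>2)}"

definition L2_norm :: "'a measure \<Rightarrow> ('a \<Rightarrow> 'b::real_normed_vector) \<Rightarrow> real" where
  "L2_norm M f = sqrt (LINT x|M. (norm (f x))\<^sup>2)"

definition L2_dist :: "'a measure \<Rightarrow> ('a \<Rightarrow> 'b::real_normed_vector) \<Rightarrow> ('a \<Rightarrow> 'b) \<Rightarrow> real" where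
  "L2_dist M f g = L2_norm M (\<lambda>x. f x - g x)"

definition L2_converges ::
    "'a measure \<Rightarrow> (nat \<Rightarrow> 'a \<Rightarrow> 'b::real_normed_vector) \<Rightarrow> ('a \<Rightarrow> 'b) \<Rightarrow> bool" where
  "L2_converges M f g \<longleftrightarrow>
     (\<forall>k. f k \<in> L2 M) \<and> g \<in> L2 M \<and> (\<lambda>k. L2_dist M (f k) g) \<longlonglongrightarrow> 0"


subsection \<open>Functions of bounded variation and their traces\<close>

definition variation_set :: "'a::euclidean_space set \<Rightarrow> ('a \<Rightarrow> real) \<Rightarrow> real set" where
  "variation_set \<Omega> w =
     {LINT x|lebesgue_on \<Omega>. w x * divergence \<phi> x | \<phi>.
        C1_compact_support \<Omega> \<phi> \<and> (\<forall>x. norm (\<phi> x) \<le> 1)}"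

definition BV :: "'a::euclidean_space set \<Rightarrow> ('a \<Rightarrow> real) set" where
  "BV \<Omega> = {w. integrable (lebesgue_on \<Omega>) w \<and> bdd_above (variation_set \<Omega> w)}"

definition total_variation :: "'a::euclidean_space set \<Rightarrow> ('a \<Rightarrow> real) \<Rightarrow> real" where
  "total_variation \<Omega> w = Sup (variation_set \<Omega> w)"

text \<open>\<open>g\<close> is the boundary trace of \<open>w\<close>: at almost every boundary point, \<open>g x\<close> is the one-sided
  approximate limit of \<open>w\<close> in the mean (Ambrosio, Fusco and Pallara, \<^emph>\<open>Functions of Bounded Variation
  and Free Discontinuity Problems\<close>, Theorem 3.87). Every function of bounded variation on a domain
  with smooth boundary has such a trace, unique almost everywhere.\<close>

definition has_trace :: "'a::euclidean_space set \<Rightarrow> ('a \<Rightarrow> real) \<Rightarrow> ('a \<Rightarrow> real) \<Rightarrow> bool" where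
  "has_trace \<Omega> w g \<longleftrightarrow> integrable (boundary_measure \<Omega>) g \<and>
     (AE x in boundary_measure \<Omega>.
        ((\<lambda>r. (LINT y:\<Omega> \<inter> ball x r|lebesgue. \<bar>w y - g x\<bar>) / r ^ DIM('a)) \<longlongrightarrow> 0) (at_right 0))"


subsection \<open>The Sobolev space on the boundary\<close>

definition tangential_gradient ::
    "'a::euclidean_space set \<Rightarrow> ('a \<Rightarrow> real) \<Rightarrow> 'a \<Rightarrow> 'a" where
  "tangential_gradient \<Omega> \<phi> x =
     gradient \<phi> x - (gradient \<phi> x \<bullet> outer_normal \<Omega> x) *\<^sub>R outer_normal \<Omega> x"

text \<open>The Sobolev space \<open>H\<^sup>1\<close> of the boundary is the completion of the continuously differentiable
  functions, and the surface gradient of its elements is the corresponding extension (closure) of the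
  tangential gradient. On a smooth boundary this closure is single-valued modulo null sets: \<open>G\<close> is the
  surface gradient of \<open>w\<close>.\<close>

definition has_surface_gradient ::
    "'a::euclidean_space set \<Rightarrow> ('a \<Rightarrow> real) \<Rightarrow> ('a \<Rightarrow> 'a) \<Rightarrow> bool" where
  "has_surface_gradient \<Omega> w G \<longleftrightarrow> (\<exists>\<phi> :: nat \<Rightarrow> 'a \<Rightarrow> real.
     (\<forall>k. Ck_on 1 (\<phi> k) UNIV) \<and>
     L2_converges (boundary_measure \<Omega>) \<phi> w \<and>
     L2_converges (boundary_measure \<Omega>) (\<lambda>k. tangential_gradient \<Omega> (\<phi> k)) G)"

definition H1_boundary :: "'a::euclidean_space set \<Rightarrow> ('a \<Rightarrow> real) set" where
  "H1_boundary \<Omega> = {w. \<exists>G. has_surface_gradient \<Omega> w G}"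

text \<open>The same space, with each element accompanied by its surface gradient, so that the \<open>H\<^sup>1\<close> distance
  can be written down.\<close>

definition H1_boundary_pairs :: "'a::euclidean_space set \<Rightarrow> (('a \<Rightarrow> real) \<times> ('a \<Rightarrow> 'a)) set" where
  "H1_boundary_pairs \<Omega> = {(w, G). has_surface_gradient \<Omega> w G}"

definition H1_norm ::
    "'a::euclidean_space set \<Rightarrow> ('a \<Rightarrow> real) \<times> ('a \<Rightarrow> 'a) \<Rightarrow> real" where
  "H1_norm \<Omega> p = sqrt ((L2_norm (boundary_measure \<Omega>) (fst p))\<^sup>2 +
                       (L2_norm (boundary_measure \<Omega>) (snd p))\<^sup>2)"

definition H1_dist ::
    "'a::euclidean_space set \<Rightarrow> ('a \<Rightarrow> real) \<times> ('a \<Rightarrow> 'a) \<Rightarrow> ('a \<Rightarrow> real) \<times> ('a \<Rightarrow> 'a) \<Rightarrow> real" where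
  "H1_dist \<Omega> p q = H1_norm \<Omega> (\<lambda>x. fst p x - fst q x, \<lambda>x. snd p x - snd q x)"


subsection \<open>Vector-valued functions of time\<close>

text \<open>Bochner measurability and integrability for functions of time with values in a space of functions.
  A space is given by a carrier \<open>X\<close> and its (pseudo-)distance \<open>d\<close>; the library's Bochner integral needs
  a Banach space that is a type, whereas the spaces here depend on the domain.\<close>

definition simple_valued :: "real set \<Rightarrow> 'e set \<Rightarrow> (real \<Rightarrow> 'e) \<Rightarrow> bool" where
  "simple_valued I X s \<longleftrightarrow>
     finite (s ` I) \<and> s ` I \<subseteq> X \<and> (\<forall>y. {t\<in>I. s t = y} \<in> sets lebesgue)"

definition strongly_measurable ::
    "real set \<Rightarrow> 'e set \<Rightarrow> ('e \<Rightarrow> 'e \<Rightarrow> real) \<Rightarrow> (real \<Rightarrow> 'e) \<Rightarrow> bool" where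
  "strongly_measurable I X d v \<longleftrightarrow> (\<exists>s :: nat \<Rightarrow> real \<Rightarrow> 'e.
     (\<forall>k. simple_valued I X (s k)) \<and>
     (AE t in lebesgue_on I. v t \<in> X \<and> (\<lambda>k. d (s k t) (v t)) \<longlonglongrightarrow> 0))"

definition L2_Bochner :: "real \<Rightarrow> 'a measure \<Rightarrow> (real \<Rightarrow> 'a \<Rightarrow> real) \<Rightarrow> bool" where
  "L2_Bochner T M v \<longleftrightarrow>
     strongly_measurable {0<..<T} (L2 M) (L2_dist M) v \<and>
     integrable (lebesgue_on {0<..<T}) (\<lambda>t. (L2_norm M (v t))\<^sup>2)"

text \<open>\<open>w\<close> is the Bochner integral of \<open>v\<close> over \<open>I\<close> in \<open>L\<^sup>2\<close>. The integral of a simple function, which is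
  a finite sum, may be computed pointwise.\<close>

definition has_L2_integral ::
    "real set \<Rightarrow> 'a measure \<Rightarrow> (real \<Rightarrow> 'a \<Rightarrow> real) \<Rightarrow> ('a \<Rightarrow> real) \<Rightarrow> bool" where
  "has_L2_integral I M v w \<longleftrightarrow>
     strongly_measurable I (L2 M) (L2_dist M) v \<and> w \<in> L2 M \<and>
     (\<exists>s :: nat \<Rightarrow> real \<Rightarrow> 'a \<Rightarrow> real.
        (\<forall>k. simple_valued I (L2 M) (s k)) \<and>
        (\<lambda>k. \<integral>\<^sup>+t. ennreal (L2_dist M (s k t) (v t)) \<partial>lebesgue_on I) \<longlonglongrightarrow> 0 \<and>
        (\<lambda>k. L2_dist M (\<lambda>x. LINT t|lebesgue_on I. s k t x) w) \<longlonglongrightarrow> 0)"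

definition has_weak_time_derivative ::
    "real \<Rightarrow> 'a measure \<Rightarrow> (real \<Rightarrow> 'a \<Rightarrow> real) \<Rightarrow> (real \<Rightarrow> 'a \<Rightarrow> real) \<Rightarrow> bool" where
  "has_weak_time_derivative T M u u' \<longleftrightarrow>
     (\<forall>\<phi> :: real \<Rightarrow> real. C1_compact_support {0<..<T} \<phi> \<longrightarrow>
        (\<exists>w. has_L2_integral {0<..<T} M (\<lambda>t x. deriv \<phi> t * u t x) w \<and>
             has_L2_integral {0<..<T} M (\<lambda>t x. - \<phi> t * u' t x) w))"

text \<open>\<open>u\<close> is the continuous representative on \<open>[0, T]\<close> of an element of \<open>W\<^sup>1\<^sup>,\<^sup>2(0, T; L\<^sup>2)\<close> with weak
  derivative \<open>u'\<close>.\<close>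

definition W12_with_derivative ::
    "real \<Rightarrow> 'a measure \<Rightarrow> (real \<Rightarrow> 'a \<Rightarrow> real) \<Rightarrow> (real \<Rightarrow> 'a \<Rightarrow> real) \<Rightarrow> bool" where
  "W12_with_derivative T M u u' \<longleftrightarrow>
     L2_Bochner T M u \<and> L2_Bochner T M u' \<and> has_weak_time_derivative T M u u' \<and>
     (\<forall>t\<in>{0..T}. u t \<in> L2 M \<and> ((\<lambda>s. L2_dist M (u s) (u t)) \<longlongrightarrow> 0) (at t within {0..T}))"

definition Linfty :: "real \<Rightarrow> (real \<Rightarrow> real) \<Rightarrow> bool" where
  "Linfty T f \<longleftrightarrow> f \<in> borel_measurable (lebesgue_on {0<..<T}) \<and>
     (\<exists>C. AE t in lebesgue_on {0<..<T}. \<bar>f t\<bar> \<le> C)"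

definition Linfty_H1_boundary ::
    "real \<Rightarrow> 'a::euclidean_space set \<Rightarrow> (real \<Rightarrow> 'a \<Rightarrow> real) \<Rightarrow> (real \<Rightarrow> 'a \<Rightarrow> 'a) \<Rightarrow> bool" where
  "Linfty_H1_boundary T \<Omega> v G \<longleftrightarrow>
     strongly_measurable {0<..<T} (H1_boundary_pairs \<Omega>) (H1_dist \<Omega>) (\<lambda>t. (v t, G t)) \<and>
     (\<exists>C. AE t in lebesgue_on {0<..<T}. H1_norm \<Omega> (v t, G t) \<le> C)"


subsection \<open>Weak solutions\<close>

text \<open>\<open>u'\<close> and \<open>u\<^sub>\<Gamma>'\<close> are the time derivatives, \<open>G\<close> the surface gradient of \<open>u\<^sub>\<Gamma>\<close>, \<open>g\<close> the trace of
  \<open>u t\<close>; \<open>h\<close> and \<open>Z\<close> are the trace of \<open>z\<close> and the surface gradient of \<open>z\<^sub>\<Gamma>\<close>. All of them exist and are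
  unique up to null sets as soon as the functions belong to the respective spaces.\<close>

definition weak_solution ::
    "real \<Rightarrow> real \<Rightarrow> 'a::euclidean_space set \<Rightarrow> ('a \<Rightarrow> real) \<Rightarrow> ('a \<Rightarrow> real) \<Rightarrow>
     (real \<Rightarrow> 'a \<Rightarrow> real) \<Rightarrow> (real \<Rightarrow> 'a \<Rightarrow> real) \<Rightarrow>
     (real \<Rightarrow> 'a \<Rightarrow> real) \<Rightarrow> (real \<Rightarrow> 'a \<Rightarrow> real) \<Rightarrow> bool" where
  "weak_solution \<epsilon> T \<Omega> u\<^sub>0 u\<^sub>\<Gamma>\<^sub>0 \<theta> \<theta>\<^sub>\<Gamma> u u\<^sub>\<Gamma> \<longleftrightarrow>
     L2_Bochner T (lebesgue_on \<Omega>) u \<and> L2_Bochner T (boundary_measure \<Omega>) u\<^sub>\<Gamma> \<and>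
     (AE t in lebesgue_on {0<..<T}. u t \<in> BV \<Omega>) \<and>
     Linfty T (\<lambda>t. total_variation \<Omega> (u t)) \<and>
     (AE x in lebesgue_on \<Omega>. u 0 x = u\<^sub>0 x) \<and>
     (AE x in boundary_measure \<Omega>. u\<^sub>\<Gamma> 0 x = u\<^sub>\<Gamma>\<^sub>0 x) \<and>
     (\<exists>u' u\<^sub>\<Gamma>' G.
        W12_with_derivative T (lebesgue_on \<Omega>) u u' \<and>
        W12_with_derivative T (boundary_measure \<Omega>) u\<^sub>\<Gamma> u\<^sub>\<Gamma>' \<and>
        Linfty_H1_boundary T \<Omega> u\<^sub>\<Gamma> G \<and>
        (AE t in lebesgue_on {0<..<T}. \<exists>g. has_trace \<Omega> (u t) g \<and>
          (\<forall>z z\<^sub>\<Gamma> h Z.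
             z \<in> BV \<Omega> \<inter> L2 (lebesgue_on \<Omega>) \<longrightarrow> has_trace \<Omega> z h \<longrightarrow>
             z\<^sub>\<Gamma> \<in> H1_boundary \<Omega> \<longrightarrow> has_surface_gradient \<Omega> z\<^sub>\<Gamma> Z \<longrightarrow>
             (LINT x|lebesgue_on \<Omega>. (u' t x - \<theta> t x) * (u t x - z x))
               + total_variation \<Omega> (u t)
               + (LINT x|boundary_measure \<Omega>. \<bar>g x - u\<^sub>\<Gamma> t x\<bar>)
               + (LINT x|boundary_measure \<Omega>. (u\<^sub>\<Gamma>' t x - \<theta>\<^sub>\<Gamma> t x) * (u\<^sub>\<Gamma> t x - z\<^sub>\<Gamma> x))
               + \<epsilon>\<^sup>2 * (LINT x|boundary_measure \<Omega>. G t x \<bullet> (G t x - Z x))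
             \<le> total_variation \<Omega> z + (LINT x|boundary_measure \<Omega>. \<bar>h x - z\<^sub>\<Gamma> x\<bar>))))"

end

theory Submission
  imports Defs
begin

text \<open>
  The stationary part of the system is the subdifferential of the convex energy
  \<open>u, v \<mapsto> \<integral>|Du| + \<integral>\<^sub>\<Gamma> |u - v| + (\<epsilon>\<^sup>2/2) \<integral>\<^sub>\<Gamma> |\<nabla>\<^sub>\<Gamma> v|\<^sup>2\<close>, and this energy is submodular: passing from two pairs to
  their pointwise minimum and maximum does not increase the sum of the energies. Therefore, testing the
  first solution with the minimum and the second with the maximum of the two solutions and adding
  the inequalities makes all energy terms cancel with the right sign. What remains, at almost every time,
  is an upper bound for the pairing of the time derivative of \<open>u\<^sub>1 - u\<^sub>2\<close> with \<open>(u\<^sub>1 - u\<^sub>2)\<^sup>+\<close> by the pairing of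
  \<open>\<theta>\<^sub>1 - \<theta>\<^sub>2\<close> with the same function, in the domain and on the boundary together
  (\<open>variational_inequality_comparison\<close>). The pairing with the time derivative is half of the derivative of the
  squared norm of the positive part, and Gronwall's inequality gives the claim.

  Submodularity has three parts. For the boundary mismatch it is an inequality between four
  numbers, once minimum and maximum are known to have the expected traces (\<open>has_trace_lattice\<close>). For the surface
  energy one needs that the positive part of an \<open>H\<^sup>1\<close> function has as surface gradient a multiple, with
  factor between zero and one, of the original gradient (\<open>has_surface_gradient_pos\<close>). For the total
  variation (\<open>total_variation_min_max\<close>) both functions are mollified. The gradients of a smooth
  approximation of the maximum and of the minimum are convex combinations of the two gradients with
  interchanged weights, and in the dual formulation the weights can be shifted to the test fields,
  which keep length at most one (\<open>smooth_submodularity\<close>, \<open>submodularity_test_fields\<close>).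

  In time, functions with a weak derivative are handled by pairing with a fixed element of \<open>L\<^sup>2\<close>, which
  reduces the fundamental theorem of calculus to real functions (\<open>W12_inner_primitive\<close>). The chain rule and
  Gronwall's inequality are then obtained by adding increments along fine partitions, from convexity
  and uniform continuity alone (\<open>negligible_increments_imp_le\<close>).

  The boundary mismatch is a meaningful integral because the boundary has finite area: locally it is a
  Lipschitz graph, which is covered economically by a grid (\<open>finite_boundary_measure\<close>).
\<close>

section \<open>Square-integrable functions\<close>

lemma L2_measurable: "f \<in> L2 M \<Longrightarrow> f \<in> borel_measurable M"
  and L2_integrable: "f \<in> L2 M \<Longrightarrow> integrable M (\<lambda>x. (norm (f x))\<^sup>2)"
  by (auto simp: L2_def)

lemma L2_inner_integrable:
  fixes f g :: "'a \<Rightarrow> 'b::euclidean_space"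
  assumes "f \<in> L2 M" "g \<in> L2 M"
  shows "integrable M (\<lambda>x. f x \<bullet> g x)"
proof (rule Bochner_Integration.integrable_bound)
  show "integrable M (\<lambda>x. (norm (f x))\<^sup>2 + (norm (g x))\<^sup>2)"
    using assms by (auto simp: L2_def)
  show "(\<lambda>x. f x \<bullet> g x) \<in> borel_measurable M"
    using assms by (auto simp: L2_def)
  have "\<bar>a \<bullet> b\<bar> \<le> (norm a)\<^sup>2 + (norm b)\<^sup>2" for a b :: 'b
  proof -
    have "2 * (norm a * norm b) \<le> (norm a)\<^sup>2 + (norm b)\<^sup>2"
      using sum_squares_bound[of "norm a" "norm b"] by (simp add: mult.assoc)
    moreover have "0 \<le> norm a * norm b" by simp
    ultimately show ?thesis using Cauchy_Schwarz_ineq2[of a b] by linarith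
  qed
  then show "AE x in M. norm (f x \<bullet> g x) \<le> norm ((norm (f x))\<^sup>2 + (norm (g x))\<^sup>2)"
    by auto
qed

lemma L2_mult_integrable:
  fixes f g :: "'a \<Rightarrow> real"
  assumes "f \<in> L2 M" "g \<in> L2 M"
  shows "integrable M (\<lambda>x. f x * g x)"
  using L2_inner_integrable[OF assms] by simp

lemma L2_bound:
  fixes f :: "'a \<Rightarrow> 'b::euclidean_space" and g :: "'a \<Rightarrow> 'c::euclidean_space"
  assumes "g \<in> L2 M" "f \<in> borel_measurable M" "\<And>x. x \<in> space M \<Longrightarrow> norm (f x) \<le> norm (g x)"
  shows "f \<in> L2 M"
proof -
  have "integrable M (\<lambda>x. (norm (f x))\<^sup>2)"
    by (rule Bochner_Integration.integrable_bound[OF L2_integrable[OF assms(1)]])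
       (use assms(2,3) in \<open>auto intro!: AE_I2 power_mono\<close>)
  then show ?thesis using assms(2) by (simp add: L2_def)
qed

lemma L2_norm_fun:
  fixes f :: "'a \<Rightarrow> 'b::euclidean_space"
  assumes "f \<in> L2 M"
  shows "(\<lambda>x. norm (f x)) \<in> L2 M"
  using assms unfolding L2_def by (auto intro: borel_measurable_norm)

lemma L2_add:
  fixes f g :: "'a \<Rightarrow> 'b::euclidean_space"
  assumes "f \<in> L2 M" "g \<in> L2 M"
  shows "(\<lambda>x. f x + g x) \<in> L2 M"
proof -
  have "integrable M (\<lambda>x. (norm (f x))\<^sup>2 + (norm (g x))\<^sup>2 + 2 * (f x \<bullet> g x))"
    using assms by (intro Bochner_Integration.integrable_add integrable_mult_right
        L2_inner_integrable L2_integrable) auto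
  moreover have "(norm (a + b))\<^sup>2 = (norm a)\<^sup>2 + (norm b)\<^sup>2 + 2 * (a \<bullet> b)" for a b :: 'b
    by (simp add: power2_norm_eq_inner inner_add_left inner_add_right inner_commute)
  moreover have "(\<lambda>x. f x + g x) \<in> borel_measurable M"
    using assms by (intro borel_measurable_add L2_measurable)
  ultimately show ?thesis by (simp add: L2_def)
qed

lemma L2_scale:
  fixes f :: "'a \<Rightarrow> 'b::euclidean_space"
  assumes "f \<in> L2 M"
  shows "(\<lambda>x. c *\<^sub>R f x) \<in> L2 M"
  using assms by (auto simp: L2_def power_mult_distrib)

lemma L2_diff:
  fixes f g :: "'a \<Rightarrow> 'b::euclidean_space"
  assumes "f \<in> L2 M" "g \<in> L2 M"
  shows "(\<lambda>x. f x - g x) \<in> L2 M"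
  using L2_add[OF assms(1) L2_scale[OF assms(2), of "-1"]] by simp

lemma L2_zero: "(\<lambda>x. 0) \<in> L2 M"
  by (simp add: L2_def)

lemma L2_pos:
  fixes f :: "'a \<Rightarrow> real"
  assumes "f \<in> L2 M"
  shows "(\<lambda>x. max (f x) 0) \<in> L2 M"
  by (rule L2_bound[OF assms]) (use L2_measurable[OF assms] in auto)

lemma L2_min:
  fixes f g :: "'a \<Rightarrow> real"
  assumes "f \<in> L2 M" "g \<in> L2 M"
  shows "(\<lambda>x. min (f x) (g x)) \<in> L2 M"
proof -
  have "(\<lambda>x. f x - max (f x - g x) 0) \<in> L2 M"
    by (intro L2_diff L2_pos assms)
  also have "(\<lambda>x. f x - max (f x - g x) 0) = (\<lambda>x. min (f x) (g x))" by auto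
  finally show ?thesis .
qed

lemma L2_max:
  fixes f g :: "'a \<Rightarrow> real"
  assumes "f \<in> L2 M" "g \<in> L2 M"
  shows "(\<lambda>x. max (f x) (g x)) \<in> L2 M"
proof -
  have "(\<lambda>x. g x + max (f x - g x) 0) \<in> L2 M"
    by (intro L2_diff L2_pos L2_add assms)
  also have "(\<lambda>x. g x + max (f x - g x) 0) = (\<lambda>x. max (f x) (g x))" by auto
  finally show ?thesis .
qed

lemma L2_norm_nonneg: "0 \<le> L2_norm M f"
  by (simp add: L2_norm_def)

lemma L2_norm_power2: "(L2_norm M f)\<^sup>2 = (LINT x|M. (norm (f x))\<^sup>2)"
  by (simp add: L2_norm_def)

lemma L2_norm_inner:
  fixes f :: "'a \<Rightarrow> 'b::euclidean_space"
  shows "(L2_norm M f)\<^sup>2 = (LINT x|M. f x \<bullet> f x)"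
  by (simp add: L2_norm_power2 power2_norm_eq_inner)

lemma L2_norm_mult:
  fixes f :: "'a \<Rightarrow> real"
  shows "(L2_norm M f)\<^sup>2 = (LINT x|M. f x * f x)"
  using L2_norm_inner[of M f] by simp

lemma L2_Cauchy_Schwarz_norm:
  fixes f g :: "'a \<Rightarrow> 'b::euclidean_space"
  assumes "f \<in> L2 M" "g \<in> L2 M"
  shows "\<bar>LINT x|M. f x \<bullet> g x\<bar> \<le> L2_norm M f * L2_norm M g"
proof (rule field_le_epsilon)
  let ?A = "L2_norm M f" and ?C = "L2_norm M g"
  \<comment> \<open>Weighted arithmetic-geometric mean with weights slightly above the two norms, so that
    they are positive even if a norm vanishes.\<close>
  have weighted: "\<bar>LINT x|M. f x \<bullet> g x\<bar> \<le> a * c" if "?A < a" "?C < c" for a c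
  proof -
    have pos: "0 < a" "0 < c" using that L2_norm_nonneg[of M f] L2_norm_nonneg[of M g] by linarith+
    have "2 * \<bar>u \<bullet> v\<bar> \<le> (c / a) * (norm u)\<^sup>2 + (a / c) * (norm v)\<^sup>2" for u v :: 'b
    proof -
      have "0 \<le> (sqrt (c / a) * norm u - sqrt (a / c) * norm v)\<^sup>2" by simp
      also have "\<dots> = (c / a) * (norm u)\<^sup>2 + (a / c) * (norm v)\<^sup>2 - 2 * (norm u * norm v)"
        using pos by (simp add: power2_diff power_mult_distrib real_sqrt_divide field_simps)
      finally show ?thesis using Cauchy_Schwarz_ineq2[of u v] by linarith
    qed
    then have "(LINT x|M. 2 * \<bar>f x \<bullet> g x\<bar>)
        \<le> (LINT x|M. (c / a) * (norm (f x))\<^sup>2 + (a / c) * (norm (g x))\<^sup>2)"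
      by (intro integral_mono L2_inner_integrable integrable_abs Bochner_Integration.integrable_add
          integrable_mult_right assms L2_integrable)
    also have "\<dots> = (c / a) * ?A\<^sup>2 + (a / c) * ?C\<^sup>2"
      using assms by (subst Bochner_Integration.integral_add) (auto simp: L2_integrable L2_norm_power2)
    also have "\<dots> \<le> (c / a) * a\<^sup>2 + (a / c) * c\<^sup>2"
      using that pos by (intro add_mono mult_left_mono power_mono) (auto simp: L2_norm_nonneg)
    also have "\<dots> = 2 * (a * c)" using pos by (simp add: power2_eq_square)
    finally have "(LINT x|M. \<bar>f x \<bullet> g x\<bar>) \<le> a * c" by simp
    then show ?thesis using integral_abs_bound[of M "\<lambda>x. f x \<bullet> g x"] by linarith
  qed
  fix e :: real assume e: "0 < e"
  have "((\<lambda>d. (?A + d) * (?C + d)) \<longlongrightarrow> (?A + 0) * (?C + 0)) (at_right 0)"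
    by (intro tendsto_intros)
  then have "((\<lambda>d. (?A + d) * (?C + d)) \<longlongrightarrow> ?A * ?C) (at_right 0)" by simp
  moreover have "\<forall>\<^sub>F d in at_right 0. \<bar>LINT x|M. f x \<bullet> g x\<bar> \<le> (?A + d) * (?C + d)"
    using eventually_at_right_less[of "0::real"] by eventually_elim (rule weighted, auto)
  ultimately have "\<bar>LINT x|M. f x \<bullet> g x\<bar> \<le> ?A * ?C"
    by (intro tendsto_lowerbound) auto
  then show "\<bar>LINT x|M. f x \<bullet> g x\<bar> \<le> ?A * ?C + e" using e by simp
qed

lemma L2_Cauchy_Schwarz:
  fixes f g :: "'a \<Rightarrow> real"
  assumes "f \<in> L2 M" "g \<in> L2 M"
  shows "\<bar>LINT x|M. f x * g x\<bar> \<le> L2_norm M f * L2_norm M g"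
  using L2_Cauchy_Schwarz_norm[OF assms] by simp

lemma L2_norm_triangle:
  fixes f g :: "'a \<Rightarrow> 'b::euclidean_space"
  assumes "f \<in> L2 M" "g \<in> L2 M"
  shows "L2_norm M (\<lambda>x. f x + g x) \<le> L2_norm M f + L2_norm M g"
proof (rule power2_le_imp_le)
  note I = L2_inner_integrable assms
  have "(L2_norm M (\<lambda>x. f x + g x))\<^sup>2
      = (LINT x|M. f x \<bullet> f x + (2 * (f x \<bullet> g x) + g x \<bullet> g x))"
    unfolding L2_norm_inner by (simp add: algebra_simps inner_commute)
  also have "\<dots> = (LINT x|M. f x \<bullet> f x) + (2 * (LINT x|M. f x \<bullet> g x) + (LINT x|M. g x \<bullet> g x))"
    by (simp add: I)
  also have "\<dots> \<le> (L2_norm M f + L2_norm M g)\<^sup>2"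
    using L2_Cauchy_Schwarz_norm[OF assms]
    by (simp add: L2_norm_inner[symmetric] power2_sum)
  finally show "(L2_norm M (\<lambda>x. f x + g x))\<^sup>2 \<le> (L2_norm M f + L2_norm M g)\<^sup>2" .
qed (simp add: L2_norm_nonneg)

lemma L2_norm_mono:
  fixes f :: "'a \<Rightarrow> 'b::euclidean_space" and g :: "'a \<Rightarrow> 'c::euclidean_space"
  assumes "f \<in> borel_measurable M" "g \<in> L2 M" "\<And>x. x \<in> space M \<Longrightarrow> norm (f x) \<le> norm (g x)"
  shows "L2_norm M f \<le> L2_norm M g"
  unfolding L2_norm_def
  using L2_bound[OF assms(2,1,3)] assms
  by (intro real_sqrt_le_mono integral_mono) (auto simp: L2_integrable intro!: power_mono)

lemma L2_norm_scale:
  fixes f :: "'a \<Rightarrow> 'b::euclidean_space"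
  shows "L2_norm M (\<lambda>x. c *\<^sub>R f x) = \<bar>c\<bar> * L2_norm M f"
  by (simp add: L2_norm_def power_mult_distrib real_sqrt_mult)

lemma L2_dist_nonneg: "0 \<le> L2_dist M f g"
  by (simp add: L2_dist_def L2_norm_nonneg)

lemma L2_dist_commute: "L2_dist M f g = L2_dist M g f"
  by (simp add: L2_dist_def L2_norm_def norm_minus_commute)

lemma L2_dist_triangle:
  fixes f g h :: "'a \<Rightarrow> 'b::euclidean_space"
  assumes "f \<in> L2 M" "g \<in> L2 M" "h \<in> L2 M"
  shows "L2_dist M f h \<le> L2_dist M f g + L2_dist M g h"
  using L2_norm_triangle[OF L2_diff[OF assms(1,2)] L2_diff[OF assms(2,3)]]
  by (simp add: L2_dist_def)

lemma L2_norm_le_dist: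
  fixes f g :: "'a \<Rightarrow> 'b::euclidean_space"
  assumes "f \<in> L2 M" "g \<in> L2 M"
  shows "\<bar>L2_norm M f - L2_norm M g\<bar> \<le> L2_dist M f g"
proof -
  have "L2_norm M f \<le> L2_norm M g + L2_dist M f g"
    using L2_norm_triangle[OF assms(2) L2_diff[OF assms]] by (simp add: L2_dist_def)
  moreover have "L2_norm M g \<le> L2_norm M f + L2_dist M g f"
    using L2_norm_triangle[OF assms(1) L2_diff[OF assms(2,1)]] by (simp add: L2_dist_def)
  ultimately show ?thesis by (simp add: L2_dist_commute)
qed

lemma L2_dist_add:
  fixes f g :: "'a \<Rightarrow> 'b::euclidean_space"
  assumes "f \<in> L2 M" "g \<in> L2 M" "f' \<in> L2 M" "g' \<in> L2 M"
  shows "L2_dist M (\<lambda>x. f x + g x) (\<lambda>x. f' x + g' x) \<le> L2_dist M f f' + L2_dist M g g'"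
  using L2_norm_triangle[OF L2_diff[OF assms(1,3)] L2_diff[OF assms(2,4)]]
  by (simp add: L2_dist_def algebra_simps)

lemma L2_dist_diff:
  fixes f g :: "'a \<Rightarrow> 'b::euclidean_space"
  assumes "f \<in> L2 M" "g \<in> L2 M" "f' \<in> L2 M" "g' \<in> L2 M"
  shows "L2_dist M (\<lambda>x. f x - g x) (\<lambda>x. f' x - g' x) \<le> L2_dist M f f' + L2_dist M g g'"
  using L2_norm_triangle[OF L2_diff[OF assms(1,3)] L2_diff[OF assms(4,2)]] L2_dist_commute[of M g g']
  by (simp add: L2_dist_def algebra_simps)

lemma L2_dist_pos:
  fixes f g :: "'a \<Rightarrow> real"
  assumes "f \<in> L2 M" "g \<in> L2 M"
  shows "L2_dist M (\<lambda>x. max (f x) 0) (\<lambda>x. max (g x) 0) \<le> L2_dist M f g"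
  unfolding L2_dist_def
  using L2_diff[OF assms] L2_measurable[OF assms(1)] L2_measurable[OF assms(2)]
  by (intro L2_norm_mono) auto

lemma tendsto_L2_norm:
  fixes f :: "'c \<Rightarrow> 'a \<Rightarrow> 'b::euclidean_space"
  assumes "\<forall>\<^sub>F k in F. f k \<in> L2 M" "g \<in> L2 M" "((\<lambda>k. L2_dist M (f k) g) \<longlongrightarrow> 0) F"
  shows "((\<lambda>k. L2_norm M (f k)) \<longlongrightarrow> L2_norm M g) F"
proof (rule Lim_transform_eventually[of "\<lambda>k. L2_norm M g + (L2_norm M (f k) - L2_norm M g)"])
  have "((\<lambda>k. L2_norm M (f k) - L2_norm M g) \<longlongrightarrow> 0) F"
    by (rule Lim_null_comparison[OF _ assms(3)])
       (use assms(1) in eventually_elim, use assms(2) L2_norm_le_dist in auto)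
  then show "((\<lambda>k. L2_norm M g + (L2_norm M (f k) - L2_norm M g)) \<longlongrightarrow> L2_norm M g) F"
    by (rule tendsto_add[OF tendsto_const, where b = 0, simplified])
qed auto

lemma tendsto_L2_inner:
  fixes f g :: "'c \<Rightarrow> 'a \<Rightarrow> real"
  assumes f: "\<forall>\<^sub>F k in F. f k \<in> L2 M" "f0 \<in> L2 M" "((\<lambda>k. L2_dist M (f k) f0) \<longlongrightarrow> 0) F"
    and g: "\<forall>\<^sub>F k in F. g k \<in> L2 M" "g0 \<in> L2 M" "((\<lambda>k. L2_dist M (g k) g0) \<longlongrightarrow> 0) F"
  shows "((\<lambda>k. LINT x|M. f k x * g k x) \<longlongrightarrow> (LINT x|M. f0 x * g0 x)) F"
proof (rule Lim_transform)
  show "((\<lambda>k. LINT x|M. f0 x * g0 x) \<longlongrightarrow> (LINT x|M. f0 x * g0 x)) F" by simp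
  have "((\<lambda>k. L2_dist M (f k) f0 * L2_norm M (g k) + L2_norm M f0 * L2_dist M (g k) g0)
      \<longlongrightarrow> 0 * L2_norm M g0 + L2_norm M f0 * 0) F"
    using f g by (intro tendsto_intros tendsto_L2_norm)
  then have lim: "((\<lambda>k. L2_dist M (f k) f0 * L2_norm M (g k) + L2_norm M f0 * L2_dist M (g k) g0) \<longlongrightarrow> 0) F"
    by simp
  have est: "norm ((LINT x|M. f0 x * g0 x) - (LINT x|M. u x * v x))
      \<le> L2_dist M u f0 * L2_norm M v + L2_norm M f0 * L2_dist M v g0"
    if u: "u \<in> L2 M" and v: "v \<in> L2 M" for u v
  proof -
    have "(LINT x|M. u x * v x) - (LINT x|M. f0 x * g0 x)
        = (LINT x|M. (u x - f0 x) * v x + f0 x * (v x - g0 x))"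
      using u v f(2) g(2) by (subst Bochner_Integration.integral_diff[symmetric])
        (auto intro!: L2_mult_integrable Bochner_Integration.integral_cong simp: algebra_simps)
    also have "\<dots> = (LINT x|M. (u x - f0 x) * v x) + (LINT x|M. f0 x * (v x - g0 x))"
      using u v f(2) g(2)
      by (intro Bochner_Integration.integral_add L2_mult_integrable L2_diff) auto
    finally show ?thesis
      using L2_Cauchy_Schwarz[OF L2_diff[OF u f(2)] v] L2_Cauchy_Schwarz[OF f(2) L2_diff[OF v g(2)]]
      by (simp add: L2_dist_def)
  qed
  have "((\<lambda>k. (LINT x|M. f0 x * g0 x) - (LINT x|M. f k x * g k x)) \<longlongrightarrow> 0) F"
    by (rule Lim_null_comparison[OF _ lim])
       (use f(1) g(1) in eventually_elim, use est in auto)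
  then show "((\<lambda>k. (LINT x|M. f k x * g k x) - (LINT x|M. f0 x * g0 x)) \<longlongrightarrow> 0) F"
    using tendsto_minus by fastforce
qed

section \<open>Measurability in time\<close>

lemma strongly_measurable_AE: "strongly_measurable I X d v \<Longrightarrow> AE t in lebesgue_on I. v t \<in> X"
  unfolding strongly_measurable_def by (elim exE conjE) (auto elim: eventually_mono)

lemma simple_valued_compose2:
  assumes s: "simple_valued I X s" and r: "simple_valued I Y r"
    and F: "\<And>x y. x \<in> X \<Longrightarrow> y \<in> Y \<Longrightarrow> F x y \<in> Z"
  shows "simple_valued I Z (\<lambda>t. F (s t) (r t))"
  unfolding simple_valued_def
proof (intro conjI allI)
  let ?P = "s ` I \<times> r ` I"
  have fin: "finite ?P" using s r by (auto simp: simple_valued_def)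
  have "(\<lambda>t. F (s t) (r t)) ` I \<subseteq> (\<lambda>(x, y). F x y) ` ?P" by auto
  then show "finite ((\<lambda>t. F (s t) (r t)) ` I)" using fin finite_surj by blast
  show "(\<lambda>t. F (s t) (r t)) ` I \<subseteq> Z" using s r F by (auto simp: simple_valued_def image_subset_iff)
  fix z
  have "{t \<in> I. F (s t) (r t) = z}
      = (\<Union>p\<in>{p\<in>?P. F (fst p) (snd p) = z}. {t\<in>I. s t = fst p} \<inter> {t\<in>I. r t = snd p})"
    by force
  also have "\<dots> \<in> sets lebesgue"
    using fin s r by (intro sets.finite_UN sets.Int) (auto simp: simple_valued_def)
  finally show "{t \<in> I. F (s t) (r t) = z} \<in> sets lebesgue" .
qed

text \<open>Strong measurability passes through a sequentially continuous map of two arguments, because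
  such a map may be applied to the approximating simple functions.\<close>

lemma strongly_measurable_compose2:
  assumes v: "strongly_measurable I X dX v" and w: "strongly_measurable I Y dY w"
    and F: "\<And>x y. x \<in> X \<Longrightarrow> y \<in> Y \<Longrightarrow> F x y \<in> Z"
    and cont: "\<And>s r x y. (\<And>k::nat. s k \<in> X) \<Longrightarrow> (\<And>k. r k \<in> Y) \<Longrightarrow> x \<in> X \<Longrightarrow> y \<in> Y \<Longrightarrow>
      (\<lambda>k. dX (s k) x) \<longlonglongrightarrow> 0 \<Longrightarrow> (\<lambda>k. dY (r k) y) \<longlonglongrightarrow> 0 \<Longrightarrow> (\<lambda>k. dZ (F (s k) (r k)) (F x y)) \<longlonglongrightarrow> 0"
  shows "strongly_measurable I Z dZ (\<lambda>t. F (v t) (w t))"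
proof -
  obtain s where s: "\<And>k. simple_valued I X (s k)"
      "AE t in lebesgue_on I. v t \<in> X \<and> (\<lambda>k. dX (s k t) (v t)) \<longlonglongrightarrow> 0"
    using v unfolding strongly_measurable_def by blast
  obtain r where r: "\<And>k. simple_valued I Y (r k)"
      "AE t in lebesgue_on I. w t \<in> Y \<and> (\<lambda>k. dY (r k t) (w t)) \<longlonglongrightarrow> 0"
    using w unfolding strongly_measurable_def by blast
  have *: "s k t \<in> X" "r k t \<in> Y" if "t \<in> I" for k t
    using s(1)[of k] r(1)[of k] that by (auto simp: simple_valued_def)
  have "AE t in lebesgue_on I. t \<in> I" by (rule AE_I2) auto
  then have "AE t in lebesgue_on I.
      F (v t) (w t) \<in> Z \<and> (\<lambda>k. dZ (F (s k t) (r k t)) (F (v t) (w t))) \<longlonglongrightarrow> 0"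
    using s(2) r(2) by eventually_elim (auto intro!: F cont *)
  then show ?thesis unfolding strongly_measurable_def
    using simple_valued_compose2[OF s(1) r(1) F] by (intro exI[of _ "\<lambda>k t. F (s k t) (r k t)"]) auto
qed

lemma simple_valued_measurable:
  fixes s :: "real \<Rightarrow> real"
  assumes "simple_valued I X s" "I \<in> sets lebesgue"
  shows "s \<in> borel_measurable (lebesgue_on I)"
proof -
  have "s -` {a} \<inter> space (lebesgue_on I) \<in> sets (lebesgue_on I)" for a
  proof -
    have "s -` {a} \<inter> space (lebesgue_on I) = {t \<in> I. s t = a}" by auto
    then show ?thesis
      using assms by (simp add: simple_valued_def sets_restrict_space_iff)
  qed
  then have "s \<in> measurable (lebesgue_on I) (count_space (s ` I))"
    using assms by (subst measurable_count_space_eq2) (auto simp: simple_valued_def)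
  then show ?thesis
    by (rule measurable_compose) simp
qed

lemma strongly_measurable_real:
  fixes f :: "real \<Rightarrow> real"
  assumes f: "strongly_measurable I UNIV dist f" and I: "I \<in> sets lebesgue"
  shows "f \<in> borel_measurable (lebesgue_on I)"
proof -
  obtain s where s: "\<And>k. simple_valued I UNIV (s k)" "AE t in lebesgue_on I. (\<lambda>k. dist (s k t) (f t)) \<longlonglongrightarrow> 0"
    using f unfolding strongly_measurable_def by auto
  have meas: "(\<lambda>t. lim (\<lambda>k. s k t)) \<in> borel_measurable (lebesgue_on I)"
    by (intro borel_measurable_lim_metric simple_valued_measurable[OF s(1) I])
  have "AE t in lebesgue_on I. lim (\<lambda>k. s k t) = f t"
    using s(2) by eventually_elim (rule limI, rule iffD2[OF tendsto_dist_iff])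
  then have "AE t in lebesgue. indicator I t *\<^sub>R lim (\<lambda>k. s k t) = indicator I t *\<^sub>R f t"
    using I by (subst (asm) AE_restrict_space_iff) (auto elim!: eventually_mono)
  moreover have "(\<lambda>t. indicator I t *\<^sub>R lim (\<lambda>k. s k t)) \<in> borel_measurable lebesgue"
    using meas I by (subst (asm) borel_measurable_restrict_space_iff) auto
  ultimately have "(\<lambda>t. indicator I t *\<^sub>R f t) \<in> borel_measurable lebesgue"
    by (rule borel_measurable_AE[rotated])
  then show ?thesis using I by (subst borel_measurable_restrict_space_iff) auto
qed

lemma strongly_measurable_L2_diff:
  fixes v w :: "real \<Rightarrow> 'a \<Rightarrow> real"
  assumes "strongly_measurable I (L2 M) (L2_dist M) v" "strongly_measurable I (L2 M) (L2_dist M) w"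
  shows "strongly_measurable I (L2 M) (L2_dist M) (\<lambda>t x. v t x - w t x)"
proof (rule strongly_measurable_compose2[OF assms, where F = "\<lambda>f g x. f x - g x"])
  fix s r :: "nat \<Rightarrow> 'a \<Rightarrow> real" and x y
  assume *: "\<And>k. s k \<in> L2 M" "\<And>k. r k \<in> L2 M" "x \<in> L2 M" "y \<in> L2 M"
    and lim: "(\<lambda>k. L2_dist M (s k) x) \<longlonglongrightarrow> 0" "(\<lambda>k. L2_dist M (r k) y) \<longlonglongrightarrow> 0"
  show "(\<lambda>k. L2_dist M (\<lambda>z. s k z - r k z) (\<lambda>z. x z - y z)) \<longlonglongrightarrow> 0"
    using * by (intro Lim_null_comparison[OF _ tendsto_add_zero[OF lim]])
      (auto intro!: always_eventually L2_dist_diff simp: L2_dist_nonneg)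
qed (auto intro: L2_diff)

lemma strongly_measurable_L2_pos:
  fixes v :: "real \<Rightarrow> 'a \<Rightarrow> real"
  assumes "strongly_measurable I (L2 M) (L2_dist M) v"
  shows "strongly_measurable I (L2 M) (L2_dist M) (\<lambda>t x. max (v t x) 0)"
proof (rule strongly_measurable_compose2[OF assms assms, where F = "\<lambda>f g x. max (f x) 0"])
  fix s r :: "nat \<Rightarrow> 'a \<Rightarrow> real" and x y
  assume *: "\<And>k. s k \<in> L2 M" "x \<in> L2 M" and lim: "(\<lambda>k. L2_dist M (s k) x) \<longlonglongrightarrow> 0"
  show "(\<lambda>k. L2_dist M (\<lambda>z. max (s k z) 0) (\<lambda>z. max (x z) 0)) \<longlonglongrightarrow> 0"
    using * by (intro Lim_null_comparison[OF _ lim])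
      (auto intro!: always_eventually L2_dist_pos simp: L2_dist_nonneg)
qed (auto intro: L2_pos)

lemma strongly_measurable_L2_inner:
  fixes v w :: "real \<Rightarrow> 'a \<Rightarrow> real"
  assumes "strongly_measurable I (L2 M) (L2_dist M) v" "strongly_measurable I (L2 M) (L2_dist M) w"
    and I: "I \<in> sets lebesgue"
  shows "(\<lambda>t. LINT x|M. v t x * w t x) \<in> borel_measurable (lebesgue_on I)"
proof (rule strongly_measurable_real[OF strongly_measurable_compose2
      [OF assms(1,2), where F = "\<lambda>f g. LINT x|M. f x * g x"] I])
  fix s r :: "nat \<Rightarrow> 'a \<Rightarrow> real" and x y
  assume *: "\<And>k. s k \<in> L2 M" "\<And>k. r k \<in> L2 M" "x \<in> L2 M" "y \<in> L2 M"
    and lim: "(\<lambda>k. L2_dist M (s k) x) \<longlonglongrightarrow> 0" "(\<lambda>k. L2_dist M (r k) y) \<longlonglongrightarrow> 0"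
  show "(\<lambda>k. dist (LINT z|M. s k z * r k z) (LINT z|M. x z * y z)) \<longlonglongrightarrow> 0"
    using * lim by (intro iffD1[OF tendsto_dist_iff] tendsto_L2_inner) auto
qed auto

lemma strongly_measurable_L2_norm_power2:
  fixes v :: "real \<Rightarrow> 'a \<Rightarrow> real"
  assumes "strongly_measurable I (L2 M) (L2_dist M) v" and I: "I \<in> sets lebesgue"
  shows "(\<lambda>t. (L2_norm M (v t))\<^sup>2) \<in> borel_measurable (lebesgue_on I)"
  using strongly_measurable_L2_inner[OF assms(1,1) I] by (simp add: L2_norm_mult)

lemma strongly_measurable_L2_norm:
  fixes v :: "real \<Rightarrow> 'a \<Rightarrow> real"
  assumes "strongly_measurable I (L2 M) (L2_dist M) v" and I: "I \<in> sets lebesgue"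
  shows "(\<lambda>t. L2_norm M (v t)) \<in> borel_measurable (lebesgue_on I)"
proof -
  have "(\<lambda>t. sqrt ((L2_norm M (v t))\<^sup>2)) \<in> borel_measurable (lebesgue_on I)"
    using strongly_measurable_L2_norm_power2[OF assms] by measurable
  then show ?thesis by (simp add: L2_norm_nonneg)
qed

lemma simple_valued_strongly_measurable:
  assumes "simple_valued I (L2 M) s" "I \<in> sets lebesgue"
  shows "strongly_measurable I (L2 M) (L2_dist M) s"
proof -
  have "AE t in lebesgue_on I. t \<in> I" by (rule AE_I2) auto
  then have "AE t in lebesgue_on I. s t \<in> L2 M \<and> (\<lambda>k. L2_dist M (s t) (s t)) \<longlonglongrightarrow> 0"
    by eventually_elim (use assms in \<open>auto simp: simple_valued_def L2_dist_def L2_norm_def\<close>)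
  then show ?thesis
    unfolding strongly_measurable_def using assms by (intro exI[of _ "\<lambda>k. s"]) auto
qed

lemma strongly_measurable_const:
  assumes "\<psi> \<in> L2 M" "I \<in> sets lebesgue"
  shows "strongly_measurable I (L2 M) (L2_dist M) (\<lambda>t. \<psi>)"
  using assms by (intro simple_valued_strongly_measurable) (auto simp: simple_valued_def image_constant_conv)

lemma L2_Bochner_AE: "L2_Bochner T M v \<Longrightarrow> AE t in lebesgue_on {0<..<T}. v t \<in> L2 M"
  unfolding L2_Bochner_def by (blast intro: strongly_measurable_AE)

lemma L2_norm_integrable_in_time:
  fixes v :: "real \<Rightarrow> 'a \<Rightarrow> real"
  assumes "L2_Bochner T M v"
  shows "integrable (lebesgue_on {0<..<T}) (\<lambda>t. L2_norm M (v t))"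
proof (rule Bochner_Integration.integrable_bound)
  show "integrable (lebesgue_on {0<..<T}) (\<lambda>t. 1 + (L2_norm M (v t))\<^sup>2)"
    using assms by (intro Bochner_Integration.integrable_add)
      (auto simp: L2_Bochner_def intro: finite_measure.integrable_const finite_measure_lebesgue_on)
  show "(\<lambda>t. L2_norm M (v t)) \<in> borel_measurable (lebesgue_on {0<..<T})"
    using assms by (intro strongly_measurable_L2_norm) (auto simp: L2_Bochner_def)
  have "y \<le> 1 + y\<^sup>2" for y :: real
    using sum_squares_bound[of y 1] zero_le_power2[of y] by (simp, linarith)
  then show "AE t in lebesgue_on {0<..<T}. norm (L2_norm M (v t)) \<le> norm (1 + (L2_norm M (v t))\<^sup>2)"
    by (auto simp: L2_norm_nonneg)
qed

lemma L2_inner_integrable_in_time: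
  fixes v :: "real \<Rightarrow> 'a \<Rightarrow> real"
  assumes v: "L2_Bochner T M v" and \<psi>: "\<psi> \<in> L2 M"
  shows "integrable (lebesgue_on {0<..<T}) (\<lambda>t. LINT x|M. v t x * \<psi> x)"
proof (rule Bochner_Integration.integrable_bound)
  show "integrable (lebesgue_on {0<..<T}) (\<lambda>t. L2_norm M (v t) * L2_norm M \<psi>)"
    using L2_norm_integrable_in_time[OF v] by simp
  show "(\<lambda>t. LINT x|M. v t x * \<psi> x) \<in> borel_measurable (lebesgue_on {0<..<T})"
    using v \<psi> by (intro strongly_measurable_L2_inner strongly_measurable_const) (auto simp: L2_Bochner_def)
  show "AE t in lebesgue_on {0<..<T}. norm (LINT x|M. v t x * \<psi> x) \<le> norm (L2_norm M (v t) * L2_norm M \<psi>)"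
    using L2_Bochner_AE[OF v]
    by eventually_elim (use L2_Cauchy_Schwarz[OF _ \<psi>] in \<open>auto simp: L2_norm_nonneg abs_mult\<close>)
qed

section \<open>The time derivative as an integral identity\<close>

lemma simple_valued_integral:
  fixes F :: "'e \<Rightarrow> real"
  assumes s: "simple_valued I X s" and I: "I \<in> lmeasurable"
  shows "integrable (lebesgue_on I) (\<lambda>t. F (s t))"
    and "(LINT t|lebesgue_on I. F (s t)) = (\<Sum>y\<in>s ` I. measure (lebesgue_on I) {t\<in>I. s t = y} * F y)"
proof -
  have fin: "finite (s ` I)" using s by (simp add: simple_valued_def)
  interpret finite_measure "lebesgue_on I" using I by (rule finite_measure_lebesgue_on)
  have sets: "{t\<in>I. s t = y} \<in> sets (lebesgue_on I)" for y
    using s I by (simp add: simple_valued_def sets_restrict_space_iff)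
  have eq: "F (s t) = (\<Sum>y\<in>s ` I. indicator {t\<in>I. s t = y} t * F y)" if "t \<in> I" for t
  proof -
    have "(\<Sum>y\<in>s ` I. indicator {t\<in>I. s t = y} t * F y) = (\<Sum>y\<in>{s t}. indicator {t\<in>I. s t = y} t * F y)"
      using that fin by (intro sum.mono_neutral_right) auto
    then show ?thesis using that by simp
  qed
  have int: "integrable (lebesgue_on I) (\<lambda>t. indicator {t\<in>I. s t = y} t * F y)" for y
    using sets by (intro integrable_mult_left integrable_real_indicator) (auto simp: emeasure_eq_measure)
  then have int2: "integrable (lebesgue_on I) (\<lambda>t. \<Sum>y\<in>s ` I. indicator {t\<in>I. s t = y} t * F y)"
    by (rule Bochner_Integration.integrable_sum)
  then show "integrable (lebesgue_on I) (\<lambda>t. F (s t))"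
    by (subst Bochner_Integration.integrable_cong[OF refl eq]) auto
  have "(LINT t|lebesgue_on I. F (s t)) = (LINT t|lebesgue_on I. (\<Sum>y\<in>s ` I. indicator {t\<in>I. s t = y} t * F y))"
    by (rule Bochner_Integration.integral_cong[OF refl eq]) auto
  also have "\<dots> = (\<Sum>y\<in>s ` I. LINT t|lebesgue_on I. indicator {t\<in>I. s t = y} t * F y)"
    by (rule Bochner_Integration.integral_sum[OF int])
  also have "\<dots> = (\<Sum>y\<in>s ` I. measure (lebesgue_on I) {t\<in>I. s t = y} * F y)"
    using sets.sets_into_space[OF sets] by (intro sum.cong) (auto simp: Int_absorb2)
  finally show "(LINT t|lebesgue_on I. F (s t)) = (\<Sum>y\<in>s ` I. measure (lebesgue_on I) {t\<in>I. s t = y} * F y)" .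
qed

lemma L2_sum:
  fixes f :: "'i \<Rightarrow> 'a \<Rightarrow> real"
  assumes "finite A" "\<And>i. i \<in> A \<Longrightarrow> f i \<in> L2 M"
  shows "(\<lambda>x. \<Sum>i\<in>A. f i x) \<in> L2 M"
  using assms by (induction A) (auto intro: L2_zero L2_add)

text \<open>A Bochner integral in \<open>L\<^sup>2\<close> is determined by its pairings with fixed elements, and the pairing
  commutes with the integral. This turns identities between vector-valued functions of time into
  identities between real functions.\<close>

lemma has_L2_integral_inner:
  fixes v :: "real \<Rightarrow> 'a \<Rightarrow> real"
  assumes v: "has_L2_integral I M v w" and I: "I \<in> lmeasurable" and \<psi>: "\<psi> \<in> L2 M"
  shows "(LINT x|M. w x * \<psi> x) = (LINT t|lebesgue_on I. LINT x|M. v t x * \<psi> x)"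
proof -
  have Is: "I \<in> sets lebesgue" using I by blast
  have vm: "strongly_measurable I (L2 M) (L2_dist M) v" and w: "w \<in> L2 M"
    using v by (auto simp: has_L2_integral_def)
  obtain s where s: "\<And>k. simple_valued I (L2 M) (s k)"
    and s1: "(\<lambda>k. \<integral>\<^sup>+t. ennreal (L2_dist M (s k t) (v t)) \<partial>lebesgue_on I) \<longlonglongrightarrow> 0"
    and s2: "(\<lambda>k. L2_dist M (\<lambda>x. LINT t|lebesgue_on I. s k t x) w) \<longlonglongrightarrow> 0"
    using v by (auto simp: has_L2_integral_def)
  note sm = simple_valued_strongly_measurable[OF s Is]
  define S where "S k x = (LINT t|lebesgue_on I. s k t x)" for k x
  define e where "e k = (\<integral>\<^sup>+t. ennreal (L2_dist M (s k t) (v t)) \<partial>lebesgue_on I)" for k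
  have S_sum: "S k = (\<lambda>x. \<Sum>y\<in>s k ` I. measure (lebesgue_on I) {t\<in>I. s k t = y} * y x)" for k
    unfolding S_def using simple_valued_integral(2)[OF s I, of "\<lambda>y. y _" k] by auto
  have sL2: "y \<in> L2 M" if "y \<in> s k ` I" for y k using s[of k] that by (auto simp: simple_valued_def)
  have fin: "finite (s k ` I)" for k using s[of k] by (auto simp: simple_valued_def)
  have S_L2: "S k \<in> L2 M" for k
    unfolding S_sum using L2_scale[OF sL2] by (intro L2_sum fin) auto
  have S_inner: "(LINT x|M. S k x * \<psi> x) = (LINT t|lebesgue_on I. LINT x|M. s k t x * \<psi> x)" for k
  proof -
    have "(LINT x|M. S k x * \<psi> x)
        = (LINT x|M. (\<Sum>y\<in>s k ` I. measure (lebesgue_on I) {t\<in>I. s k t = y} * (y x * \<psi> x)))"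
      unfolding S_sum by (simp add: sum_distrib_right mult.assoc)
    also have "\<dots> = (\<Sum>y\<in>s k ` I. measure (lebesgue_on I) {t\<in>I. s k t = y} * (LINT x|M. y x * \<psi> x))"
      using sL2 \<psi> by (subst Bochner_Integration.integral_sum) (auto intro!: integrable_mult_right L2_mult_integrable)
    also have "\<dots> = (LINT t|lebesgue_on I. LINT x|M. s k t x * \<psi> x)"
      by (rule simple_valued_integral(2)[OF s I, symmetric])
    finally show ?thesis .
  qed
  have dist_meas: "(\<lambda>t. L2_dist M (s k t) (v t)) \<in> borel_measurable (lebesgue_on I)" for k
    unfolding L2_dist_def by (intro strongly_measurable_L2_norm strongly_measurable_L2_diff sm vm Is)
  have inner_meas: "(\<lambda>t. LINT x|M. u t x * \<psi> x) \<in> borel_measurable (lebesgue_on I)"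
    if u: "strongly_measurable I (L2 M) (L2_dist M) u" for u
    by (rule strongly_measurable_L2_inner[OF u strongly_measurable_const[OF \<psi> Is] Is])
  have AEv: "AE t in lebesgue_on I. v t \<in> L2 M \<and> t \<in> I"
    using strongly_measurable_AE[OF vm] AE_space by eventually_elim auto
  have est: "norm ((LINT x|M. w x * \<psi> x) - (LINT t|lebesgue_on I. LINT x|M. v t x * \<psi> x))
      \<le> L2_dist M (S k) w * L2_norm M \<psi> + enn2real (e k) * L2_norm M \<psi>" if fink: "e k < \<infinity>" for k
  proof -
    have intd: "integrable (lebesgue_on I) (\<lambda>t. L2_dist M (s k t) (v t))"
      using fink dist_meas unfolding e_def
      by (subst integrable_iff_bounded) (auto simp: L2_dist_nonneg)
    have dist_e: "(LINT t|lebesgue_on I. L2_dist M (s k t) (v t)) = enn2real (e k)"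
      unfolding e_def using dist_meas by (intro integral_eq_nn_integral) (auto simp: L2_dist_nonneg)
    have ints: "integrable (lebesgue_on I) (\<lambda>t. LINT x|M. s k t x * \<psi> x)"
      by (rule simple_valued_integral(1)[OF s I])
    have bd: "AE t in lebesgue_on I. norm ((LINT x|M. s k t x * \<psi> x) - (LINT x|M. v t x * \<psi> x))
        \<le> L2_dist M (s k t) (v t) * L2_norm M \<psi>"
      using AEv
    proof eventually_elim
      case (elim t)
      then have st: "s k t \<in> L2 M" and vt: "v t \<in> L2 M" using sL2[of "s k t" k] by auto
      have "(LINT x|M. s k t x * \<psi> x) - (LINT x|M. v t x * \<psi> x) = (LINT x|M. (s k t x - v t x) * \<psi> x)"
        using st vt \<psi> by (subst Bochner_Integration.integral_diff[symmetric])
          (auto intro!: L2_mult_integrable simp: left_diff_distrib)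
      then show ?case using L2_Cauchy_Schwarz[OF L2_diff[OF st vt] \<psi>] by (simp add: L2_dist_def)
    qed
    have intdiff: "integrable (lebesgue_on I) (\<lambda>t. (LINT x|M. s k t x * \<psi> x) - (LINT x|M. v t x * \<psi> x))"
      by (rule Bochner_Integration.integrable_bound[OF integrable_mult_left[where c = "L2_norm M \<psi>", OF intd]])
         (use inner_meas[OF sm] inner_meas[OF vm] bd in
           \<open>auto intro!: borel_measurable_diff elim!: eventually_mono simp: L2_dist_nonneg L2_norm_nonneg\<close>)
    have intv: "integrable (lebesgue_on I) (\<lambda>t. LINT x|M. v t x * \<psi> x)"
      using Bochner_Integration.integrable_diff[OF ints intdiff] by simp
    have "\<bar>(LINT x|M. S k x * \<psi> x) - (LINT t|lebesgue_on I. LINT x|M. v t x * \<psi> x)\<bar>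
        = \<bar>LINT t|lebesgue_on I. (LINT x|M. s k t x * \<psi> x) - (LINT x|M. v t x * \<psi> x)\<bar>"
      by (simp add: S_inner ints intv)
    also have "\<dots> \<le> (LINT t|lebesgue_on I. norm ((LINT x|M. s k t x * \<psi> x) - (LINT x|M. v t x * \<psi> x)))"
      using integral_norm_bound[of "lebesgue_on I" "\<lambda>t. (LINT x|M. s k t x * \<psi> x) - (LINT x|M. v t x * \<psi> x)"] by simp
    also have "\<dots> \<le> (LINT t|lebesgue_on I. L2_dist M (s k t) (v t) * L2_norm M \<psi>)"
      by (rule integral_mono_AE[OF integrable_norm[OF intdiff] integrable_mult_left[OF intd] bd])
    also have "\<dots> = enn2real (e k) * L2_norm M \<psi>" by (simp add: dist_e)
    finally have 1: "\<bar>(LINT x|M. S k x * \<psi> x) - (LINT t|lebesgue_on I. LINT x|M. v t x * \<psi> x)\<bar>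
        \<le> enn2real (e k) * L2_norm M \<psi>" .
    have "(LINT x|M. S k x * \<psi> x) - (LINT x|M. w x * \<psi> x) = (LINT x|M. (S k x - w x) * \<psi> x)"
      using S_L2 w \<psi> by (subst Bochner_Integration.integral_diff[symmetric])
        (auto intro!: L2_mult_integrable simp: left_diff_distrib)
    then have 2: "\<bar>(LINT x|M. S k x * \<psi> x) - (LINT x|M. w x * \<psi> x)\<bar> \<le> L2_dist M (S k) w * L2_norm M \<psi>"
      using L2_Cauchy_Schwarz[OF L2_diff[OF S_L2 w] \<psi>] by (simp add: L2_dist_def)
    show ?thesis using 1 2 by simp
  qed
  have e0: "e \<longlonglongrightarrow> 0" using s1 by (simp add: e_def[abs_def])
  then have ev: "\<forall>\<^sub>F k in sequentially. e k < \<infinity>" by (intro order_tendstoD(2)) auto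
  have e0r: "(\<lambda>k. enn2real (e k)) \<longlonglongrightarrow> 0"
    using tendsto_enn2real[of e 0 sequentially] e0 by simp
  have "(\<lambda>k. L2_dist M (S k) w * L2_norm M \<psi> + enn2real (e k) * L2_norm M \<psi>)
      \<longlonglongrightarrow> 0 * L2_norm M \<psi> + 0 * L2_norm M \<psi>"
    using s2 e0r by (intro tendsto_add tendsto_mult tendsto_const) (simp_all add: S_def[abs_def])
  then have "(\<lambda>k. L2_dist M (S k) w * L2_norm M \<psi> + enn2real (e k) * L2_norm M \<psi>) \<longlonglongrightarrow> 0" by simp
  then have "norm ((LINT x|M. w x * \<psi> x) - (LINT t|lebesgue_on I. LINT x|M. v t x * \<psi> x)) \<le> 0"
    by (rule tendsto_lowerbound) (use ev est in \<open>auto elim: eventually_mono\<close>)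
  then show ?thesis by simp
qed

lemma Ck_on_1_real:
  fixes f :: "real \<Rightarrow> real"
  assumes "\<And>x. (f has_real_derivative f' x) (at x)" "continuous_on UNIV f'"
  shows "Ck_on 1 f UNIV"
proof -
  have "frechet_derivative f (at x) = (\<lambda>v. f' x * v)" for x
    using assms(1)[of x] by (simp add: has_field_derivative_def frechet_derivative_at[symmetric])
  then show ?thesis
    using assms by (auto simp: differentiable_def has_field_derivative_def intro!: continuous_intros)
qed

lemma DERIV_pos_part_power2:
  "((\<lambda>x. (max x 0)\<^sup>2) has_real_derivative 2 * max x 0) (at (x::real))"
proof (cases "x = 0")
  case True
  have "((\<lambda>h. ((max h 0)\<^sup>2 - (max 0 0)\<^sup>2) / (h - 0)) \<longlongrightarrow> 0) (at (0::real))"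
  proof (rule Lim_null_comparison[where g = abs])
    show "\<forall>\<^sub>F h in at 0. norm (((max h 0)\<^sup>2 - (max 0 0)\<^sup>2) / (h - 0)) \<le> \<bar>h::real\<bar>"
      by (intro always_eventually) (auto simp: power2_eq_square max_def)
    show "(abs \<longlongrightarrow> 0) (at (0::real))"
      using tendsto_rabs[OF tendsto_ident_at[of "0::real" UNIV]] by simp
  qed
  then show ?thesis using True by (simp add: has_field_derivative_iff)
next
  case False
  then consider "x < 0" | "0 < x" by linarith
  then show ?thesis
  proof cases
    case 1
    have "((\<lambda>x. 0) has_real_derivative 2 * max x 0) (at x)"
      using 1 by (auto intro!: derivative_eq_intros)
    then show ?thesis
      by (rule has_field_derivative_transform_within_open[of _ _ _ "{..<0}"]) (use 1 in auto)
  next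
    case 2
    have "((\<lambda>x. x\<^sup>2) has_real_derivative 2 * max x 0) (at x)"
      using 2 by (auto intro!: derivative_eq_intros)
    then show ?thesis
      by (rule has_field_derivative_transform_within_open[of _ _ _ "{0<..}"]) (use 2 in auto)
  qed
qed

text \<open>A hat function of unit mass on \<open>{0..2}\<close> and its primitive, a continuously differentiable step from 0 to 1.
  Squares of positive parts are the building blocks because they are continuously differentiable.\<close>

definition hat :: "real \<Rightarrow> real" where
  "hat x = max x 0 - 2 * max (x - 1) 0 + max (x - 2) 0"

definition smooth_step :: "real \<Rightarrow> real" where
  "smooth_step x = ((max x 0)\<^sup>2 - 2 * (max (x - 1) 0)\<^sup>2 + (max (x - 2) 0)\<^sup>2) / 2"

lemma DERIV_smooth_step: "(smooth_step has_real_derivative hat x) (at x)"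
proof -
  have shift: "((\<lambda>x. (max (x - c) 0)\<^sup>2) has_real_derivative 2 * max (x - c) 0) (at x)" for c
    using DERIV_shift[of "\<lambda>x. (max x 0)\<^sup>2" "2 * max (x - c) 0" x "- c"] DERIV_pos_part_power2[of "x - c"]
    by simp
  show ?thesis
    unfolding smooth_step_def[abs_def]
    by (rule DERIV_cong[OF DERIV_cdivide[OF DERIV_add[OF DERIV_diff[OF shift[of 0, unfolded diff_0_right]
          DERIV_cmult[OF shift[of 1], of 2]] shift[of 2]], of 2]])
      (simp add: hat_def field_simps)
qed

lemma continuous_hat: "continuous_on S hat"
  unfolding hat_def[abs_def] by (intro continuous_intros)

lemma hat_nonneg: "0 \<le> hat x" and hat_outside: "x \<notin> {0..2} \<Longrightarrow> hat x = 0"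
  by (auto simp: hat_def max_def)

lemma smooth_step_eq_0: "x \<le> 0 \<Longrightarrow> smooth_step x = 0"
  by (simp add: smooth_step_def)

lemma smooth_step_eq_1: "2 \<le> x \<Longrightarrow> smooth_step x = 1"
  by (simp add: smooth_step_def max_def power2_eq_square algebra_simps)

lemma smooth_step_mono: "x \<le> y \<Longrightarrow> smooth_step x \<le> smooth_step y"
  by (rule DERIV_nonneg_imp_nondecreasing[of x y smooth_step]) (auto intro: DERIV_smooth_step hat_nonneg)

lemma smooth_step_bounds: "0 \<le> smooth_step x" "smooth_step x \<le> 1"
  using smooth_step_mono[of "min x 0" x] smooth_step_mono[of x "max x 2"] smooth_step_eq_0[of "min x 0"] smooth_step_eq_1[of "max x 2"]
  by auto

lemma DERIV_smooth_step_scaled: "((\<lambda>x. smooth_step ((x - s) / h)) has_real_derivative hat ((x - s) / h) / h) (at x)"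
proof -
  have "((\<lambda>x. (x - s) / h) has_real_derivative 1 / h) (at x)"
    using DERIV_cdivide[OF DERIV_diff[OF DERIV_ident DERIV_const]] by simp
  from DERIV_chain2[OF DERIV_smooth_step this] show ?thesis by simp
qed

lemma continuous_hat_scaled: "h \<noteq> 0 \<Longrightarrow> continuous_on S (\<lambda>x. hat ((x - s) / h) / h)"
  by (intro continuous_intros continuous_on_compose2[OF continuous_hat[of UNIV]]) auto

lemma absolutely_integrable_Ioo_continuous_mult:
  fixes f p :: "real \<Rightarrow> real"
  assumes "continuous_on {a..b} f" "continuous_on {a..b} p"
  shows "integrable (lebesgue_on {a<..<b}) (\<lambda>x. f x * p x)"
proof -
  have "(\<lambda>x. f x * p x) absolutely_integrable_on {a..b}"
    using assms by (intro absolutely_integrable_continuous_real continuous_intros)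
  then have "(\<lambda>x. f x * p x) absolutely_integrable_on {a<..<b}"
    by (simp add: absolutely_integrable_on_Icc_iff_Ioo)
  then show ?thesis by (intro absolutely_integrable_imp_integrable) auto
qed

lemma integral_hat:
  assumes "0 < h" "a \<le> s" "s + 2 * h \<le> b"
  shows "(LINT x|lebesgue_on {a<..<b}. hat ((x - s) / h) / h) = 1"
proof -
  have ab: "a \<le> b" using assms by linarith
  have "((\<lambda>x. hat ((x - s) / h) / h) has_integral smooth_step ((b - s) / h) - smooth_step ((a - s) / h)) {a..b}"
    using DERIV_smooth_step_scaled[of s h] ab
    by (intro fundamental_theorem_of_calculus)
      (auto simp: has_real_derivative_iff_has_vector_derivative[symmetric] intro: has_field_derivative_at_within)
  moreover have "smooth_step ((b - s) / h) = 1" "smooth_step ((a - s) / h) = 0"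
    using assms by (auto intro!: smooth_step_eq_1 smooth_step_eq_0 simp: field_simps)
  ultimately have "((\<lambda>x. hat ((x - s) / h) / h) has_integral 1) {a..b}" by simp
  then have "((\<lambda>x. hat ((x - s) / h) / h) has_integral 1) {a<..<b}"
    by (simp add: has_integral_Icc_iff_Ioo)
  moreover have "integrable (lebesgue_on {a<..<b}) (\<lambda>x. hat ((x - s) / h) / h * 1)"
    using assms by (intro absolutely_integrable_Ioo_continuous_mult continuous_hat_scaled) auto
  ultimately show ?thesis
    by (subst lebesgue_integral_eq_integral) (simp_all only: mult_1_right integral_unique, simp_all)
qed

lemma hat_approximates_point_value:
  fixes p :: "real \<Rightarrow> real"
  assumes p: "continuous_on {a..b} p" and s: "a < s" "s < b"
    and h: "\<And>n. 0 < h n" "h \<longlonglongrightarrow> 0"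
  shows "(\<lambda>n. LINT x|lebesgue_on {a<..<b}. hat ((x - s) / h n) / h n * p x) \<longlonglongrightarrow> p s"
proof (rule LIMSEQ_I)
  fix e :: real assume e: "0 < e"
  obtain d where d: "0 < d" "\<And>x. x \<in> {a..b} \<Longrightarrow> dist x s < d \<Longrightarrow> dist (p x) (p s) < e / 2"
    using p s e unfolding continuous_on_iff by (metis atLeastAtMost_iff half_gt_zero less_imp_le)
  have "\<forall>\<^sub>F n in sequentially. h n < min d (b - s) / 2"
    using h(2) d s by (intro order_tendstoD(2)) auto
  then obtain N where N: "\<And>n. n \<ge> N \<Longrightarrow> h n < min d (b - s) / 2"
    by (auto simp: eventually_sequentially)
  have "norm ((LINT x|lebesgue_on {a<..<b}. hat ((x - s) / h n) / h n * p x) - p s) < e" if n: "n \<ge> N" for n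
  proof -
    let ?k = "\<lambda>x. hat ((x - s) / h n) / h n"
    have hn: "0 < h n" "2 * h n < d" "2 * h n < b - s" using h(1) N[OF n] by auto
    note int = absolutely_integrable_Ioo_continuous_mult[OF continuous_hat_scaled]
    have one: "(LINT x|lebesgue_on {a<..<b}. ?k x) = 1"
      using hn s by (intro integral_hat) auto
    have i1: "integrable (lebesgue_on {a<..<b}) (\<lambda>x. ?k x * p x)" using hn p by (intro int) auto
    have i2: "integrable (lebesgue_on {a<..<b}) (\<lambda>x. ?k x * c)" for c using hn by (intro int) auto
    have "(LINT x|lebesgue_on {a<..<b}. ?k x * p x) - p s
        = (LINT x|lebesgue_on {a<..<b}. ?k x * p x) - (LINT x|lebesgue_on {a<..<b}. ?k x * p s)"
      using one by simp
    also have "\<dots> = (LINT x|lebesgue_on {a<..<b}. ?k x * p x - ?k x * p s)"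
      by (rule Bochner_Integration.integral_diff[OF i1 i2, symmetric])
    finally have "norm ((LINT x|lebesgue_on {a<..<b}. ?k x * p x) - p s)
        \<le> (LINT x|lebesgue_on {a<..<b}. norm (?k x * p x - ?k x * p s))"
      by (simp only: integral_norm_bound)
    also have "\<dots> \<le> (LINT x|lebesgue_on {a<..<b}. ?k x * (e / 2))"
    proof (rule integral_mono[OF integrable_norm[OF Bochner_Integration.integrable_diff[OF i1 i2]] i2])
      fix x assume x: "x \<in> space (lebesgue_on {a<..<b})"
      show "norm (?k x * p x - ?k x * p s) \<le> ?k x * (e / 2)"
      proof (cases "(x - s) / h n \<in> {0..2}")
        case True
        then have "0 \<le> x - s" "x - s \<le> 2 * h n" using hn by (auto simp: field_simps)
        then have "dist (p x) (p s) < e / 2" using hn x by (intro d) (auto simp: dist_real_def)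
        then have "\<bar>p x - p s\<bar> \<le> e / 2" by (simp add: dist_real_def)
        then have "?k x * \<bar>p x - p s\<bar> \<le> ?k x * (e / 2)"
          using hn hat_nonneg by (intro mult_left_mono) auto
        moreover have "norm (?k x * p x - ?k x * p s) = ?k x * \<bar>p x - p s\<bar>"
          using hn hat_nonneg[of "(x - s) / h n"]
          unfolding right_diff_distrib[symmetric] by (simp add: abs_mult)
        ultimately show ?thesis by simp
      next
        case False then show ?thesis by (simp add: hat_outside)
      qed
    qed
    also have "\<dots> = e / 2" using one by simp
    finally show ?thesis using e by simp
  qed
  then show "\<exists>N. \<forall>n\<ge>N. norm ((LINT x|lebesgue_on {a<..<b}. hat ((x - s) / h n) / h n * p x) - p s) < e"
    by blast
qed

lemma C1_compact_support_real:
  fixes \<phi> :: "real \<Rightarrow> real"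
  assumes "\<And>x. (\<phi> has_real_derivative \<phi>' x) (at x)" "continuous_on UNIV \<phi>'"
    and "\<And>x. x \<notin> {c..d} \<Longrightarrow> \<phi> x = 0" "{c..d} \<subseteq> U"
  shows "C1_compact_support U \<phi>"
proof -
  have "closure {x. \<phi> x \<noteq> 0} \<subseteq> {c..d}"
    using assms(3) by (intro closure_minimal) (force, simp)
  then show ?thesis
    using Ck_on_1_real[OF assms(1,2)] assms(4) unfolding C1_compact_support_def
    by (auto simp: compact_eq_bounded_closed intro: bounded_subset[OF bounded_closed_interval])
qed

text \<open>The lemma of du Bois-Reymond: a continuous function is a primitive of its weak derivative. The
  test functions are smoothed indicators of \<open>{s..t}\<close>; their derivatives concentrate at \<open>s\<close> and \<open>t\<close>.\<close>

lemma weak_derivative_imp_primitive_interior: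
  fixes p q :: "real \<Rightarrow> real"
  assumes p: "continuous_on {0..T} p" and q: "integrable (lebesgue_on {0<..<T}) q"
    and weak: "\<And>\<phi>. C1_compact_support {0<..<T} \<phi> \<Longrightarrow>
      (LINT x|lebesgue_on {0<..<T}. deriv \<phi> x * p x) = (LINT x|lebesgue_on {0<..<T}. - \<phi> x * q x)"
    and st: "0 < s" "s \<le> t" "t < T"
  shows "p t - p s = integral {s..t} q"
proof -
  \<comment> \<open>The smoothed step at \<open>t\<close> ends at \<open>t + 2 * h n\<close>, which has to stay below \<open>T\<close>.\<close>
  define h where "h n = (T - t) / (4 * (real n + 1))" for n
  have hpos: "0 < h n" for n using st by (simp add: h_def)
  have h0: "h \<longlonglongrightarrow> 0" unfolding h_def by real_asymp
  have h2: "2 * h n < T - t" for n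
  proof -
    have "2 * h n = (T - t) * (1 / (2 * (real n + 1)))" by (simp add: h_def field_simps)
    also have "\<dots> < (T - t) * 1" using st by (intro mult_strict_left_mono) (auto simp: field_simps)
    finally show ?thesis by simp
  qed
  define \<phi> where "\<phi> n x = smooth_step ((x - s) / h n) - smooth_step ((x - t) / h n)" for n x
  define \<phi>' where "\<phi>' n x = hat ((x - s) / h n) / h n - hat ((x - t) / h n) / h n" for n x
  have D: "(\<phi> n has_real_derivative \<phi>' n x) (at x)" for n x
    unfolding \<phi>_def \<phi>'_def by (intro DERIV_diff DERIV_smooth_step_scaled)
  have test: "C1_compact_support {0<..<T} (\<phi> n)" for n
  proof (rule C1_compact_support_real[OF D])
    have "h n \<noteq> 0" using hpos[of n] by simp
    then show "continuous_on UNIV (\<phi>' n)"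
      unfolding \<phi>'_def by (intro continuous_on_diff continuous_hat_scaled)
    show "{s..t + 2 * h n} \<subseteq> {0<..<T}" using st h2[of n] by auto
    fix x assume "x \<notin> {s..t + 2 * h n}"
    then consider "x < s" | "x > t + 2 * h n" by fastforce
    then show "\<phi> n x = 0"
    proof cases
      case 1 then have "(x - s) / h n \<le> 0" "(x - t) / h n \<le> 0" using st hpos[of n] by (auto simp: field_simps)
      then show ?thesis by (simp add: \<phi>_def smooth_step_eq_0)
    next
      case 2 then have "2 \<le> (x - s) / h n" "2 \<le> (x - t) / h n" using st hpos[of n] by (auto simp: field_simps)
      then show ?thesis by (simp add: \<phi>_def smooth_step_eq_1)
    qed
  qed
  have lim1: "(\<lambda>n. LINT x|lebesgue_on {0<..<T}. deriv (\<phi> n) x * p x) \<longlonglongrightarrow> p s - p t"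
  proof -
    have "(\<lambda>n. (LINT x|lebesgue_on {0<..<T}. hat ((x - s) / h n) / h n * p x)
        - (LINT x|lebesgue_on {0<..<T}. hat ((x - t) / h n) / h n * p x)) \<longlonglongrightarrow> p s - p t"
      using st p hpos h0 by (intro tendsto_diff hat_approximates_point_value) auto
    moreover have "(LINT x|lebesgue_on {0<..<T}. deriv (\<phi> n) x * p x)
        = (LINT x|lebesgue_on {0<..<T}. hat ((x - s) / h n) / h n * p x)
        - (LINT x|lebesgue_on {0<..<T}. hat ((x - t) / h n) / h n * p x)" for n
    proof -
      have "h n \<noteq> 0" using hpos[of n] by simp
      then have i: "integrable (lebesgue_on {0<..<T}) (\<lambda>x. hat ((x - c) / h n) / h n * p x)" for c
        using p by (intro absolutely_integrable_Ioo_continuous_mult continuous_hat_scaled)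
      show ?thesis
        unfolding DERIV_imp_deriv[OF D] \<phi>'_def left_diff_distrib
        by (rule Bochner_Integration.integral_diff[OF i i])
    qed
    ultimately show ?thesis by simp
  qed
  have lim2: "(\<lambda>n. LINT x|lebesgue_on {0<..<T}. - \<phi> n x * q x)
      \<longlonglongrightarrow> (LINT x|lebesgue_on {0<..<T}. - indicator {s<..t} x * q x)"
  proof (rule integral_dominated_convergence)
    have "\<phi> n \<in> borel_measurable lebesgue" for n
      using continuous_at_imp_continuous_on[of UNIV "\<phi> n"] DERIV_isCont[OF D]
      by (intro measurable_completion) (simp add: borel_measurable_continuous_onI)
    then show "(\<lambda>x. - \<phi> n x * q x) \<in> borel_measurable (lebesgue_on {0<..<T})" for n
      using q by (intro borel_measurable_times borel_measurable_uminus)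
        (auto intro: measurable_restrict_space1)
    show "(\<lambda>x. - indicator {s<..t} x * q x) \<in> borel_measurable (lebesgue_on {0<..<T})"
      by (intro borel_measurable_times borel_measurable_uminus borel_measurable_integrable[OF q]
          measurable_restrict_space1 borel_measurable_indicator) simp
    show "integrable (lebesgue_on {0<..<T}) (\<lambda>x. norm (q x))" using q by simp
    show "AE x in lebesgue_on {0<..<T}. norm (- \<phi> n x * q x) \<le> norm (q x)" for n
    proof (rule AE_I2)
      fix x
      have "\<bar>\<phi> n x\<bar> \<le> 1"
        using smooth_step_bounds[of "(x - s) / h n"] smooth_step_bounds[of "(x - t) / h n"] by (simp add: \<phi>_def abs_le_iff)
      then show "norm (- \<phi> n x * q x) \<le> norm (q x)"
        using mult_right_mono[of "\<bar>\<phi> n x\<bar>" 1 "\<bar>q x\<bar>"] by (simp add: abs_mult)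
    qed
    show "AE x in lebesgue_on {0<..<T}. (\<lambda>n. - \<phi> n x * q x) \<longlonglongrightarrow> - indicator {s<..t} x * q x"
    proof (rule AE_I2)
      fix x
      have *: "(\<lambda>n. smooth_step ((x - c) / h n)) \<longlonglongrightarrow> indicator {c<..} x" for c
      proof (cases "x \<le> c")
        case True
        then have "smooth_step ((x - c) / h n) = 0" for n
          using hpos[of n] by (intro smooth_step_eq_0) (auto simp: divide_le_0_iff)
        then show ?thesis using True by simp
      next
        case False
        have "\<forall>\<^sub>F n in sequentially. h n < (x - c) / 2" using h0 False by (intro order_tendstoD(2)) auto
        then have "\<forall>\<^sub>F n in sequentially. smooth_step ((x - c) / h n) = 1"
          by eventually_elim (rule smooth_step_eq_1, use hpos in \<open>auto simp: field_simps\<close>)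
        then show ?thesis using False tendsto_eventually by (simp add: tendsto_eventually)
      qed
      have "(\<lambda>n. \<phi> n x) \<longlonglongrightarrow> indicator {s<..} x - indicator {t<..} x"
        unfolding \<phi>_def by (intro tendsto_diff *)
      moreover have "indicator {s<..} x - indicator {t<..} x = (indicator {s<..t} x :: real)"
        using st by (auto simp: indicator_def)
      ultimately show "(\<lambda>n. - \<phi> n x * q x) \<longlonglongrightarrow> - indicator {s<..t} x * q x"
        by (intro tendsto_intros) simp
    qed
  qed
  have "p s - p t = (LINT x|lebesgue_on {0<..<T}. - indicator {s<..t} x * q x)"
    using LIMSEQ_unique[OF lim1] lim2 weak[OF test] by simp
  also have "\<dots> = - (LINT x|lebesgue_on {0<..<T}. indicator {s<..t} x * q x)" by simp
  also have "(LINT x|lebesgue_on {0<..<T}. indicator {s<..t} x * q x) = (LINT x|lebesgue. indicator {s<..t} x * q x)"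
    using st by (subst integral_restrict_space)
      (auto intro!: Bochner_Integration.integral_cong simp: indicator_def)
  also have "\<dots> = integral {s<..t} q"
  proof -
    have "q absolutely_integrable_on {0<..<T}" using q
      by (simp add: set_integrable_def integrable_restrict_space)
    then have "q absolutely_integrable_on {s<..t}"
      using st by (rule_tac set_integrable_subset) auto
    from set_lebesgue_integral_eq_integral(2)[OF this] show ?thesis
      by (simp add: set_lebesgue_integral_def)
  qed
  also have "\<dots> = integral {s..t} q"
    by (rule integral_subset_negligible[of "{s<..t}" "{s..t}"]) (auto intro: negligible_subset[of "{s}"])
  finally show ?thesis by simp
qed

text \<open>The identity extends from interior points to the end points since both sides are continuous.\<close>

lemma weak_derivative_imp_primitive:
  fixes p q :: "real \<Rightarrow> real"
  assumes p: "continuous_on {0..T} p" and q: "integrable (lebesgue_on {0<..<T}) q"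
    and weak: "\<And>\<phi>. C1_compact_support {0<..<T} \<phi> \<Longrightarrow>
      (LINT x|lebesgue_on {0<..<T}. deriv \<phi> x * p x) = (LINT x|lebesgue_on {0<..<T}. - \<phi> x * q x)"
    and st: "0 \<le> s" "s \<le> t" "t \<le> T"
  shows "p t - p s = integral {s..t} q"
proof (cases "0 < T")
  case True
  have "q absolutely_integrable_on {0<..<T}" using q
    by (simp add: set_integrable_def integrable_restrict_space)
  then have qi: "q integrable_on {0..T}"
    by (simp add: absolutely_integrable_on_Icc_iff_Ioo[symmetric] set_lebesgue_integral_eq_integral(1))
  let ?k = "\<lambda>t. p t - integral {0..t} q"
  have cont: "continuous_on {0..T} ?k"
    using p qi by (intro continuous_intros indefinite_integral_continuous_1)
  have diff: "?k t - ?k s = p t - p s - integral {s..t} q" if "0 \<le> s" "s \<le> t" "t \<le> T" for s t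
    using Henstock_Kurzweil_Integration.integral_combine[of 0 s t q] that qi
    by (simp add: integrable_on_subinterval[of q "{0..T}" 0 t])
  have "?k t = ?k (T / 2)" if "t \<in> {0<..<T}" for t
  proof -
    have T2: "0 < T / 2" "T / 2 < T" using True by auto
    show ?thesis
    proof (cases "t \<le> T / 2")
      case le: True
      have "p (T / 2) - p t = integral {t..T / 2} q"
        using that T2 le by (intro weak_derivative_imp_primitive_interior[OF p q weak]) auto
      then show ?thesis using diff[of t "T / 2"] that T2 le by simp
    next
      case False
      then have "p t - p (T / 2) = integral {T / 2..t} q"
        using that T2 by (intro weak_derivative_imp_primitive_interior[OF p q weak]) auto
      then show ?thesis using diff[of "T / 2" t] that T2 False by simp
    qed
  qed
  then have const: "?k t = ?k (T / 2)" if "t \<in> {0..T}" for t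
    using continuous_constant_on_closure[of "{0<..<T}" ?k "?k (T / 2)" t] cont that True
    by (simp only: closure_greaterThanLessThan)
  have "t \<in> {0..T}" "s \<in> {0..T}" using st by auto
  note const[OF this(1)] const[OF this(2)]
  then show ?thesis using diff[OF st] by linarith
next
  case False
  then have "s = t" using st by simp
  then show ?thesis by simp
qed

text \<open>The fundamental theorem of calculus in \<open>W\<^sup>1\<^sup>,\<^sup>2(0, T; L\<^sup>2)\<close>, tested with a fixed element of \<open>L\<^sup>2\<close>. In this form no
  vector-valued integral has to be constructed.\<close>

lemma W12_inner_primitive:
  fixes u u' :: "real \<Rightarrow> 'a \<Rightarrow> real"
  assumes u: "W12_with_derivative T M u u'" and \<psi>: "\<psi> \<in> L2 M"
    and st: "0 \<le> s" "s \<le> t" "t \<le> T"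
  shows "(LINT x|M. u t x * \<psi> x) - (LINT x|M. u s x * \<psi> x) = integral {s..t} (\<lambda>r. LINT x|M. u' r x * \<psi> x)"
proof (rule weak_derivative_imp_primitive[OF _ _ _ st])
  have uc: "u t \<in> L2 M" "((\<lambda>s. L2_dist M (u s) (u t)) \<longlongrightarrow> 0) (at t within {0..T})" if "t \<in> {0..T}" for t
    using u that by (auto simp: W12_with_derivative_def)
  show "continuous_on {0..T} (\<lambda>t. LINT x|M. u t x * \<psi> x)"
    unfolding continuous_on_def
  proof
    fix t assume t: "t \<in> {0..T}"
    show "((\<lambda>t. LINT x|M. u t x * \<psi> x) \<longlongrightarrow> (LINT x|M. u t x * \<psi> x)) (at t within {0..T})"
      using uc t \<psi> by (intro tendsto_L2_inner)
        (auto simp: eventually_at_filter L2_dist_def L2_norm_def)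
  qed
  show "integrable (lebesgue_on {0<..<T}) (\<lambda>r. LINT x|M. u' r x * \<psi> x)"
    using u \<psi> by (intro L2_inner_integrable_in_time) (simp_all add: W12_with_derivative_def)
  fix \<phi> :: "real \<Rightarrow> real" assume "C1_compact_support {0<..<T} \<phi>"
  then obtain w where w: "has_L2_integral {0<..<T} M (\<lambda>t x. deriv \<phi> t * u t x) w"
      "has_L2_integral {0<..<T} M (\<lambda>t x. - \<phi> t * u' t x) w"
    using u unfolding W12_with_derivative_def has_weak_time_derivative_def by blast
  have "(LINT t|lebesgue_on {0<..<T}. LINT x|M. deriv \<phi> t * u t x * \<psi> x)
      = (LINT t|lebesgue_on {0<..<T}. LINT x|M. - \<phi> t * u' t x * \<psi> x)"
    using has_L2_integral_inner[OF w(1) _ \<psi>] has_L2_integral_inner[OF w(2) _ \<psi>] by simp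
  then show "(LINT t|lebesgue_on {0<..<T}. deriv \<phi> t * (LINT x|M. u t x * \<psi> x))
      = (LINT t|lebesgue_on {0<..<T}. - \<phi> t * (LINT x|M. u' t x * \<psi> x))"
    by (simp add: mult.assoc)
qed

section \<open>A chain rule and a Gronwall inequality without differentiation\<close>

text \<open>A function whose increments over short intervals are negligible compared with those of a monotone
  function does not increase: the increments add up along a fine partition.\<close>

lemma negligible_increments_imp_le:
  fixes k A :: "real \<Rightarrow> real"
  assumes ab: "a \<le> b"
    and small: "\<And>e. 0 < e \<Longrightarrow> \<exists>d>0. \<forall>s t. a \<le> s \<and> s \<le> t \<and> t \<le> b \<and> t - s < d \<longrightarrow> k t - k s \<le> e * (A t - A s)"
  shows "k b \<le> k a"
proof (rule field_le_epsilon)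
  fix \<eta> :: real assume \<eta>: "0 < \<eta>"
  define e where "e = \<eta> / (\<bar>A b - A a\<bar> + 1)"
  have e: "0 < e" using \<eta> by (simp add: e_def)
  obtain d where d: "0 < d"
    "\<And>s t. a \<le> s \<Longrightarrow> s \<le> t \<Longrightarrow> t \<le> b \<Longrightarrow> t - s < d \<Longrightarrow> k t - k s \<le> e * (A t - A s)"
    using small[OF e] by blast
  obtain n :: nat where n: "(b - a) / d < real n" using reals_Archimedean2 by blast
  have "0 \<le> (b - a) / d" using ab d by simp
  then have n0: "0 < real n" using n by linarith
  define h where "h = (b - a) / real n"
  have h: "0 \<le> h" "h < d" using n n0 ab d by (auto simp: h_def field_simps)
  have nh: "a + real n * h = b" using n0 by (simp add: h_def)
  have "k (a + real i * h) - k a \<le> e * (A (a + real i * h) - A a)" if "i \<le> n" for i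
    using that
  proof (induction i)
    case (Suc i)
    have "real (Suc i) * h \<le> real n * h" using Suc.prems h by (intro mult_right_mono) auto
    then have "k (a + real (Suc i) * h) - k (a + real i * h) \<le> e * (A (a + real (Suc i) * h) - A (a + real i * h))"
      using h nh by (intro d) (auto simp: algebra_simps)
    then show ?case using Suc by (simp add: algebra_simps)
  qed simp
  from this[of n] have "k b - k a \<le> e * (A b - A a)" using nh by simp
  also have "\<dots> \<le> e * (\<bar>A b - A a\<bar> + 1)" using e by (intro mult_left_mono) auto
  also have "\<dots> = \<eta>" by (simp add: e_def)
  finally show "k b \<le> k a + \<eta>" by simp
qed

lemma integral_mono_AE_subinterval:
  fixes f g :: "real \<Rightarrow> real"
  assumes "f absolutely_integrable_on {0..T}" "g absolutely_integrable_on {0..T}"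
    and le: "AE r in lebesgue_on {0<..<T}. f r \<le> g r" and st: "0 \<le> s" "t \<le> T"
  shows "integral {s..t} f \<le> integral {s..t} g"
proof -
  have sub: "{s<..<t} \<subseteq> {0..T}" using st by auto
  have f: "f absolutely_integrable_on {s<..<t}" and g: "g absolutely_integrable_on {s<..<t}"
    using assms(1,2) sub by (auto intro: set_integrable_subset)
  have "AE r in lebesgue. r \<in> {0<..<T} \<longrightarrow> f r \<le> g r" using le by (subst (asm) AE_restrict_space_iff) auto
  then have "AE r in lebesgue. indicator {s<..<t} r *\<^sub>R f r \<le> indicator {s<..<t} r *\<^sub>R g r"
    by eventually_elim (use st in \<open>auto simp: indicator_def\<close>)
  then have "(LINT r:{s<..<t}|lebesgue. f r) \<le> (LINT r:{s<..<t}|lebesgue. g r)"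
    using f g unfolding set_lebesgue_integral_def set_integrable_def by (intro integral_mono_AE)
  then show ?thesis
    using f g by (simp add: set_lebesgue_integral_eq_integral(2) integral_open_interval_real)
qed

lemma absolutely_integrable_Icc_iff_lebesgue_on:
  fixes f :: "real \<Rightarrow> real"
  shows "f absolutely_integrable_on {0..T} \<longleftrightarrow> integrable (lebesgue_on {0<..<T}) f"
  unfolding absolutely_integrable_on_Icc_iff_Ioo by (simp add: set_integrable_def integrable_restrict_space)

lemma integral_split:
  fixes f :: "real \<Rightarrow> real"
  assumes "f absolutely_integrable_on {0..T}" "0 \<le> s" "s \<le> t" "t \<le> T"
  shows "integral {0..t} f - integral {0..s} f = integral {s..t} f"
  using Henstock_Kurzweil_Integration.integral_combine[of 0 s t f] assms
    integrable_on_subinterval[of f "{0..T}" 0 t] set_lebesgue_integral_eq_integral(1)[OF assms(1)] by auto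

lemma absolutely_integrable_subinterval:
  fixes f :: "real \<Rightarrow> real"
  assumes "f absolutely_integrable_on {0..T}" "0 \<le> s" "t \<le> T"
  shows "f absolutely_integrable_on {s..t}" "f integrable_on {s..t}"
  using assms absolutely_integrable_on_subinterval[of "{0..T}" f s t]
    set_lebesgue_integral_eq_integral(1) by auto

text \<open>Distances in \<open>L\<^sup>2\<close> vanish between functions that agree almost everywhere, so compactness of \<open>{0..T}\<close> is applied
  to the intervals on which the oscillation is small, rather than to a map into a metric space.\<close>

lemma L2_uniformly_continuous:
  fixes w :: "real \<Rightarrow> 'a \<Rightarrow> real"
  assumes w: "\<And>t. t \<in> {0..T} \<Longrightarrow> w t \<in> L2 M"
    and cont: "\<And>t. t \<in> {0..T} \<Longrightarrow> ((\<lambda>s. L2_dist M (w s) (w t)) \<longlongrightarrow> 0) (at t within {0..T})"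
    and e: "0 < e"
  obtains d where "0 < d" "\<And>s t. s \<in> {0..T} \<Longrightarrow> t \<in> {0..T} \<Longrightarrow> \<bar>s - t\<bar> < d \<Longrightarrow> L2_dist M (w s) (w t) < e"
proof -
  have "\<exists>d>0. \<forall>s\<in>{0..T}. \<bar>s - t\<bar> < d \<longrightarrow> L2_dist M (w s) (w t) < e / 2" if t: "t \<in> {0..T}" for t
  proof -
    have "\<forall>\<^sub>F s in at t within {0..T}. L2_dist M (w s) (w t) < e / 2"
      using cont[OF t] e by (intro order_tendstoD(2)) auto
    then obtain d where "0 < d" "\<And>s. s \<in> {0..T} \<Longrightarrow> s \<noteq> t \<Longrightarrow> dist s t < d \<Longrightarrow> L2_dist M (w s) (w t) < e / 2"
      unfolding eventually_at by blast
    moreover have "L2_dist M (w t) (w t) < e / 2" using e by (simp add: L2_dist_def L2_norm_def)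
    ultimately show ?thesis by (metis dist_real_def)
  qed
  then obtain d where d: "\<And>t. t \<in> {0..T} \<Longrightarrow> 0 < d t"
    "\<And>s t. t \<in> {0..T} \<Longrightarrow> s \<in> {0..T} \<Longrightarrow> \<bar>s - t\<bar> < d t \<Longrightarrow> L2_dist M (w s) (w t) < e / 2"
    by metis
  obtain \<delta> where \<delta>: "0 < \<delta>" "\<And>x. x \<in> {0..T} \<Longrightarrow> \<exists>G\<in>(\<lambda>t. ball t (d t)) ` {0..T}. ball x \<delta> \<subseteq> G"
    by (rule Heine_Borel_lemma[of "{0..T}" "(\<lambda>t. ball t (d t)) ` {0..T}"]) (use d in \<open>auto intro: bexI\<close>)
  show ?thesis
  proof (rule that[OF \<delta>(1)])
    fix s t assume s: "s \<in> {0..T}" and t: "t \<in> {0..T}" and st: "\<bar>s - t\<bar> < \<delta>"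
    obtain r where r: "r \<in> {0..T}" "ball t \<delta> \<subseteq> ball r (d r)" using \<delta>(2)[OF t] by blast
    have "s \<in> ball t \<delta>" "t \<in> ball t \<delta>" using st \<delta>(1) by (auto simp: dist_real_def)
    then have "s \<in> ball r (d r)" "t \<in> ball r (d r)" using r by blast+
    then have "\<bar>s - r\<bar> < d r" "\<bar>t - r\<bar> < d r" by (auto simp: dist_real_def)
    then have "L2_dist M (w s) (w r) < e / 2" "L2_dist M (w r) (w t) < e / 2"
      using d(2)[OF r(1) s] d(2)[OF r(1) t] L2_dist_commute[of M "w r" "w t"] by simp_all
    then show "L2_dist M (w s) (w t) < e"
      using L2_dist_triangle[OF w[OF s] w[OF r(1)] w[OF t]] by simp
  qed
qed

text \<open>The chain rule for the squared positive part, as an inequality. The increment of the convex function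
  \<open>w \<mapsto> (w\<^sup>+)\<^sup>2\<close> is at most its derivative at the right end point applied to the increment of \<open>w\<close>; by
  uniform continuity the right end point may be replaced by the running time at the cost of a
  negligible increment.\<close>

lemma
  fixes w w' :: "real \<Rightarrow> 'a \<Rightarrow> real"
  assumes w: "\<And>t. t \<in> {0..T} \<Longrightarrow> w t \<in> L2 M"
    and cont: "\<And>t. t \<in> {0..T} \<Longrightarrow> ((\<lambda>s. L2_dist M (w s) (w t)) \<longlongrightarrow> 0) (at t within {0..T})"
    and wm: "strongly_measurable {0<..<T} (L2 M) (L2_dist M) w"
    and w'm: "strongly_measurable {0<..<T} (L2 M) (L2_dist M) w'"
    and w'int: "(\<lambda>r. L2_norm M (w' r)) absolutely_integrable_on {0..T}"
    and primitive: "\<And>\<psi> s t. \<psi> \<in> L2 M \<Longrightarrow> 0 \<le> s \<Longrightarrow> s \<le> t \<Longrightarrow> t \<le> T \<Longrightarrow>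
      (LINT x|M. (w t x - w s x) * \<psi> x) = integral {s..t} (\<lambda>r. LINT x|M. w' r x * \<psi> x)"
  shows L2_pos_part_chain_integrable:
      "(\<lambda>r. LINT x|M. w' r x * max (w r x) 0) absolutely_integrable_on {0..T}"
    and L2_pos_part_chain_le: "0 \<le> a \<Longrightarrow> a \<le> b \<Longrightarrow> b \<le> T \<Longrightarrow>
      (L2_norm M (\<lambda>x. max (w b x) 0))\<^sup>2 - (L2_norm M (\<lambda>x. max (w a x) 0))\<^sup>2
        \<le> 2 * integral {a..b} (\<lambda>r. LINT x|M. w' r x * max (w r x) 0)"
proof -
  define p where "p t = (\<lambda>x. max (w t x) 0)" for t
  have p: "p t \<in> L2 M" if "t \<in> {0..T}" for t unfolding p_def by (intro L2_pos w that)
  have pm: "strongly_measurable {0<..<T} (L2 M) (L2_dist M) p"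
    using strongly_measurable_L2_pos[OF wm] by (simp add: p_def[abs_def])
  have unif: "\<exists>d>0. \<forall>s\<in>{0..T}. \<forall>t\<in>{0..T}. \<bar>s - t\<bar> < d \<longrightarrow> L2_dist M (p s) (p t) < e" if e: "0 < e" for e
  proof -
    obtain d where d: "0 < d" "\<And>s t. s \<in> {0..T} \<Longrightarrow> t \<in> {0..T} \<Longrightarrow> \<bar>s - t\<bar> < d \<Longrightarrow> L2_dist M (w s) (w t) < e"
      using L2_uniformly_continuous[OF w cont e] by blast
    show ?thesis
    proof (intro exI[of _ d] conjI ballI impI)
      fix s t assume *: "s \<in> {0..T}" "t \<in> {0..T}" "\<bar>s - t\<bar> < d"
      then show "L2_dist M (p s) (p t) < e"
        using d(2)[OF *] L2_dist_pos[OF w[OF *(1)] w[OF *(2)]] by (simp add: p_def)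
    qed (rule d(1))
  qed
  have AEw': "AE r in lebesgue_on {0<..<T}. w' r \<in> L2 M \<and> r \<in> {0..T}"
    using strongly_measurable_AE[OF w'm] AE_space by eventually_elim auto
  have inner_int: "(\<lambda>r. LINT x|M. w' r x * f r x) absolutely_integrable_on {0..T}"
    if f: "strongly_measurable {0<..<T} (L2 M) (L2_dist M) f" "\<And>r. r \<in> {0..T} \<Longrightarrow> f r \<in> L2 M"
      "\<And>r. r \<in> {0..T} \<Longrightarrow> L2_norm M (f r) \<le> B" for f B
    unfolding absolutely_integrable_Icc_iff_lebesgue_on
  proof (rule Bochner_Integration.integrable_bound)
    show "integrable (lebesgue_on {0<..<T}) (\<lambda>r. L2_norm M (w' r) * B)"
      using w'int unfolding absolutely_integrable_Icc_iff_lebesgue_on by simp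
    show "(\<lambda>r. LINT x|M. w' r x * f r x) \<in> borel_measurable (lebesgue_on {0<..<T})"
      by (intro strongly_measurable_L2_inner w'm f) simp
    show "AE r in lebesgue_on {0<..<T}. norm (LINT x|M. w' r x * f r x) \<le> norm (L2_norm M (w' r) * B)"
      using AEw'
    proof eventually_elim
      case (elim r)
      have "\<bar>LINT x|M. w' r x * f r x\<bar> \<le> L2_norm M (w' r) * L2_norm M (f r)"
        using elim f by (intro L2_Cauchy_Schwarz) auto
      also have "\<dots> \<le> L2_norm M (w' r) * B" using elim f by (intro mult_left_mono L2_norm_nonneg) auto
      finally show ?case by (simp add: abs_le_iff)
    qed
  qed
  have bounded: "\<exists>B. \<forall>r\<in>{0..T}. L2_norm M (p r) \<le> B"
  proof -
    have "continuous_on {0..T} (\<lambda>r. L2_norm M (p r))"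
      unfolding continuous_on_iff
    proof (intro ballI allI impI)
      fix t e :: real assume t: "t \<in> {0..T}" and e: "0 < e"
      obtain d where "d > 0" "\<And>s t. s\<in>{0..T} \<Longrightarrow> t\<in>{0..T} \<Longrightarrow> \<bar>s - t\<bar> < d \<Longrightarrow> L2_dist M (p s) (p t) < e"
        using unif[OF e] by blast
      then show "\<exists>d>0. \<forall>s\<in>{0..T}. dist s t < d \<longrightarrow> dist (L2_norm M (p s)) (L2_norm M (p t)) < e"
        using L2_norm_le_dist[OF p p] t by (metis dist_real_def order_le_less_trans)
    qed
    then have "bounded ((\<lambda>r. L2_norm M (p r)) ` {0..T})"
      by (intro compact_imp_bounded compact_continuous_image) auto
    then show ?thesis unfolding bounded_iff by (auto simp: abs_le_iff)
  qed
  have pint: "(\<lambda>r. LINT x|M. w' r x * p r x) absolutely_integrable_on {0..T}"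
    using bounded inner_int[OF pm p] by blast
  then show "(\<lambda>r. LINT x|M. w' r x * max (w r x) 0) absolutely_integrable_on {0..T}"
    by (simp add: p_def)
  have const_int: "(\<lambda>r. LINT x|M. w' r x * p t x) absolutely_integrable_on {0..T}" if t: "t \<in> {0..T}" for t
    by (rule inner_int[OF strongly_measurable_const]) (auto intro: p t)
  show "(L2_norm M (\<lambda>x. max (w b x) 0))\<^sup>2 - (L2_norm M (\<lambda>x. max (w a x) 0))\<^sup>2
        \<le> 2 * integral {a..b} (\<lambda>r. LINT x|M. w' r x * max (w r x) 0)"
    if a: "0 \<le> a" and ab: "a \<le> b" and b: "b \<le> T"
  proof -
    let ?I = "\<lambda>t. integral {0..t} (\<lambda>r. LINT x|M. w' r x * p r x)"
    let ?A = "\<lambda>t. integral {0..t} (\<lambda>r. L2_norm M (w' r))"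
    let ?k = "\<lambda>t. (L2_norm M (p t))\<^sup>2 / 2 - ?I t"
    have "?k b \<le> ?k a"
    proof (rule negligible_increments_imp_le[OF ab, where A = ?A])
      fix e :: real assume e: "0 < e"
      obtain d where d: "0 < d" "\<And>s t. s\<in>{0..T} \<Longrightarrow> t\<in>{0..T} \<Longrightarrow> \<bar>s - t\<bar> < d \<Longrightarrow> L2_dist M (p s) (p t) < e"
        using unif[OF e] by blast
      show "\<exists>d>0. \<forall>s t. a \<le> s \<and> s \<le> t \<and> t \<le> b \<and> t - s < d \<longrightarrow> ?k t - ?k s \<le> e * (?A t - ?A s)"
      proof (intro exI[of _ d] conjI allI impI)
        fix s t assume "a \<le> s \<and> s \<le> t \<and> t \<le> b \<and> t - s < d"
        then have st: "0 \<le> s" "s \<le> t" "t \<le> T" "t - s < d" and sT: "s \<in> {0..T}" and tT: "t \<in> {0..T}"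
          using a b by auto
        have "(L2_norm M (p t))\<^sup>2 / 2 - (L2_norm M (p s))\<^sup>2 / 2 = (LINT x|M. (p t x * p t x) / 2 - (p s x * p s x) / 2)"
          using p[OF sT] p[OF tT] by (simp add: L2_norm_mult L2_mult_integrable)
        \<comment> \<open>Convexity of \<open>s \<mapsto> (s\<^sup>+)\<^sup>2 / 2\<close>, with the derivative taken at the later time.\<close>
        also have "\<dots> \<le> (LINT x|M. (w t x - w s x) * p t x)"
        proof (rule integral_mono)
          fix x
          have "max u 0 * max u 0 / 2 - max v 0 * max v 0 / 2 \<le> (u - v) * max u 0" for u v :: real
          proof -
            have "0 \<le> (max u 0 - max v 0)\<^sup>2" by simp
            moreover have "v * max u 0 \<le> max v 0 * max u 0" by (intro mult_right_mono) auto
            moreover have "u * max u 0 = max u 0 * max u 0" by (auto simp: max_def)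
            moreover have "(max u 0 - max v 0)\<^sup>2 = max u 0 * max u 0 - 2 * (max v 0 * max u 0) + max v 0 * max v 0"
              by (simp add: power2_eq_square algebra_simps)
            ultimately show ?thesis unfolding left_diff_distrib by linarith
          qed
          then show "p t x * p t x / 2 - p s x * p s x / 2 \<le> (w t x - w s x) * p t x" by (simp add: p_def)
        qed (use p[OF sT] p[OF tT] w[OF sT] w[OF tT] in \<open>auto intro!: L2_mult_integrable L2_diff\<close>)
        also have "\<dots> = integral {s..t} (\<lambda>r. LINT x|M. w' r x * p t x)"
          by (rule primitive[OF p[OF tT] st(1-3)])
        finally have 1: "?k t - ?k s \<le> integral {s..t} (\<lambda>r. LINT x|M. w' r x * p t x)
            - integral {s..t} (\<lambda>r. LINT x|M. w' r x * p r x)"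
          using integral_split[OF pint st(1-3)] by linarith
        have "integral {s..t} (\<lambda>r. LINT x|M. w' r x * p t x) - integral {s..t} (\<lambda>r. LINT x|M. w' r x * p r x)
            = integral {s..t} (\<lambda>r. (LINT x|M. w' r x * p t x) - (LINT x|M. w' r x * p r x))"
          using absolutely_integrable_subinterval(2)[OF const_int[OF tT] st(1,3)]
            absolutely_integrable_subinterval(2)[OF pint st(1,3)]
          by (simp add: Henstock_Kurzweil_Integration.integral_diff)
        also have "\<dots> = integral {s..t} (\<lambda>r. indicator {s..t} r * ((LINT x|M. w' r x * p t x) - (LINT x|M. w' r x * p r x)))"
          by (rule Henstock_Kurzweil_Integration.integral_cong) auto
        also have "\<dots> \<le> integral {s..t} (\<lambda>r. e * L2_norm M (w' r))"
        proof (rule integral_mono_AE_subinterval[OF _ _ _ st(1,3)])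
          have "(\<lambda>r. (LINT x|M. w' r x * p t x) - (LINT x|M. w' r x * p r x)) absolutely_integrable_on {s..t}"
            using absolutely_integrable_subinterval(1)[OF const_int[OF tT] st(1,3)]
              absolutely_integrable_subinterval(1)[OF pint st(1,3)] by (rule set_integral_diff(1))
          then show "(\<lambda>r. indicator {s..t} r * ((LINT x|M. w' r x * p t x) - (LINT x|M. w' r x * p r x))) absolutely_integrable_on {0..T}"
            unfolding set_integrable_def
            by (rule back_subst[where P = "integrable lebesgue"])
              (use st in \<open>auto simp: indicator_def fun_eq_iff\<close>)
          show "(\<lambda>r. e * L2_norm M (w' r)) absolutely_integrable_on {0..T}"
            using w'int by (rule set_integrable_mult_right)
          show "AE r in lebesgue_on {0<..<T}.
              indicator {s..t} r * ((LINT x|M. w' r x * p t x) - (LINT x|M. w' r x * p r x)) \<le> e * L2_norm M (w' r)"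
            using AEw'
          proof eventually_elim
            case (elim r)
            then have w'r: "w' r \<in> L2 M" and rT: "r \<in> {0..T}" by auto
            show ?case
            proof (cases "r \<in> {s..t}")
              case True
              have "(LINT x|M. w' r x * p t x) - (LINT x|M. w' r x * p r x) = (LINT x|M. w' r x * (p t x - p r x))"
                using w'r p[OF tT] p[OF rT] by (simp add: L2_mult_integrable right_diff_distrib)
              also have "\<dots> \<le> L2_norm M (w' r) * L2_dist M (p t) (p r)"
                using L2_Cauchy_Schwarz[OF w'r L2_diff[OF p[OF tT] p[OF rT]]] by (simp add: L2_dist_def)
              also have "\<dots> \<le> L2_norm M (w' r) * e"
                using d(2)[OF tT rT] st True by (intro mult_left_mono) (auto simp: L2_norm_nonneg)
              finally show ?thesis using True by (simp add: mult.commute)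
            next
              case False
              then show ?thesis using e by (simp add: L2_norm_nonneg)
            qed
          qed
        qed
        also have "\<dots> = e * (?A t - ?A s)"
          using integral_split[OF w'int st(1-3)] by simp
        finally show "?k t - ?k s \<le> e * (?A t - ?A s)" using 1 by linarith
      qed (rule d(1))
    qed
    then show ?thesis using integral_split[OF pint a ab b] by (simp add: p_def)
  qed
qed

text \<open>With the factor \<open>exp (- t)\<close> the integral inequality becomes the statement that \<open>exp (- t) * F t\<close> minus
  the integral of \<open>exp (- r) * f r\<close> does not increase; the terms with \<open>F\<close> cancel up to the oscillation
  of \<open>F\<close>.\<close>

lemma Gronwall_integral_inequality:
  fixes F f :: "real \<Rightarrow> real"
  assumes F: "continuous_on {0..T} F" "\<And>t. t \<in> {0..T} \<Longrightarrow> 0 \<le> F t"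
    and f: "f absolutely_integrable_on {0..T}" "\<And>t. 0 \<le> f t"
    and increment: "\<And>s t. 0 \<le> s \<Longrightarrow> s \<le> t \<Longrightarrow> t \<le> T \<Longrightarrow> F t - F s \<le> integral {s..t} (\<lambda>r. F r + f r)"
    and t: "0 \<le> t" "t \<le> T"
  shows "F t \<le> exp t * F 0 + integral {0..t} (\<lambda>r. exp (t - r) * f r)"
proof -
  have fe: "(\<lambda>r. exp (- r) * f r) absolutely_integrable_on {0..T}"
    using f(1) by (intro absolutely_integrable_bounded_measurable_product_real compact_imp_bounded
        compact_continuous_image continuous_imp_measurable_on_sets_lebesgue)
      (auto intro!: continuous_intros)
  let ?k = "\<lambda>t. exp (- t) * F t - integral {0..t} (\<lambda>r. exp (- r) * f r)"
  have "?k t \<le> ?k 0"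
  proof (rule negligible_increments_imp_le[OF t(1), where A = "\<lambda>t. t"])
    fix e :: real assume e: "0 < e"
    have "uniformly_continuous_on {0..T} F" using F(1) by (rule compact_uniformly_continuous) simp
    then obtain d where d: "0 < d" "\<And>x y. x \<in> {0..T} \<Longrightarrow> y \<in> {0..T} \<Longrightarrow> dist y x < d \<Longrightarrow> dist (F y) (F x) < e"
      using e unfolding uniformly_continuous_on_def by meson
    show "\<exists>d>0. \<forall>r s. 0 \<le> r \<and> r \<le> s \<and> s \<le> t \<and> s - r < d \<longrightarrow> ?k s - ?k r \<le> e * (s - r)"
    proof (intro exI[of _ d] conjI allI impI)
      fix r s assume "0 \<le> r \<and> r \<le> s \<and> s \<le> t \<and> s - r < d"
      then have rs: "0 \<le> r" "r \<le> s" "s \<le> T" "s - r < d" using t by auto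
      have sub: "{r..s} \<subseteq> {0..T}" using rs by auto
      have Fi: "F integrable_on {r..s}" by (intro integrable_continuous_real continuous_on_subset[OF F(1) sub])
      have fi: "f integrable_on {r..s}" and fei: "(\<lambda>x. exp (- x) * f x) integrable_on {r..s}"
        using absolutely_integrable_subinterval(2)[OF _ rs(1,3)] f fe by auto
      have ei: "(\<lambda>x. exp (- x)) integrable_on {r..s}" by (intro integrable_continuous_real continuous_intros)
      have "((\<lambda>x. exp (- x)) has_integral (- exp (- s)) - (- exp (- r))) {r..s}"
        using rs by (intro fundamental_theorem_of_calculus)
          (auto intro!: derivative_eq_intros simp: has_real_derivative_iff_has_vector_derivative[symmetric])
      then have expint: "integral {r..s} (\<lambda>x. exp (- x)) = exp (- r) - exp (- s)" by (simp add: integral_unique)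
      have "exp (- s) * F s - exp (- r) * F r = exp (- s) * (F s - F r) - integral {r..s} (\<lambda>x. exp (- x)) * F r"
        by (simp add: expint algebra_simps)
      also have "\<dots> \<le> exp (- s) * integral {r..s} (\<lambda>x. F x + f x) - integral {r..s} (\<lambda>x. exp (- x)) * F r"
        using increment[OF rs(1-3)] by simp
      also have "\<dots> = integral {r..s} (\<lambda>x. exp (- s) * (F x + f x) - exp (- x) * F r)"
        using Fi fi ei by (subst Henstock_Kurzweil_Integration.integral_diff)
          (auto intro!: integrable_add integrable_on_mult_left integrable_on_mult_right)
      also have "\<dots> \<le> integral {r..s} (\<lambda>x. exp (- x) * f x + e)"
      proof (rule integral_le)
        show "(\<lambda>x. exp (- s) * (F x + f x) - exp (- x) * F r) integrable_on {r..s}"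
          using Fi fi ei by (intro integrable_diff integrable_add integrable_on_mult_left integrable_on_mult_right)
        show "(\<lambda>x. exp (- x) * f x + e) integrable_on {r..s}"
          using fei by (intro integrable_add) auto
        fix x assume x: "x \<in> {r..s}"
        then have xT: "x \<in> {0..T}" "r \<in> {0..T}" using sub rs by auto
        have "dist (F x) (F r) < e" using x rs xT by (intro d) (auto simp: dist_real_def)
        then have "F x - F r \<le> e" by (simp add: dist_real_def)
        then have "exp (- x) * (F x - F r) \<le> exp (- x) * e" by (intro mult_left_mono) auto
        also have "\<dots> \<le> 1 * e" using e xT by (intro mult_right_mono) auto
        finally have "exp (- x) * (F x - F r) \<le> e" by simp
        moreover have "exp (- s) * (F x + f x) \<le> exp (- x) * (F x + f x)"
          using F(2)[OF xT(1)] f(2)[of x] x by (intro mult_right_mono) auto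
        ultimately show "exp (- s) * (F x + f x) - exp (- x) * F r \<le> exp (- x) * f x + e"
          by (simp add: algebra_simps)
      qed
      also have "\<dots> = integral {r..s} (\<lambda>x. exp (- x) * f x) + e * (s - r)"
        using fei rs by (subst Henstock_Kurzweil_Integration.integral_add) auto
      finally show "?k s - ?k r \<le> e * (s - r)"
        using integral_split[OF fe rs(1-3)] by linarith
    qed (rule d(1))
  qed
  then have "exp (- t) * F t \<le> F 0 + integral {0..t} (\<lambda>r. exp (- r) * f r)" by simp
  then have "exp t * (exp (- t) * F t) \<le> exp t * (F 0 + integral {0..t} (\<lambda>r. exp (- r) * f r))"
    by (intro mult_left_mono) auto
  moreover have "exp t * (exp (- t) * F t) = F t" by (simp add: exp_minus field_simps)
  moreover have "exp t * integral {0..t} (\<lambda>r. exp (- r) * f r) = integral {0..t} (\<lambda>r. exp (t - r) * f r)"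
    by (simp add: exp_diff exp_minus field_simps flip: Henstock_Kurzweil_Integration.integral_mult_right)
  ultimately show ?thesis by (simp add: distrib_left)
qed

section \<open>Smoothing the positive part\<close>

text \<open>Half the sum of \<open>s\<close> and the regularised absolute value \<open>sqrt (s\<^sup>2 + \<eta>\<^sup>2)\<close>. It is needed twice: for the surface
  gradient of a positive part and, with its second derivative, for the weights in the submodularity of the
  total variation.\<close>

definition smooth_pos :: "real \<Rightarrow> real \<Rightarrow> real" where
  "smooth_pos \<eta> s = (s + sqrt (s\<^sup>2 + \<eta>\<^sup>2)) / 2"

definition smooth_pos' :: "real \<Rightarrow> real \<Rightarrow> real" where
  "smooth_pos' \<eta> s = (1 + s / sqrt (s\<^sup>2 + \<eta>\<^sup>2)) / 2"

context
  fixes \<eta> :: real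
  assumes \<eta>: "0 < \<eta>"
begin

lemma sqrt_pos: "0 < sqrt (s\<^sup>2 + \<eta>\<^sup>2)" and sqrt_ne: "s\<^sup>2 + \<eta>\<^sup>2 \<noteq> 0"
  using \<eta> by (simp_all add: sum_power2_gt_zero_iff sum_power2_eq_zero_iff)

lemma DERIV_smooth_pos: "(smooth_pos \<eta> has_real_derivative smooth_pos' \<eta> s) (at s)"
  unfolding smooth_pos_def[abs_def] smooth_pos'_def
  using sqrt_pos[of s] \<eta>
  by (auto intro!: derivative_eq_intros simp: field_simps sum_power2_gt_zero_iff not_sum_power2_lt_zero)

lemma DERIV_smooth_pos':
  "(smooth_pos' \<eta> has_real_derivative \<eta>\<^sup>2 / (2 * (s\<^sup>2 + \<eta>\<^sup>2) * sqrt (s\<^sup>2 + \<eta>\<^sup>2))) (at s)"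
proof -
  let ?q = "sqrt (s\<^sup>2 + \<eta>\<^sup>2)"
  have q: "0 < ?q" "?q * ?q = s\<^sup>2 + \<eta>\<^sup>2" using sqrt_pos[of s] by auto
  have "((\<lambda>s. sqrt (s\<^sup>2 + \<eta>\<^sup>2)) has_real_derivative s / ?q) (at s)"
    using \<eta> by (auto intro!: derivative_eq_intros simp: field_simps sum_power2_gt_zero_iff not_sum_power2_lt_zero)
  then have "((\<lambda>s. (1 + s / sqrt (s\<^sup>2 + \<eta>\<^sup>2)) / 2) has_real_derivative
      (0 + (1 * ?q - s * (s / ?q)) / (?q * ?q)) / 2) (at s)"
    using q by (intro DERIV_cdivide DERIV_add DERIV_const DERIV_divide DERIV_ident) auto
  moreover have "(0 + (1 * ?q - s * (s / ?q)) / (?q * ?q)) / 2 = \<eta>\<^sup>2 / (2 * (?q * ?q) * ?q)"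
  proof -
    have "1 * r - s * (s / r) = (r * r - s\<^sup>2) / r" if "0 < r" for r
      using that by (simp add: field_simps power2_eq_square)
    from this[OF q(1)] have "1 * ?q - s * (s / ?q) = (?q * ?q - s\<^sup>2) / ?q" .
    also have "\<dots> = \<eta>\<^sup>2 / ?q" unfolding q(2) by simp
    finally have eq: "1 * ?q - s * (s / ?q) = \<eta>\<^sup>2 / ?q" .
    have "(0 + (c / r) / (r * r)) / 2 = c / (2 * (r * r) * r)" for c r :: real
      by simp
    then show ?thesis unfolding eq .
  qed
  ultimately show ?thesis unfolding smooth_pos'_def[abs_def] q(2) by simp
qed

lemma continuous_smooth_pos': "continuous_on S (smooth_pos' \<eta>)"
  by (intro continuous_at_imp_continuous_on ballI DERIV_isCont[OF DERIV_smooth_pos'])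

lemma continuous_smooth_pos'': "continuous_on S (\<lambda>s. \<eta>\<^sup>2 / (2 * (s\<^sup>2 + \<eta>\<^sup>2) * sqrt (s\<^sup>2 + \<eta>\<^sup>2)))"
  by (intro continuous_intros ballI) (simp only: mult_eq_0_iff real_sqrt_eq_zero_cancel_iff sqrt_ne, simp)

lemma smooth_pos'_bounds: "0 \<le> smooth_pos' \<eta> s" "smooth_pos' \<eta> s \<le> 1"
proof -
  have "\<bar>s\<bar> \<le> sqrt (s\<^sup>2 + \<eta>\<^sup>2)" using real_sqrt_sum_squares_ge1[of s \<eta>] by (simp add: abs_le_iff real_le_rsqrt)
  then have "\<bar>s / sqrt (s\<^sup>2 + \<eta>\<^sup>2)\<bar> \<le> 1" using sqrt_pos[of s] by (simp add: abs_divide divide_le_eq)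
  then have "- 1 \<le> s / sqrt (s\<^sup>2 + \<eta>\<^sup>2)" "s / sqrt (s\<^sup>2 + \<eta>\<^sup>2) \<le> 1"
    unfolding abs_le_iff by linarith+
  then show "0 \<le> smooth_pos' \<eta> s" "smooth_pos' \<eta> s \<le> 1" unfolding smooth_pos'_def by simp_all
qed

lemma smooth_pos_approx: "\<bar>smooth_pos \<eta> s - max s 0\<bar> \<le> \<eta> / 2"
proof -
  have "sqrt (s\<^sup>2 + \<eta>\<^sup>2) \<le> \<bar>s\<bar> + \<eta>"
    using \<eta> by (intro real_le_lsqrt) (auto simp: power2_sum)
  moreover have "\<bar>s\<bar> \<le> sqrt (s\<^sup>2 + \<eta>\<^sup>2)" by (simp add: real_le_rsqrt)
  moreover have "max s 0 = (s + \<bar>s\<bar>) / 2" by auto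
  moreover have "\<bar>(s + q) / 2 - m\<bar> \<le> \<eta> / 2" if "q \<le> a + \<eta>" "a \<le> q" "m = (s + a) / 2" for q a m
    using that by (simp add: abs_le_iff field_simps)
  ultimately show ?thesis unfolding smooth_pos_def by blast
qed

lemma smooth_pos_bound: "\<bar>smooth_pos \<eta> s\<bar> \<le> \<bar>s\<bar> + \<eta>"
proof -
  have "\<bar>smooth_pos \<eta> s\<bar> \<le> \<bar>smooth_pos \<eta> s - max s 0\<bar> + \<bar>max s 0\<bar>"
    using abs_triangle_ineq[of "smooth_pos \<eta> s - max s 0" "max s 0"] by simp
  moreover have "\<bar>max s 0\<bar> \<le> \<bar>s\<bar>" by simp
  ultimately show ?thesis using smooth_pos_approx[of s] \<eta> by linarith
qed

lemma smooth_pos_Lipschitz: "\<bar>smooth_pos \<eta> s - smooth_pos \<eta> t\<bar> \<le> \<bar>s - t\<bar>"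
  using field_differentiable_bound[of UNIV "smooth_pos \<eta>" "smooth_pos' \<eta>" 1 s t]
    DERIV_smooth_pos smooth_pos'_bounds by auto

end

lemma smooth_pos'_limit:
  assumes "\<And>n. 0 < h n" "h \<longlonglongrightarrow> 0"
  shows "(\<lambda>n. smooth_pos' (h n) s) \<longlonglongrightarrow> (1 + sgn s) / 2"
proof (cases "s = 0")
  case False
  have "(\<lambda>n. (1 + s / sqrt (s\<^sup>2 + (h n)\<^sup>2)) / 2) \<longlonglongrightarrow> (1 + s / sqrt (s\<^sup>2 + 0\<^sup>2)) / 2"
    using assms(2) False by (intro tendsto_intros) auto
  moreover have "s / sqrt (s\<^sup>2 + 0\<^sup>2) = sgn s" by (simp add: sgn_real_def abs_if)
  ultimately show ?thesis by (simp add: smooth_pos'_def)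
qed (simp add: smooth_pos'_def)

section \<open>Continuously differentiable functions\<close>

lemma Ck_on_1_iff:
  "Ck_on 1 f S \<longleftrightarrow> (\<forall>x\<in>S. f differentiable (at x)) \<and> (\<forall>v. continuous_on S (\<lambda>x. frechet_derivative f (at x) v))"
  by simp

lemma Ck_on_1I:
  assumes "\<And>x. (f has_derivative f' x) (at x)" "\<And>v. continuous_on UNIV (\<lambda>x. f' x v)"
  shows "Ck_on 1 f UNIV"
proof -
  have "frechet_derivative f (at x) = f' x" for x
    using frechet_derivative_at[OF assms(1)] by simp
  then show ?thesis unfolding Ck_on_1_iff using assms by (auto simp: differentiable_def)
qed

lemma Ck_on_1_has_derivative:
  "Ck_on 1 f UNIV \<Longrightarrow> (f has_derivative frechet_derivative f (at x)) (at x)"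
  unfolding Ck_on_1_iff frechet_derivative_works[symmetric] by simp

lemma Ck_on_1_continuous: "Ck_on 1 f UNIV \<Longrightarrow> continuous_on S f"
  by (meson Ck_on_1_has_derivative continuous_at_imp_continuous_on has_derivative_continuous)

lemma Ck_on_1_derivative_continuous:
  "Ck_on 1 f UNIV \<Longrightarrow> continuous_on UNIV (\<lambda>x. frechet_derivative f (at x) v)"
  unfolding Ck_on_1_iff by simp

lemma Ck_on_1_add:
  assumes "Ck_on 1 f UNIV" "Ck_on 1 g UNIV"
  shows "Ck_on 1 (\<lambda>x. f x + g x) UNIV"
  by (rule Ck_on_1I[OF has_derivative_add[OF assms[THEN Ck_on_1_has_derivative]]])
     (intro continuous_intros Ck_on_1_derivative_continuous assms)

lemma Ck_on_1_scaleR: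
  assumes "Ck_on 1 f UNIV" "Ck_on 1 g UNIV"
  shows "Ck_on 1 (\<lambda>x. f x *\<^sub>R g x) UNIV"
  by (rule Ck_on_1I[OF has_derivative_scaleR[OF assms[THEN Ck_on_1_has_derivative]]])
     (intro continuous_intros Ck_on_1_derivative_continuous Ck_on_1_continuous assms)

lemma Ck_on_1_const: "Ck_on 1 (\<lambda>x. c) UNIV"
  by (rule Ck_on_1I[OF has_derivative_const]) simp

lemma has_derivative_compose_real:
  assumes "Ck_on 1 f UNIV" "\<And>s. (g has_real_derivative g' s) (at s)"
  shows "((\<lambda>x. g (f x)) has_derivative (\<lambda>v. g' (f x) * frechet_derivative f (at x) v)) (at x)"
  using has_derivative_compose[OF Ck_on_1_has_derivative[OF assms(1)], of g "(*) (g' (f x))"] assms(2)[of "f x"]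
  by (simp add: has_field_derivative_def)

lemma Ck_on_1_compose_real:
  assumes "Ck_on 1 f UNIV" "\<And>s. (g has_real_derivative g' s) (at s)" "continuous_on UNIV g'"
  shows "Ck_on 1 (\<lambda>x. g (f x)) UNIV"
  by (rule Ck_on_1I[OF has_derivative_compose_real[OF assms(1,2)]])
     (intro continuous_intros Ck_on_1_derivative_continuous assms continuous_on_compose2[OF assms(3)]
        Ck_on_1_continuous subset_UNIV)

lemma frechet_derivative_compose_real:
  assumes "Ck_on 1 f UNIV" "\<And>s. (g has_real_derivative g' s) (at s)"
  shows "frechet_derivative (\<lambda>x. g (f x)) (at x) v = g' (f x) * frechet_derivative f (at x) v"
  using frechet_derivative_at[OF has_derivative_compose_real[OF assms]] by metis

lemma tangential_gradient_compose:
  assumes "Ck_on 1 \<phi> UNIV" "\<And>s. (g has_real_derivative g' s) (at s)"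
  shows "tangential_gradient \<Omega> (\<lambda>x. g (\<phi> x)) x = g' (\<phi> x) *\<^sub>R tangential_gradient \<Omega> \<phi> x"
  unfolding tangential_gradient_def gradient_def frechet_derivative_compose_real[OF assms]
  by (simp add: scaleR_diff_right flip: scaleR_scaleR scaleR_sum_right)

lemma tangential_gradient_add_scaled:
  assumes "Ck_on 1 \<phi> UNIV" "Ck_on 1 \<psi> UNIV"
  shows "tangential_gradient \<Omega> (\<lambda>x. \<phi> x + c * \<psi> x) x
    = tangential_gradient \<Omega> \<phi> x + c *\<^sub>R tangential_gradient \<Omega> \<psi> x"
proof -
  have "((\<lambda>x. \<phi> x + c * \<psi> x) has_derivative
      (\<lambda>v. frechet_derivative \<phi> (at x) v + c * frechet_derivative \<psi> (at x) v)) (at x)"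
    using Ck_on_1_has_derivative[OF assms(1)] Ck_on_1_has_derivative[OF assms(2)]
    by (auto intro!: derivative_eq_intros)
  from frechet_derivative_at[OF this] have
    "frechet_derivative (\<lambda>x. \<phi> x + c * \<psi> x) (at x)
      = (\<lambda>v. frechet_derivative \<phi> (at x) v + c * frechet_derivative \<psi> (at x) v)" by simp
  then have "gradient (\<lambda>x. \<phi> x + c * \<psi> x) x = gradient \<phi> x + c *\<^sub>R gradient \<psi> x"
    by (simp add: gradient_def scaleR_add_left sum.distrib scaleR_sum_right)
  then show ?thesis by (simp add: tangential_gradient_def inner_add_left algebra_simps)
qed

section \<open>The lattice structure of the Sobolev space on the boundary\<close>

lemma L2_const:
  assumes "finite_measure M"
  shows "(\<lambda>x. c) \<in> L2 M"
  using assms by (simp add: L2_def finite_measure.integrable_const)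

lemma L2_dominated_convergence:
  fixes f :: "nat \<Rightarrow> 'a \<Rightarrow> 'b::euclidean_space"
  assumes g: "g \<in> L2 M" and f: "\<And>k. f k \<in> borel_measurable M" "f0 \<in> borel_measurable M"
    and bound: "\<And>k x. norm (f k x) \<le> (g x :: real)"
    and lim: "AE x in M. (\<lambda>k. f k x) \<longlonglongrightarrow> f0 x"
  shows "(\<lambda>k. L2_dist M (f k) f0) \<longlonglongrightarrow> 0"
proof -
  have "(\<lambda>k. LINT x|M. (norm (f k x - f0 x))\<^sup>2) \<longlonglongrightarrow> (LINT x|M. 0)"
  proof (rule integral_dominated_convergence)
    show "integrable M (\<lambda>x. 4 * (norm (g x))\<^sup>2)" using L2_integrable[OF g] by simp
    show "AE x in M. norm ((norm (f k x - f0 x))\<^sup>2) \<le> 4 * (norm (g x))\<^sup>2" for k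
      using lim
    proof eventually_elim
      case (elim x)
      have "norm (f0 x) \<le> g x"
        using tendsto_norm[OF elim] by (rule tendsto_upperbound) (auto simp: bound)
      then have "norm (f k x - f0 x) \<le> 2 * g x"
        using norm_triangle_ineq4[of "f k x" "f0 x"] bound[of k x] by simp
      from power_mono[OF this, of 2] show ?case by (simp add: power_mult_distrib)
    qed
    show "AE x in M. (\<lambda>k. (norm (f k x - f0 x))\<^sup>2) \<longlonglongrightarrow> 0"
      using lim
    proof eventually_elim
      case (elim x)
      have "(\<lambda>k. (norm (f k x - f0 x))\<^sup>2) \<longlonglongrightarrow> (norm (f0 x - f0 x))\<^sup>2"
        by (intro tendsto_intros elim)
      then show ?case by simp
    qed
  qed (use f in measurable)
  from tendsto_real_sqrt[OF this] show ?thesis by (simp add: L2_dist_def L2_norm_def)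
qed

text \<open>Pointwise convergence is needed to pass to the limit in nonlinear functions of a convergent sequence.\<close>

lemma L2_converges_subseq_AE:
  fixes f :: "nat \<Rightarrow> 'a \<Rightarrow> real"
  assumes "L2_converges M f g"
  obtains r where "strict_mono r" "AE x in M. (\<lambda>k. f (r k) x) \<longlonglongrightarrow> g x"
proof -
  have L2: "f k \<in> L2 M" "g \<in> L2 M" for k using assms by (auto simp: L2_converges_def)
  have "(\<lambda>k. (L2_dist M (f k) g)\<^sup>2) \<longlonglongrightarrow> 0\<^sup>2"
    using assms by (intro tendsto_power) (simp add: L2_converges_def)
  then have "(\<lambda>k. LINT x|M. norm ((f k x - g x)\<^sup>2)) \<longlonglongrightarrow> 0"
    by (simp add: L2_dist_def L2_norm_power2)
  moreover have "integrable M (\<lambda>x. (f k x - g x)\<^sup>2)" for k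
    using L2_integrable[OF L2_diff[OF L2]] by simp
  ultimately obtain r where r: "strict_mono r" "AE x in M. (\<lambda>k. (f (r k) x - g x)\<^sup>2) \<longlonglongrightarrow> 0"
    using tendsto_L1_AE_subseq[of M "\<lambda>k x. (f k x - g x)\<^sup>2"] by blast
  have "AE x in M. (\<lambda>k. f (r k) x) \<longlonglongrightarrow> g x"
    using r(2)
  proof eventually_elim
    case (elim x)
    then have "(\<lambda>k. sqrt ((f (r k) x - g x)\<^sup>2)) \<longlonglongrightarrow> sqrt 0" by (rule tendsto_real_sqrt)
    then show ?case by (simp add: tendsto_rabs_zero_iff LIM_zero_iff)
  qed
  with r(1) show ?thesis by (rule that)
qed

lemma has_surface_gradient_L2:
  assumes "has_surface_gradient \<Omega> w G"
  shows "w \<in> L2 (boundary_measure \<Omega>)" "G \<in> L2 (boundary_measure \<Omega>)"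
  using assms by (auto simp: has_surface_gradient_def L2_converges_def)

lemma has_surface_gradient_add_scaled:
  assumes "has_surface_gradient \<Omega> w G" "has_surface_gradient \<Omega> v H"
  shows "has_surface_gradient \<Omega> (\<lambda>x. w x + c * v x) (\<lambda>x. G x + c *\<^sub>R H x)"
proof -
  let ?M = "boundary_measure \<Omega>"
  have lin: "L2_converges ?M (\<lambda>k x. f k x + c *\<^sub>R g k x) (\<lambda>x. f0 x + c *\<^sub>R g0 x)"
    if f: "L2_converges ?M f f0" and g: "L2_converges ?M g g0"
    for f g :: "nat \<Rightarrow> 'a \<Rightarrow> 'b::euclidean_space" and f0 g0
  proof -
    have L2: "f k \<in> L2 ?M" "f0 \<in> L2 ?M" "g k \<in> L2 ?M" "g0 \<in> L2 ?M" for k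
      using f g by (auto simp: L2_converges_def)
    have le: "L2_dist ?M (\<lambda>x. f k x + c *\<^sub>R g k x) (\<lambda>x. f0 x + c *\<^sub>R g0 x)
        \<le> L2_dist ?M (f k) f0 + \<bar>c\<bar> * L2_dist ?M (g k) g0" for k
      using L2_dist_add[OF L2(1) L2_scale[OF L2(3)] L2(2) L2_scale[OF L2(4)], of k c k c]
      by (simp only: L2_dist_def L2_norm_scale scaleR_diff_right[symmetric])
    have lim: "(\<lambda>k. L2_dist ?M (f k) f0 + \<bar>c\<bar> * L2_dist ?M (g k) g0) \<longlonglongrightarrow> 0 + \<bar>c\<bar> * 0"
      using f g by (intro tendsto_intros) (auto simp: L2_converges_def)
    have "(\<lambda>k. L2_dist ?M (\<lambda>x. f k x + c *\<^sub>R g k x) (\<lambda>x. f0 x + c *\<^sub>R g0 x)) \<longlonglongrightarrow> 0"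
      by (rule Lim_null_comparison[OF _ lim[simplified]]) (use le in \<open>simp add: L2_dist_nonneg\<close>)
    then show ?thesis using L2 by (auto simp: L2_converges_def intro!: L2_add L2_scale)
  qed
  obtain \<phi> \<psi> where \<phi>: "\<And>k. Ck_on 1 (\<phi> k) UNIV" "L2_converges ?M \<phi> w"
      "L2_converges ?M (\<lambda>k. tangential_gradient \<Omega> (\<phi> k)) G"
    and \<psi>: "\<And>k. Ck_on 1 (\<psi> k) UNIV" "L2_converges ?M \<psi> v"
      "L2_converges ?M (\<lambda>k. tangential_gradient \<Omega> (\<psi> k)) H"
    using assms unfolding has_surface_gradient_def by blast
  show ?thesis unfolding has_surface_gradient_def
  proof (intro exI[of _ "\<lambda>k x. \<phi> k x + c * \<psi> k x"] conjI allI)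
    show "Ck_on 1 (\<lambda>x. \<phi> k x + c * \<psi> k x) UNIV" for k
      using Ck_on_1_add[OF \<phi>(1) Ck_on_1_scaleR[OF Ck_on_1_const \<psi>(1)], of k c k] by simp
    show "L2_converges ?M (\<lambda>k x. \<phi> k x + c * \<psi> k x) (\<lambda>x. w x + c * v x)"
      using lin[OF \<phi>(2) \<psi>(2)] by simp
    have "tangential_gradient \<Omega> (\<lambda>x. \<phi> k x + c * \<psi> k x)
        = (\<lambda>x. tangential_gradient \<Omega> (\<phi> k) x + c *\<^sub>R tangential_gradient \<Omega> (\<psi> k) x)" for k
      using tangential_gradient_add_scaled[OF \<phi>(1) \<psi>(1)] by (intro ext)
    then show "L2_converges ?M (\<lambda>k. tangential_gradient \<Omega> (\<lambda>x. \<phi> k x + c * \<psi> k x)) (\<lambda>x. G x + c *\<^sub>R H x)"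
      using lin[OF \<phi>(3) \<psi>(3)] by simp
  qed
qed

text \<open>The graph of the surface gradient is closed, by a diagonal choice from the approximating sequences.\<close>

lemma has_surface_gradient_closed:
  assumes w: "w \<in> L2 (boundary_measure \<Omega>)" and G: "G \<in> L2 (boundary_measure \<Omega>)"
    and grad: "\<And>n::nat. has_surface_gradient \<Omega> (v n) (H n)"
    and lim: "(\<lambda>n. L2_dist (boundary_measure \<Omega>) (v n) w) \<longlonglongrightarrow> 0"
      "(\<lambda>n. L2_dist (boundary_measure \<Omega>) (H n) G) \<longlonglongrightarrow> 0"
  shows "has_surface_gradient \<Omega> w G"
proof -
  let ?M = "boundary_measure \<Omega>"
  have "\<exists>\<psi>. Ck_on 1 \<psi> UNIV \<and> \<psi> \<in> L2 ?M \<and> tangential_gradient \<Omega> \<psi> \<in> L2 ?M \<and>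
      L2_dist ?M \<psi> (v n) < 1 / Suc n \<and> L2_dist ?M (tangential_gradient \<Omega> \<psi>) (H n) < 1 / Suc n" for n
  proof -
    obtain \<phi> where \<phi>: "\<And>k. Ck_on 1 (\<phi> k) UNIV" "L2_converges ?M \<phi> (v n)"
      "L2_converges ?M (\<lambda>k. tangential_gradient \<Omega> (\<phi> k)) (H n)"
      using grad[of n] unfolding has_surface_gradient_def by blast
    have "\<forall>\<^sub>F k in sequentially. L2_dist ?M (\<phi> k) (v n) < 1 / Suc n"
      "\<forall>\<^sub>F k in sequentially. L2_dist ?M (tangential_gradient \<Omega> (\<phi> k)) (H n) < 1 / Suc n"
      using \<phi>(2,3) by (auto simp: L2_converges_def intro!: order_tendstoD(2))
    then have "\<forall>\<^sub>F k in sequentially. L2_dist ?M (\<phi> k) (v n) < 1 / Suc n \<and>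
        L2_dist ?M (tangential_gradient \<Omega> (\<phi> k)) (H n) < 1 / Suc n"
      by (rule eventually_conj)
    then obtain k where "L2_dist ?M (\<phi> k) (v n) < 1 / Suc n"
        "L2_dist ?M (tangential_gradient \<Omega> (\<phi> k)) (H n) < 1 / Suc n"
      by (auto simp: eventually_sequentially)
    then show ?thesis using \<phi> by (intro exI[of _ "\<phi> k"]) (auto simp: L2_converges_def)
  qed
  then obtain \<psi> where \<psi>: "\<And>n. Ck_on 1 (\<psi> n) UNIV" "\<And>n. \<psi> n \<in> L2 ?M" "\<And>n. tangential_gradient \<Omega> (\<psi> n) \<in> L2 ?M"
      "\<And>n. L2_dist ?M (\<psi> n) (v n) < 1 / Suc n" "\<And>n. L2_dist ?M (tangential_gradient \<Omega> (\<psi> n)) (H n) < 1 / Suc n"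
    by metis
  have conv: "(\<lambda>n. L2_dist ?M (f n) f0) \<longlonglongrightarrow> 0"
    if "\<And>n. f n \<in> L2 ?M" "\<And>n. g n \<in> L2 ?M" "f0 \<in> L2 ?M" "\<And>n. L2_dist ?M (f n) (g n) < 1 / Suc n"
      "(\<lambda>n. L2_dist ?M (g n) f0) \<longlonglongrightarrow> 0" for f g :: "nat \<Rightarrow> 'a \<Rightarrow> 'b::euclidean_space" and f0
  proof (rule Lim_null_comparison)
    show "(\<lambda>n. 1 / real (Suc n) + L2_dist ?M (g n) f0) \<longlonglongrightarrow> 0"
      using tendsto_add[OF LIMSEQ_Suc[OF lim_1_over_n] that(5)] by simp
    have "L2_dist ?M (f n) f0 \<le> 1 / real (Suc n) + L2_dist ?M (g n) f0" for n
      using L2_dist_triangle[OF that(1,2,3), of n n] that(4)[of n] by linarith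
    then show "\<forall>\<^sub>F n in sequentially. norm (L2_dist ?M (f n) f0) \<le> 1 / real (Suc n) + L2_dist ?M (g n) f0"
      by (intro always_eventually) (simp add: L2_dist_nonneg)
  qed
  have "L2_converges ?M \<psi> w"
    using conv[OF \<psi>(2) has_surface_gradient_L2(1)[OF grad] w \<psi>(4) lim(1)] w \<psi>(2) by (simp add: L2_converges_def)
  moreover have "L2_converges ?M (\<lambda>n. tangential_gradient \<Omega> (\<psi> n)) G"
    using conv[OF \<psi>(3) has_surface_gradient_L2(2)[OF grad] G \<psi>(5) lim(2)] G \<psi>(3) by (simp add: L2_converges_def)
  ultimately show ?thesis using \<psi>(1) unfolding has_surface_gradient_def by blast
qed

text \<open>The chain rule survives the passage to the limit: the factors \<open>smooth_pos' \<eta> (\<phi> k x)\<close> converge almost everywhere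
  along a subsequence, boundedly, so they may be applied to the limit gradient \<open>H\<close>; replacing \<open>H\<close> by the
  approximating gradients costs no more than their distance to \<open>H\<close> because the factors are at most one.\<close>

lemma has_surface_gradient_smooth_pos:
  assumes fin: "finite_measure (boundary_measure \<Omega>)" and grad: "has_surface_gradient \<Omega> w H" and \<eta>: "0 < \<eta>"
  shows "has_surface_gradient \<Omega> (\<lambda>x. smooth_pos \<eta> (w x)) (\<lambda>x. smooth_pos' \<eta> (w x) *\<^sub>R H x)"
proof -
  let ?M = "boundary_measure \<Omega>"
  note w = has_surface_gradient_L2(1)[OF grad] and H = has_surface_gradient_L2(2)[OF grad]
  obtain \<phi>0 where \<phi>0: "\<And>k. Ck_on 1 (\<phi>0 k) UNIV" "L2_converges ?M \<phi>0 w"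
      "L2_converges ?M (\<lambda>k. tangential_gradient \<Omega> (\<phi>0 k)) H"
    using grad unfolding has_surface_gradient_def by blast
  obtain r where r: "strict_mono r" "AE x in ?M. (\<lambda>k. \<phi>0 (r k) x) \<longlonglongrightarrow> w x"
    using L2_converges_subseq_AE[OF \<phi>0(2)] .
  define \<phi> where "\<phi> k = \<phi>0 (r k)" for k
  have \<phi>: "Ck_on 1 (\<phi> k) UNIV" "\<phi> k \<in> L2 ?M" "tangential_gradient \<Omega> (\<phi> k) \<in> L2 ?M" for k
    using \<phi>0 by (auto simp: \<phi>_def L2_converges_def)
  have \<phi>lim: "(\<lambda>k. L2_dist ?M (\<phi> k) w) \<longlonglongrightarrow> 0" "(\<lambda>k. L2_dist ?M (tangential_gradient \<Omega> (\<phi> k)) H) \<longlonglongrightarrow> 0"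
    using LIMSEQ_subseq_LIMSEQ[OF _ r(1), of "\<lambda>k. L2_dist ?M (\<phi>0 k) w"]
      LIMSEQ_subseq_LIMSEQ[OF _ r(1), of "\<lambda>k. L2_dist ?M (tangential_gradient \<Omega> (\<phi>0 k)) H"] \<phi>0(2,3)
    by (auto simp: \<phi>_def L2_converges_def o_def)
  have AElim: "AE x in ?M. (\<lambda>k. \<phi> k x) \<longlonglongrightarrow> w x" using r(2) by (simp add: \<phi>_def)
  have meas: "smooth_pos \<eta> \<in> borel_measurable borel" "smooth_pos' \<eta> \<in> borel_measurable borel"
    by (intro borel_measurable_continuous_onI continuous_smooth_pos'[OF \<eta>] continuous_at_imp_continuous_on
        ballI DERIV_isCont[OF DERIV_smooth_pos[OF \<eta>]])+
  have smL2: "(\<lambda>x. smooth_pos \<eta> (f x)) \<in> L2 ?M" if f: "f \<in> L2 ?M" for f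
  proof (rule L2_bound[where g = "\<lambda>x. \<bar>f x\<bar> + \<eta>"])
    have "(\<lambda>x. \<bar>f x\<bar>) \<in> L2 ?M" using L2_norm_fun[OF f] by simp
    then show "(\<lambda>x. \<bar>f x\<bar> + \<eta>) \<in> L2 ?M" by (intro L2_add L2_const fin)
    show "(\<lambda>x. smooth_pos \<eta> (f x)) \<in> borel_measurable ?M"
      using meas(1) L2_measurable[OF f] by (rule measurable_compose[rotated])
    show "norm (smooth_pos \<eta> (f x)) \<le> norm (\<bar>f x\<bar> + \<eta>)" for x
      using smooth_pos_bound[OF \<eta>, of "f x"] \<eta> by simp
  qed
  have sm': "(\<lambda>x. smooth_pos' \<eta> (f x) *\<^sub>R g x) \<in> L2 ?M" if f: "f \<in> L2 ?M" and g: "g \<in> L2 ?M"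
    for f and g :: "'a \<Rightarrow> 'a"
  proof (rule L2_bound[OF g])
    show "(\<lambda>x. smooth_pos' \<eta> (f x) *\<^sub>R g x) \<in> borel_measurable ?M"
      using measurable_compose[OF L2_measurable[OF f] meas(2)] L2_measurable[OF g]
      by (intro borel_measurable_scaleR)
    show "norm (smooth_pos' \<eta> (f x) *\<^sub>R g x) \<le> norm (g x)" for x
      using smooth_pos'_bounds[OF \<eta>, of "f x"] by (simp add: mult_left_le_one_le)
  qed
  show ?thesis
    unfolding has_surface_gradient_def
  proof (intro exI[of _ "\<lambda>k x. smooth_pos \<eta> (\<phi> k x)"] conjI allI)
    show "Ck_on 1 (\<lambda>x. smooth_pos \<eta> (\<phi> k x)) UNIV" for k
      by (rule Ck_on_1_compose_real[OF \<phi>(1) DERIV_smooth_pos[OF \<eta>] continuous_smooth_pos'[OF \<eta>]])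
    have "L2_dist ?M (\<lambda>x. smooth_pos \<eta> (\<phi> k x)) (\<lambda>x. smooth_pos \<eta> (w x)) \<le> L2_dist ?M (\<phi> k) w" for k
      unfolding L2_dist_def
      using L2_measurable[OF L2_diff[OF smL2[OF \<phi>(2)[of k]] smL2[OF w]]] L2_diff[OF \<phi>(2) w] smooth_pos_Lipschitz[OF \<eta>]
      by (intro L2_norm_mono) auto
    then have "(\<lambda>k. L2_dist ?M (\<lambda>x. smooth_pos \<eta> (\<phi> k x)) (\<lambda>x. smooth_pos \<eta> (w x))) \<longlonglongrightarrow> 0"
      by (intro Lim_null_comparison[OF _ \<phi>lim(1)]) (auto simp: L2_dist_nonneg)
    then show "L2_converges ?M (\<lambda>k x. smooth_pos \<eta> (\<phi> k x)) (\<lambda>x. smooth_pos \<eta> (w x))"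
      using smL2 \<phi>(2) w by (simp add: L2_converges_def)
    have tg: "tangential_gradient \<Omega> (\<lambda>x. smooth_pos \<eta> (\<phi> k x))
        = (\<lambda>x. smooth_pos' \<eta> (\<phi> k x) *\<^sub>R tangential_gradient \<Omega> (\<phi> k) x)" for k
      by (intro ext tangential_gradient_compose[OF \<phi>(1) DERIV_smooth_pos[OF \<eta>]])
    have lim1: "(\<lambda>k. L2_dist ?M (\<lambda>x. smooth_pos' \<eta> (\<phi> k x) *\<^sub>R H x) (\<lambda>x. smooth_pos' \<eta> (w x) *\<^sub>R H x)) \<longlonglongrightarrow> 0"
    proof (rule L2_dominated_convergence)
      show "(\<lambda>x. norm (H x)) \<in> L2 ?M" by (rule L2_norm_fun[OF H])
      show "norm (smooth_pos' \<eta> (\<phi> k x) *\<^sub>R H x) \<le> norm (H x)" for k x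
        using smooth_pos'_bounds[OF \<eta>, of "\<phi> k x"] by (simp add: mult_left_le_one_le)
      show "AE x in ?M. (\<lambda>k. smooth_pos' \<eta> (\<phi> k x) *\<^sub>R H x) \<longlonglongrightarrow> smooth_pos' \<eta> (w x) *\<^sub>R H x"
        using AElim
      proof eventually_elim
        case (elim x)
        show ?case
          using DERIV_isCont[OF DERIV_smooth_pos'[OF \<eta>]]
          by (intro tendsto_scaleR tendsto_const isCont_tendsto_compose[OF _ elim])
      qed
    qed (use sm'[OF \<phi>(2) H] sm'[OF w H] in \<open>auto dest: L2_measurable\<close>)
    have "L2_dist ?M (\<lambda>x. smooth_pos' \<eta> (\<phi> k x) *\<^sub>R tangential_gradient \<Omega> (\<phi> k) x) (\<lambda>x. smooth_pos' \<eta> (w x) *\<^sub>R H x)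
        \<le> L2_dist ?M (tangential_gradient \<Omega> (\<phi> k)) H
          + L2_dist ?M (\<lambda>x. smooth_pos' \<eta> (\<phi> k x) *\<^sub>R H x) (\<lambda>x. smooth_pos' \<eta> (w x) *\<^sub>R H x)" for k
    proof -
      have "L2_dist ?M (\<lambda>x. smooth_pos' \<eta> (\<phi> k x) *\<^sub>R tangential_gradient \<Omega> (\<phi> k) x) (\<lambda>x. smooth_pos' \<eta> (\<phi> k x) *\<^sub>R H x)
          \<le> L2_dist ?M (tangential_gradient \<Omega> (\<phi> k)) H"
        unfolding L2_dist_def
      proof (rule L2_norm_mono)
        show "(\<lambda>x. smooth_pos' \<eta> (\<phi> k x) *\<^sub>R tangential_gradient \<Omega> (\<phi> k) x - smooth_pos' \<eta> (\<phi> k x) *\<^sub>R H x) \<in> borel_measurable ?M"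
          by (intro L2_measurable L2_diff sm' \<phi> H)
        show "norm (smooth_pos' \<eta> (\<phi> k x) *\<^sub>R tangential_gradient \<Omega> (\<phi> k) x - smooth_pos' \<eta> (\<phi> k x) *\<^sub>R H x)
            \<le> norm (tangential_gradient \<Omega> (\<phi> k) x - H x)" for x
          using smooth_pos'_bounds[OF \<eta>, of "\<phi> k x"]
          by (simp add: mult_left_le_one_le flip: scaleR_diff_right)
      qed (intro L2_diff \<phi> H)
      then show ?thesis
        using L2_dist_triangle[OF sm'[OF \<phi>(2) \<phi>(3)] sm'[OF \<phi>(2) H] sm'[OF w H], of k k k] by linarith
    qed
    then have "(\<lambda>k. L2_dist ?M (\<lambda>x. smooth_pos' \<eta> (\<phi> k x) *\<^sub>R tangential_gradient \<Omega> (\<phi> k) x) (\<lambda>x. smooth_pos' \<eta> (w x) *\<^sub>R H x)) \<longlonglongrightarrow> 0"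
      by (intro Lim_null_comparison[OF _ tendsto_add_zero[OF \<phi>lim(2) lim1]])
         (auto simp: L2_dist_nonneg)
    then show "L2_converges ?M (\<lambda>k. tangential_gradient \<Omega> (\<lambda>x. smooth_pos \<eta> (\<phi> k x))) (\<lambda>x. smooth_pos' \<eta> (w x) *\<^sub>R H x)"
      unfolding tg using sm' \<phi> w H by (simp add: L2_converges_def)
  qed
qed

text \<open>The factor \<open>(1 + sgn (w x)) / 2\<close> is the pointwise limit of the derivatives of the smooth approximations; on
  the zero set of \<open>w\<close> it is one half. It lies between zero and one, so that the pairing of the gradient of
  the positive part with \<open>H\<close> is nonnegative.\<close>

lemma has_surface_gradient_pos:
  assumes fin: "finite_measure (boundary_measure \<Omega>)" and grad: "has_surface_gradient \<Omega> w H"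
  shows "has_surface_gradient \<Omega> (\<lambda>x. max (w x) 0) (\<lambda>x. ((1 + sgn (w x)) / 2) *\<^sub>R H x)"
proof -
  let ?M = "boundary_measure \<Omega>"
  define h where "h n = 1 / real (Suc n)" for n
  have h: "0 < h n" "h n \<le> 1" for n by (simp_all add: h_def)
  have h0: "h \<longlonglongrightarrow> 0" unfolding h_def by (rule LIMSEQ_Suc[OF lim_1_over_n])
  note w = has_surface_gradient_L2(1)[OF grad] and H = has_surface_gradient_L2(2)[OF grad]
  note smooth = has_surface_gradient_smooth_pos[OF fin grad h(1)]
  have P: "(\<lambda>x. ((1 + sgn (w x)) / 2) *\<^sub>R H x) \<in> L2 ?M"
  proof (rule L2_bound[OF H])
    have "(\<lambda>x. (1 + sgn (w x)) / 2) \<in> borel_measurable ?M"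
      using L2_measurable[OF w] by (simp add: sgn_real_def)
    then show "(\<lambda>x. ((1 + sgn (w x)) / 2) *\<^sub>R H x) \<in> borel_measurable ?M"
      using L2_measurable[OF H] by (intro borel_measurable_scaleR)
    show "norm (((1 + sgn (w x)) / 2) *\<^sub>R H x) \<le> norm (H x)" for x
      by (auto simp: sgn_real_def)
  qed
  show ?thesis
  proof (rule has_surface_gradient_closed[OF L2_pos[OF w] P smooth])
    show "(\<lambda>n. L2_dist ?M (\<lambda>x. smooth_pos (h n) (w x)) (\<lambda>x. max (w x) 0)) \<longlonglongrightarrow> 0"
    proof (rule L2_dominated_convergence)
      have "(\<lambda>x. \<bar>w x\<bar>) \<in> L2 ?M" using L2_norm_fun[OF w] by simp
      then show "(\<lambda>x. \<bar>w x\<bar> + 1) \<in> L2 ?M" by (intro L2_add L2_const fin)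
      show "norm (smooth_pos (h n) (w x)) \<le> \<bar>w x\<bar> + 1" for n x
        using smooth_pos_bound[OF h(1), of n "w x"] h(2)[of n] by simp
      show "AE x in ?M. (\<lambda>n. smooth_pos (h n) (w x)) \<longlonglongrightarrow> max (w x) 0"
      proof (rule AE_I2)
        fix x
        have "(\<lambda>n. h n / 2) \<longlonglongrightarrow> 0" using tendsto_divide[OF h0 tendsto_const, of 2] by simp
        then have "(\<lambda>n. smooth_pos (h n) (w x) - max (w x) 0) \<longlonglongrightarrow> 0"
          by (rule Lim_null_comparison[rotated]) (use smooth_pos_approx[OF h(1)] in auto)
        then show "(\<lambda>n. smooth_pos (h n) (w x)) \<longlonglongrightarrow> max (w x) 0" by (simp add: LIM_zero_iff)
      qed
    qed (use L2_pos[OF w] smooth in \<open>auto dest: L2_measurable has_surface_gradient_L2\<close>)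
    show "(\<lambda>n. L2_dist ?M (\<lambda>x. smooth_pos' (h n) (w x) *\<^sub>R H x) (\<lambda>x. ((1 + sgn (w x)) / 2) *\<^sub>R H x)) \<longlonglongrightarrow> 0"
    proof (rule L2_dominated_convergence)
      show "(\<lambda>x. norm (H x)) \<in> L2 ?M" by (rule L2_norm_fun[OF H])
      show "norm (smooth_pos' (h n) (w x) *\<^sub>R H x) \<le> norm (H x)" for n x
        using smooth_pos'_bounds[OF h(1), of n "w x"] by (simp add: mult_left_le_one_le)
      show "AE x in ?M. (\<lambda>n. smooth_pos' (h n) (w x) *\<^sub>R H x) \<longlonglongrightarrow> ((1 + sgn (w x)) / 2) *\<^sub>R H x"
        by (intro AE_I2 tendsto_scaleR tendsto_const smooth_pos'_limit h h0)
    qed (use P smooth in \<open>auto dest: L2_measurable has_surface_gradient_L2\<close>)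
  qed
qed

section \<open>The area of a smooth compact boundary is finite\<close>

text \<open>Continuity of the derivative is only available along fixed directions, so the operator norm is bounded
  through the directions of the standard basis.\<close>

lemma Lipschitz_of_bounded_partial_derivatives:
  fixes f :: "'a::euclidean_space \<Rightarrow> 'b::real_normed_vector"
  assumes f: "Ck_on 1 f UNIV" and S: "convex S"
    and K: "\<And>x b. x \<in> S \<Longrightarrow> b \<in> Basis \<Longrightarrow> norm (frechet_derivative f (at x) b) \<le> K b"
    and xy: "x \<in> S" "y \<in> S"
  shows "norm (f x - f y) \<le> (\<Sum>b\<in>Basis. K b) * norm (x - y)"
proof (rule differentiable_bound[OF S _ _ xy])
  show "(f has_derivative frechet_derivative f (at x)) (at x within S)" if "x \<in> S" for x
    using Ck_on_1_has_derivative[OF f] by (rule has_derivative_at_withinI)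
  fix x assume x: "x \<in> S"
  have lin: "linear (frechet_derivative f (at x))"
    using Ck_on_1_has_derivative[OF f] has_derivative_linear by blast
  show "onorm (frechet_derivative f (at x)) \<le> (\<Sum>b\<in>Basis. K b)"
  proof (rule onorm_le)
    fix v :: 'a
    have "frechet_derivative f (at x) v = frechet_derivative f (at x) (\<Sum>b\<in>Basis. (v \<bullet> b) *\<^sub>R b)"
      by (simp add: euclidean_representation)
    also have "\<dots> = (\<Sum>b\<in>Basis. (v \<bullet> b) *\<^sub>R frechet_derivative f (at x) b)"
      by (simp add: linear_sum[OF lin] linear_cmul[OF lin])
    also have "norm \<dots> \<le> (\<Sum>b\<in>Basis. norm v * K b)"
      using K[OF x] by (intro sum_norm_le) (auto intro!: mult_mono Basis_le_norm)
    finally show "norm (frechet_derivative f (at x) v) \<le> (\<Sum>b\<in>Basis. K b) * norm v"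
      by (simp add: sum_distrib_left mult.commute)
  qed
qed

lemma C1_Lipschitz_on_cball:
  fixes f :: "'a::euclidean_space \<Rightarrow> 'b::real_normed_vector"
  assumes f: "Ck_on 1 f UNIV"
  obtains L where "0 \<le> L" "\<And>x y. x \<in> cball 0 R \<Longrightarrow> y \<in> cball 0 R \<Longrightarrow> norm (f x - f y) \<le> L * norm (x - y)"
proof -
  have "\<exists>K. \<forall>x\<in>cball 0 R. norm (frechet_derivative f (at x) b) \<le> K" for b
  proof -
    have "compact ((\<lambda>x. frechet_derivative f (at x) b) ` cball 0 R)"
      by (intro compact_continuous_image continuous_on_subset[OF Ck_on_1_derivative_continuous[OF f]]) auto
    from compact_imp_bounded[OF this] show ?thesis by (simp add: bounded_iff)
  qed
  then obtain K where K: "\<And>b x. x \<in> cball 0 R \<Longrightarrow> norm (frechet_derivative f (at x) b) \<le> K b" by metis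
  show ?thesis
  proof (rule that)
    show "0 \<le> (\<Sum>b\<in>Basis. \<bar>K b\<bar>)" by (simp add: sum_nonneg)
    have bound: "norm (frechet_derivative f (at x) b) \<le> \<bar>K b\<bar>" if "x \<in> cball 0 R" for x b
      using K[OF that, of b] by linarith
    show "norm (f x - f y) \<le> (\<Sum>b\<in>Basis. \<bar>K b\<bar>) * norm (x - y)" if "x \<in> cball 0 R" "y \<in> cball 0 R" for x y
      by (rule Lipschitz_of_bounded_partial_derivatives[OF f convex_cball bound that])
  qed
qed

text \<open>If distances in \<open>A\<close> are controlled by the coordinates along \<open>s\<close> directions, then a grid of \<open>k ^ s\<close> cells
  in these coordinates covers \<open>A\<close> by sets whose diameters are of order \<open>1 / k\<close>; the sum of the
  \<open>s\<close>-th powers of the diameters does not depend on \<open>k\<close>.\<close>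

lemma hausdorff_pre_le:
  fixes A :: "'a::euclidean_space set"
  assumes B: "finite B" "card B = s" and L: "0 \<le> L" and R: "0 < R" and \<delta>: "0 < \<delta>"
    and dist: "\<And>x y. x \<in> A \<Longrightarrow> y \<in> A \<Longrightarrow> norm (x - y) \<le> L * (\<Sum>b\<in>B. \<bar>(x - y) \<bullet> b\<bar>)"
    and coord: "\<And>x b. x \<in> A \<Longrightarrow> b \<in> B \<Longrightarrow> \<bar>x \<bullet> b\<bar> < R"
  shows "hausdorff_pre s \<delta> A \<le> ennreal (unit_ball_vol (real s) * (L * real s * R) ^ s)"
proof -
  obtain k0 :: nat where k0: "L * real s * 2 * R / \<delta> < real k0" using reals_Archimedean2 by blast
  define k where "k = Suc k0"
  have k: "0 < k" by (simp add: k_def)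
  define D where "D = L * real s * (2 * R / real k)"
  have D0: "0 \<le> D" using L R k by (simp add: D_def)
  have D\<delta>: "D \<le> \<delta>"
  proof -
    have "L * real s * 2 * R / \<delta> \<le> real k" using k0 by (simp add: k_def)
    then show ?thesis using \<delta> k by (simp add: D_def field_simps)
  qed
  define g where "g x b = nat \<lfloor>(x \<bullet> b + R) * real k / (2 * R)\<rfloor>" for x b :: 'a
  define F where "F = PiE B (\<lambda>_. {..<k})"
  have F: "finite F" "card F = k ^ s" unfolding F_def using B by (auto simp: card_PiE finite_PiE)
  define cell where "cell f = {x \<in> A. \<forall>b\<in>B. g x b = f b}" for f
  have g_lt: "g x b < k" if "x \<in> A" "b \<in> B" for x b
  proof -
    have "x \<bullet> b + R < 2 * R" using coord[OF that] by linarith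
    then have "(x \<bullet> b + R) * real k / (2 * R) < real k" using R k by (simp add: field_simps)
    then have "\<lfloor>(x \<bullet> b + R) * real k / (2 * R)\<rfloor> < int k" by (simp only: floor_less_iff of_int_of_nat_eq)
    then show ?thesis using k unfolding g_def by linarith
  qed
  have cover: "\<exists>f\<in>F. x \<in> cell f" if "x \<in> A" for x
  proof
    show "restrict (g x) B \<in> F" using g_lt[OF that] by (auto simp: F_def)
    show "x \<in> cell (restrict (g x) B)" using that by (simp add: cell_def)
  qed
  have diam: "norm (x - y) \<le> D" if "x \<in> cell f" "y \<in> cell f" for x y f
  proof -
    have xy: "x \<in> A" "y \<in> A" using that by (auto simp: cell_def)
    have "\<bar>(x - y) \<bullet> b\<bar> \<le> 2 * R / real k" if b: "b \<in> B" for b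
    proof -
      let ?u = "\<lambda>x. (x \<bullet> b + R) * real k / (2 * R)"
      have pos: "0 \<le> ?u x" "0 \<le> ?u y"
        using coord[OF xy(1) b] coord[OF xy(2) b] R by auto
      have "g x b = g y b" using \<open>x \<in> cell f\<close> \<open>y \<in> cell f\<close> b by (simp add: cell_def)
      then have "\<lfloor>?u x\<rfloor> = \<lfloor>?u y\<rfloor>" using pos by (simp add: g_def eq_nat_nat_iff)
      then have "\<bar>?u x - ?u y\<bar> \<le> 1" by linarith
      moreover have "?u x - ?u y = ((x - y) \<bullet> b) * (real k / (2 * R))"
        unfolding inner_diff_left diff_divide_distrib[symmetric] left_diff_distrib[symmetric] by simp
      ultimately have "\<bar>(x - y) \<bullet> b\<bar> * (real k / (2 * R)) \<le> 1" using R by (simp add: abs_mult)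
      then show ?thesis using R k by (simp add: field_simps)
    qed
    then have "(\<Sum>b\<in>B. \<bar>(x - y) \<bullet> b\<bar>) \<le> real s * (2 * R / real k)"
      using sum_bounded_above[of B "\<lambda>b. \<bar>(x - y) \<bullet> b\<bar>" "2 * R / real k"] B by simp
    then have "L * (\<Sum>b\<in>B. \<bar>(x - y) \<bullet> b\<bar>) \<le> L * (real s * (2 * R / real k))"
      using L by (rule mult_left_mono)
    then show ?thesis using dist[OF xy] by (simp add: D_def mult.assoc)
  qed
  obtain h where h: "bij_betw h {0..<card F} F" using ex_bij_betw_nat_finite[OF F(1)] by blast
  define C where "C j = (if j < card F then cell (h j) else {})" for j
  have diamC: "bounded (C j) \<and> diameter (C j) \<le> D" for j
  proof
    show "bounded (C j)" using diam D0
      by (auto simp: C_def bounded_two_points dist_norm intro!: exI[of _ D])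
    show "diameter (C j) \<le> D" using diam D0 by (intro diameter_le) (auto simp: C_def split: if_splits)
  qed
  have "A \<subseteq> (\<Union>j. C j)"
  proof
    fix x assume "x \<in> A"
    then obtain f where f: "f \<in> F" "x \<in> cell f" using cover by blast
    then have "f \<in> h ` {0..<card F}" using bij_betw_imp_surj_on[OF h] by simp
    then obtain j where "j < card F" "h j = f" by auto
    then show "x \<in> (\<Union>j. C j)" using f by (auto simp: C_def)
  qed
  then have C: "C \<in> {C. A \<subseteq> (\<Union>j. C j) \<and> (\<forall>j. bounded (C j) \<and> diameter (C j) \<le> \<delta>)}"
    using diamC D\<delta> by (auto intro: order_trans)
  let ?term = "\<lambda>j. if C j = {} then 0 else ennreal (unit_ball_vol (real s) * (diameter (C j) / 2) ^ s)"
  have "hausdorff_pre s \<delta> A \<le> (\<Sum>j. ?term j)"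
    unfolding hausdorff_pre_def by (rule INF_lower[OF C])
  also have "\<dots> = (\<Sum>j<card F. ?term j)" by (rule suminf_finite) (auto simp: C_def)
  also have "\<dots> \<le> (\<Sum>j<card F. ennreal (unit_ball_vol (real s) * (D / 2) ^ s))"
    using diamC D0 by (intro sum_mono)
      (auto intro!: ennreal_leI mult_left_mono power_mono divide_right_mono diameter_ge_0)
  also have "\<dots> = ennreal (real (k ^ s) * (unit_ball_vol (real s) * (D / 2) ^ s))"
    using D0 F(2) by (simp add: ennreal_mult ennreal_of_nat_eq_real_of_nat)
  also have "real (k ^ s) * (unit_ball_vol (real s) * (D / 2) ^ s) = unit_ball_vol (real s) * (real k * (D / 2)) ^ s"
    unfolding power_mult_distrib of_nat_power by (simp only: mult.left_commute)
  also have "real k * (D / 2) = L * real s * R" using k by (simp add: D_def)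
  finally show ?thesis .
qed

text \<open>On the graph of a Lipschitz function over the hyperplane orthogonal to \<open>e\<close>, distances are controlled by the
  coordinates with respect to an orthonormal basis of that hyperplane.\<close>

lemma hausdorff_outer_graph_finite:
  fixes \<gamma> :: "'a::euclidean_space \<Rightarrow> real"
  assumes e: "norm e = 1" and \<gamma>: "Ck_on 1 \<gamma> UNIV" and S: "bounded S"
    and graph: "\<And>x. x \<in> S \<Longrightarrow> x \<bullet> e = \<gamma> (x - (x \<bullet> e) *\<^sub>R e)"
  shows "hausdorff_outer (DIM('a) - 1) S < \<infinity>"
proof -
  obtain R where R: "0 < R" "\<And>x. x \<in> S \<Longrightarrow> norm x < R"
    using S bounded_pos_less by blast
  define proj where "proj x = x - (x \<bullet> e) *\<^sub>R e" for x
  have "norm (proj x) \<le> 2 * R" if "x \<in> S" for x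
  proof -
    have "\<bar>x \<bullet> e\<bar> \<le> norm x" using Cauchy_Schwarz_ineq2[of x e] e by simp
    then show ?thesis using norm_triangle_ineq4[of x "(x \<bullet> e) *\<^sub>R e"] e R(2)[OF that] by (simp add: proj_def)
  qed
  then have projR: "proj x \<in> cball 0 (2 * R)" if "x \<in> S" for x using that by simp
  obtain L where L: "0 \<le> L" "\<And>x y. x \<in> cball 0 (2 * R) \<Longrightarrow> y \<in> cball 0 (2 * R) \<Longrightarrow> norm (\<gamma> x - \<gamma> y) \<le> L * norm (x - y)"
    using C1_Lipschitz_on_cball[OF \<gamma>] by blast
  let ?H = "{x. e \<bullet> x = 0}"
  obtain B where B: "B \<subseteq> ?H" "pairwise orthogonal B" "\<And>b. b \<in> B \<Longrightarrow> norm b = 1" "independent B"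
      "card B = dim ?H" "span B = ?H"
    using orthonormal_basis_subspace[OF subspace_hyperplane[of e]] by blast
  have finB: "finite B" using B(4) independent_imp_finite by blast
  have "e \<noteq> 0" using e by auto
  then have cardB: "card B = DIM('a) - 1" using B(5) dim_hyperplane[of e] by simp
  have proj_le: "norm z \<le> (\<Sum>b\<in>B. \<bar>z \<bullet> b\<bar>)" if "e \<bullet> z = 0" for z
  proof -
    have "z = (\<Sum>b\<in>B. (z \<bullet> b) *\<^sub>R b)"
      using orthonormal_basis_expand[OF B(2,3) _ finB, of z] B(6) that by simp
    then have "norm z = norm (\<Sum>b\<in>B. (z \<bullet> b) *\<^sub>R b)" by simp
    also have "\<dots> \<le> (\<Sum>b\<in>B. \<bar>z \<bullet> b\<bar>)" using B(3) by (intro sum_norm_le) auto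
    finally show ?thesis .
  qed
  have "e \<bullet> e = 1" using e by (simp add: dot_square_norm)
  have est: "norm (x - y) \<le> (1 + L) * (\<Sum>b\<in>B. \<bar>(x - y) \<bullet> b\<bar>)" if "x \<in> S" "y \<in> S" for x y
  proof -
    have "x - y = (proj x - proj y) + (x \<bullet> e - y \<bullet> e) *\<^sub>R e" by (simp add: proj_def algebra_simps)
    then have "norm (x - y) \<le> norm (proj x - proj y) + norm ((x \<bullet> e - y \<bullet> e) *\<^sub>R e)"
      by (metis norm_triangle_ineq)
    also have "norm ((x \<bullet> e - y \<bullet> e) *\<^sub>R e) = norm (\<gamma> (proj x) - \<gamma> (proj y))"
      using graph[OF that(1)] graph[OF that(2)] e by (simp add: proj_def)
    also have "\<dots> \<le> L * norm (proj x - proj y)" using projR that by (intro L(2))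
    finally have "norm (x - y) \<le> (1 + L) * norm (proj x - proj y)" by (simp add: algebra_simps)
    also have "\<dots> \<le> (1 + L) * (\<Sum>b\<in>B. \<bar>(proj x - proj y) \<bullet> b\<bar>)"
    proof (intro mult_left_mono proj_le)
      show "e \<bullet> (proj x - proj y) = 0"
        using \<open>e \<bullet> e = 1\<close> by (simp add: proj_def inner_diff_right inner_commute)
    qed (use L in auto)
    also have "(\<Sum>b\<in>B. \<bar>(proj x - proj y) \<bullet> b\<bar>) = (\<Sum>b\<in>B. \<bar>(x - y) \<bullet> b\<bar>)"
      using B(1) by (intro sum.cong) (auto simp: proj_def inner_diff_left)
    finally show ?thesis .
  qed
  have coord: "\<bar>x \<bullet> b\<bar> < R" if "x \<in> S" "b \<in> B" for x b
    using Cauchy_Schwarz_ineq2[of x b] B(3)[OF that(2)] R(2)[OF that(1)] by simp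
  have "hausdorff_pre (DIM('a) - 1) \<delta> S
      \<le> ennreal (unit_ball_vol (real (DIM('a) - 1)) * ((1 + L) * real (DIM('a) - 1) * R) ^ (DIM('a) - 1))" if "0 < \<delta>" for \<delta>
    by (rule hausdorff_pre_le[OF finB cardB _ R(1) that est]) (use L(1) coord in simp_all)
  then have "hausdorff_outer (DIM('a) - 1) S
      \<le> ennreal (unit_ball_vol (real (DIM('a) - 1)) * ((1 + L) * real (DIM('a) - 1) * R) ^ (DIM('a) - 1))"
    unfolding hausdorff_outer_def by (intro SUP_least) auto
  then show ?thesis by (rule le_less_trans) simp
qed

lemma frontier_subset_graph:
  fixes \<gamma> :: "'a::euclidean_space \<Rightarrow> real"
  assumes \<Omega>: "open \<Omega>" and \<gamma>: "continuous_on UNIV \<gamma>"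
    and above: "\<Omega> \<inter> ball p r = {x \<in> ball p r. \<gamma> (x - (x \<bullet> e) *\<^sub>R e) < x \<bullet> e}"
    and x: "x \<in> frontier \<Omega>" "x \<in> ball p r"
  shows "x \<bullet> e = \<gamma> (x - (x \<bullet> e) *\<^sub>R e)"
proof (rule antisym)
  have "x \<notin> \<Omega>" using x(1) \<Omega> by (simp add: frontier_def interior_open)
  then have "x \<notin> {x \<in> ball p r. \<gamma> (x - (x \<bullet> e) *\<^sub>R e) < x \<bullet> e}" unfolding above[symmetric] by blast
  then show "x \<bullet> e \<le> \<gamma> (x - (x \<bullet> e) *\<^sub>R e)" using x(2) by (simp only: mem_Collect_eq not_less de_Morgan_conj simp_thms)
  have "closed {x. \<gamma> (x - (x \<bullet> e) *\<^sub>R e) \<le> x \<bullet> e}"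
    by (intro closed_Collect_le continuous_intros continuous_on_compose2[OF \<gamma>]) auto
  moreover have "ball p r \<inter> \<Omega> \<subseteq> {x. \<gamma> (x - (x \<bullet> e) *\<^sub>R e) \<le> x \<bullet> e}"
    unfolding Int_commute[of "ball p r"] above by (auto intro: less_imp_le)
  ultimately have "closure (ball p r \<inter> \<Omega>) \<subseteq> {x. \<gamma> (x - (x \<bullet> e) *\<^sub>R e) \<le> x \<bullet> e}"
    by (rule closure_minimal[rotated])
  moreover have "x \<in> closure (ball p r \<inter> \<Omega>)"
    using open_Int_closure_subset[of "ball p r" \<Omega>] x by (auto simp: frontier_def)
  ultimately show "\<gamma> (x - (x \<bullet> e) *\<^sub>R e) \<le> x \<bullet> e" by auto
qed

lemma sets_hausdorff_measure: "sets (hausdorff_measure s) = sets borel"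
  and space_hausdorff_measure: "space (hausdorff_measure s) = UNIV"
  unfolding hausdorff_measure_def using sets.sigma_sets_eq[of borel]
  by (auto simp: sets_measure_of_conv space_measure_of_conv)

text \<open>The measure generated by a set function either agrees with it on the generated sets or vanishes; both
  cases give an upper bound.\<close>

lemma emeasure_hausdorff_measure_le: "emeasure (hausdorff_measure s) A \<le> hausdorff_outer s A"
  unfolding hausdorff_measure_def by (simp add: emeasure_measure_of_conv)

text \<open>Finiteness of the area puts \<open>L\<^sup>2\<close> functions on the boundary into \<open>L\<^sup>1\<close>, where the traces live.\<close>

lemma finite_boundary_measure:
  fixes \<Omega> :: "'a::euclidean_space set"
  assumes "smooth_bounded_domain \<Omega>"
  shows "finite_measure (boundary_measure \<Omega>)"
proof (rule finite_measureI)
  let ?H = "hausdorff_measure (DIM('a) - 1) :: 'a measure"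
  have \<Omega>: "open \<Omega>" "bounded \<Omega>" "smooth_boundary \<Omega>" using assms by (auto simp: smooth_bounded_domain_def)
  have "\<exists>r>0. emeasure ?H (frontier \<Omega> \<inter> ball p r) < \<infinity>" if p: "p \<in> frontier \<Omega>" for p
  proof -
    obtain r e and \<gamma> :: "'a \<Rightarrow> real" where r: "0 < r" "norm e = 1" "smooth_on \<gamma> UNIV"
      "\<Omega> \<inter> ball p r = {x \<in> ball p r. \<gamma> (x - (x \<bullet> e) *\<^sub>R e) < x \<bullet> e}"
      using \<Omega>(3) p unfolding smooth_boundary_def by blast
    have \<gamma>: "Ck_on 1 \<gamma> UNIV" using r(3) unfolding smooth_on_def by blast
    have "hausdorff_outer (DIM('a) - 1) (frontier \<Omega> \<inter> ball p r) < \<infinity>"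
      using frontier_subset_graph[OF \<Omega>(1) Ck_on_1_continuous[OF \<gamma>] r(4)]
      by (intro hausdorff_outer_graph_finite[OF r(2) \<gamma>]) (auto intro: bounded_subset[OF bounded_ball])
    then show ?thesis using r(1) le_less_trans[OF emeasure_hausdorff_measure_le] by blast
  qed
  then obtain r where r: "\<And>p. p \<in> frontier \<Omega> \<Longrightarrow> 0 < r p"
      "\<And>p. p \<in> frontier \<Omega> \<Longrightarrow> emeasure ?H (frontier \<Omega> \<inter> ball p (r p)) < \<infinity>"
    by metis
  have "compact (frontier \<Omega>)" using \<Omega>(2) compact_frontier_bounded by blast
  then obtain P where P: "P \<subseteq> frontier \<Omega>" "finite P" "frontier \<Omega> \<subseteq> (\<Union>p\<in>P. ball p (r p))"
    by (rule compactE_image[of _ "frontier \<Omega>" "\<lambda>p. ball p (r p)"]) (use r(1) in auto)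
  have "frontier \<Omega> = (\<Union>p\<in>P. frontier \<Omega> \<inter> ball p (r p))" using P(3) by auto
  also have "emeasure ?H \<dots> \<le> (\<Sum>p\<in>P. emeasure ?H (frontier \<Omega> \<inter> ball p (r p)))"
    using P(2) by (intro emeasure_subadditive_finite) (auto simp: sets_hausdorff_measure)
  also have "\<dots> < \<infinity>" using P r(2) by (simp add: subset_eq less_top)
  finally have "emeasure ?H (frontier \<Omega>) < \<infinity>" .
  moreover have "space (boundary_measure \<Omega>) = frontier \<Omega>"
    by (simp add: boundary_measure_def space_restrict_space space_hausdorff_measure)
  ultimately show "emeasure (boundary_measure \<Omega>) (space (boundary_measure \<Omega>)) \<noteq> \<infinity>"
    by (simp add: boundary_measure_def emeasure_restrict_space sets_hausdorff_measure space_hausdorff_measure)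
qed

section \<open>Continuity of translations in the mean\<close>

lemma integrable_translate:
  fixes f :: "'a::euclidean_space \<Rightarrow> real"
  assumes "integrable lborel f"
  shows "integrable lborel (\<lambda>x. f (x + y))" "(LINT x|lborel. f (x + y)) = (LINT x|lborel. f x)"
proof -
  have f: "f \<in> borel_measurable borel" using assms by (auto dest: borel_measurable_integrable)
  have "integrable (distr lborel borel ((+) y)) f" using assms unfolding lborel_distr_plus .
  then show "integrable lborel (\<lambda>x. f (x + y))"
    by (subst (asm) integrable_distr_eq) (use f in \<open>auto simp: add.commute\<close>)
  have "(LINT x|distr lborel borel ((+) y). f x) = (LINT x|lborel. f (y + x))"
    by (rule integral_distr) (use f in auto)
  then show "(LINT x|lborel. f (x + y)) = (LINT x|lborel. f x)"
    unfolding lborel_distr_plus by (simp add: add.commute)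
qed

lemma integrable_abs_translate_minus:
  fixes f :: "'a::euclidean_space \<Rightarrow> real"
  assumes "integrable lborel f" "integrable lborel g"
  shows "integrable lborel (\<lambda>x. \<bar>f (x + y) - g x\<bar>)"
  using integrable_translate(1)[OF assms(1)] assms(2) by simp

definition translation_continuous :: "('a::euclidean_space \<Rightarrow> real) \<Rightarrow> bool" where
  "translation_continuous f \<longleftrightarrow>
     (\<forall>e>0. \<exists>d>0. \<forall>y. norm y < d \<longrightarrow> (LINT x|lborel. \<bar>f (x + y) - f x\<bar>) < e)"

lemma translation_continuous_closed:
  fixes f :: "'a::euclidean_space \<Rightarrow> real"
  assumes f: "integrable lborel f"
    and approx: "\<And>e. 0 < e \<Longrightarrow> \<exists>g. integrable lborel g \<and> translation_continuous g \<and> (LINT x|lborel. \<bar>f x - g x\<bar>) < e"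
  shows "translation_continuous f"
  unfolding translation_continuous_def
proof (intro allI impI)
  fix e :: real assume e: "0 < e"
  obtain g where g: "integrable lborel g" "translation_continuous g" "(LINT x|lborel. \<bar>f x - g x\<bar>) < e / 3"
    using approx[of "e / 3"] e by auto
  obtain d where d: "0 < d" "\<And>y. norm y < d \<Longrightarrow> (LINT x|lborel. \<bar>g (x + y) - g x\<bar>) < e / 3"
    using g(2) e unfolding translation_continuous_def by (meson divide_pos_pos zero_less_numeral)
  show "\<exists>d>0. \<forall>y. norm y < d \<longrightarrow> (LINT x|lborel. \<bar>f (x + y) - f x\<bar>) < e"
  proof (intro exI[of _ d] conjI allI impI d(1))
    fix y :: 'a assume y: "norm y < d"
    note int = integrable_translate(1)[OF f, of y] integrable_translate(1)[OF g(1), of y] f g(1)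
    have shift: "(LINT x|lborel. \<bar>f (x + y) - g (x + y)\<bar>) = (LINT x|lborel. \<bar>f x - g x\<bar>)"
      using integrable_translate(2)[of "\<lambda>x. \<bar>f x - g x\<bar>" y] f g(1) by simp
    have "(LINT x|lborel. \<bar>f (x + y) - f x\<bar>)
        \<le> (LINT x|lborel. \<bar>f (x + y) - g (x + y)\<bar> + \<bar>g (x + y) - g x\<bar> + \<bar>f x - g x\<bar>)"
      using int by (intro integral_mono) auto
    also have "\<dots> = (LINT x|lborel. \<bar>f (x + y) - g (x + y)\<bar>) + (LINT x|lborel. \<bar>g (x + y) - g x\<bar>)
        + (LINT x|lborel. \<bar>f x - g x\<bar>)"
      using int by simp
    also have "\<dots> < e" unfolding shift using d(2)[OF y] g(3) by linarith
    finally show "(LINT x|lborel. \<bar>f (x + y) - f x\<bar>) < e" .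
  qed
qed

text \<open>Squeeze \<open>A\<close> between a compact set \<open>K\<close> and an open set \<open>U\<close> with \<open>U - K\<close> small. A translation by less than the
  distance from \<open>K\<close> to the complement of \<open>U\<close> changes membership in \<open>A\<close> only at points that lie in \<open>U - K\<close> before
  or after the translation.\<close>

lemma translation_continuous_indicator:
  fixes A :: "'a::euclidean_space set"
  assumes A: "A \<in> sets borel" "emeasure lborel A < \<infinity>"
  shows "translation_continuous (indicator A :: 'a \<Rightarrow> real)"
  unfolding translation_continuous_def
proof (intro allI impI)
  fix e :: real assume e: "0 < e"
  obtain K where K: "K \<subseteq> A" "compact K" "emeasure lborel (A - K) < ennreal (e / 4)"
  proof -
    let ?M = "density lborel (indicator A)"
    have M: "emeasure ?M B = emeasure lborel (A \<inter> B)" if "B \<in> sets borel" for B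
      using A that by (subst emeasure_density) (auto simp: nn_integral_indicator mult_indicator_subset
        indicator_inter_arith[symmetric])
    have "emeasure ?M A = (SUP K \<in> {K. K \<subseteq> A \<and> compact K}. emeasure ?M K)"
      using A by (intro inner_regular) (auto simp: M)
    also have "\<dots> = (SUP K \<in> {K. K \<subseteq> A \<and> compact K}. emeasure lborel K)"
      by (rule SUP_cong) (auto simp: M compact_imp_closed Int_absorb1)
    finally have sup: "emeasure lborel A = (SUP K \<in> {K. K \<subseteq> A \<and> compact K}. emeasure lborel K)"
      using A by (simp add: M)
    have "\<exists>K\<in>{K. K \<subseteq> A \<and> compact K}. emeasure lborel A < emeasure lborel K + ennreal (e / 4)"
      by (rule SUP_approx_ennreal[OF _ _ sup]) (use e A(2) in \<open>simp, blast, simp\<close>)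
    then obtain K where K: "K \<subseteq> A" "compact K" "emeasure lborel A < emeasure lborel K + ennreal (e / 4)"
      by auto
    have "emeasure lborel K + emeasure lborel (A - K) = emeasure lborel (K \<union> (A - K))"
      using K A(1) by (intro plus_emeasure) (auto simp: compact_imp_closed)
    also have "K \<union> (A - K) = A" using K(1) by blast
    finally have "emeasure lborel K + emeasure lborel (A - K) = emeasure lborel A" .
    then have "emeasure lborel K + emeasure lborel (A - K) < emeasure lborel K + ennreal (e / 4)"
      using K(3) by simp
    then have "emeasure lborel (A - K) < ennreal (e / 4)" by (simp add: ennreal_add_left_cancel_less)
    with K(1,2) show ?thesis by (rule that)
  qed
  obtain U where U: "open U" "A \<subseteq> U" "emeasure lborel (U - A) < ennreal (e / 4)"
    using outer_regular_lborel[OF A(1), of "e / 4"] e by auto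
  obtain d where d: "0 < d" "\<And>x y. x \<in> K \<Longrightarrow> y \<in> - U \<Longrightarrow> d \<le> dist x y"
    using separate_compact_closed[of K "- U"] K U by blast
  have [measurable]: "K \<in> sets borel" "U \<in> sets borel" "A \<in> sets borel"
    using K(2) U(1) A(1) by (auto simp: compact_imp_closed)
  have "U - K = (U - A) \<union> (A - K)" using K U by auto
  then have "emeasure lborel (U - K) \<le> emeasure lborel (U - A) + emeasure lborel (A - K)"
    using emeasure_subadditive[of "U - A" lborel "A - K"] by auto
  also have "\<dots> < ennreal (e / 4) + ennreal (e / 4)" by (rule add_strict_mono[OF U(3) K(3)])
  also have "\<dots> = ennreal (e / 2)" using e by (simp flip: ennreal_plus)
  finally have small: "emeasure lborel (U - K) < ennreal (e / 2)" .
  then have fin: "emeasure lborel (U - K) < \<infinity>" by (auto intro: order_less_trans)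
  then have m: "measure lborel (U - K) < e / 2"
    using small e by (simp add: emeasure_eq_ennreal_measure ennreal_less_iff)
  have ind: "integrable lborel (indicator (U - K) :: 'a \<Rightarrow> real)" using fin by simp
  show "\<exists>d>0. \<forall>y. norm y < d \<longrightarrow> (LINT x|lborel. \<bar>indicator A (x + y) - indicator A x :: real\<bar>) < e"
  proof (intro exI[of _ d] conjI allI impI d(1))
    fix y :: 'a assume y: "norm y < d"
    have U_shift: "x + y \<in> U" "x - y \<in> U" if "x \<in> K" for x
      using d(2)[OF that, of "x + y"] d(2)[OF that, of "x - y"] y by (force simp: dist_norm)+
    have le: "\<bar>indicator A (x + y) - indicator A x :: real\<bar> \<le> indicator (U - K) (x + y) + indicator (U - K) x" for x
      using U_shift[of x] U_shift[of "x + y"] K(1) U(2) by (auto simp: indicator_def)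
    have "(LINT x|lborel. \<bar>indicator A (x + y) - indicator A x :: real\<bar>)
        \<le> (LINT x|lborel. indicator (U - K) (x + y) + indicator (U - K) x)"
      using A integrable_translate(1)[OF ind, of y] ind le
        integrable_abs_translate_minus[of "indicator A" "indicator A" y]
      by (intro integral_mono) auto
    also have "\<dots> = 2 * measure lborel (U - K)"
      using integrable_translate[OF ind, of y] ind by simp
    finally show "(LINT x|lborel. \<bar>indicator A (x + y) - indicator A x :: real\<bar>) < e" using m by linarith
  qed
qed

lemma translation_continuous_add:
  assumes "integrable lborel f" "integrable lborel g" "translation_continuous f" "translation_continuous g"
  shows "translation_continuous (\<lambda>x. f x + g x)"
  unfolding translation_continuous_def
proof (intro allI impI)
  fix e :: real assume e: "0 < e"
  obtain d1 where d1: "0 < d1" "\<And>y. norm y < d1 \<Longrightarrow> (LINT x|lborel. \<bar>f (x + y) - f x\<bar>) < e / 2"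
    using assms(3) e unfolding translation_continuous_def by (meson half_gt_zero)
  obtain d2 where d2: "0 < d2" "\<And>y. norm y < d2 \<Longrightarrow> (LINT x|lborel. \<bar>g (x + y) - g x\<bar>) < e / 2"
    using assms(4) e unfolding translation_continuous_def by (meson half_gt_zero)
  show "\<exists>d>0. \<forall>y. norm y < d \<longrightarrow> (LINT x|lborel. \<bar>f (x + y) + g (x + y) - (f x + g x)\<bar>) < e"
  proof (intro exI[of _ "min d1 d2"] conjI allI impI)
    fix y :: 'a assume y: "norm y < min d1 d2"
    have "(LINT x|lborel. \<bar>f (x + y) + g (x + y) - (f x + g x)\<bar>)
        \<le> (LINT x|lborel. \<bar>f (x + y) - f x\<bar> + \<bar>g (x + y) - g x\<bar>)"
      using integrable_translate(1)[OF assms(1), of y] integrable_translate(1)[OF assms(2), of y] assms(1,2)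
      by (intro integral_mono) auto
    also have "\<dots> = (LINT x|lborel. \<bar>f (x + y) - f x\<bar>) + (LINT x|lborel. \<bar>g (x + y) - g x\<bar>)"
      using integrable_translate(1)[OF assms(1), of y] integrable_translate(1)[OF assms(2), of y] assms(1,2) by simp
    also have "\<dots> < e" using d1(2)[of y] d2(2)[of y] y by simp
    finally show "(LINT x|lborel. \<bar>f (x + y) + g (x + y) - (f x + g x)\<bar>) < e" .
  qed (use d1 d2 in auto)
qed

lemma translation_continuous_scale:
  assumes "translation_continuous f"
  shows "translation_continuous (\<lambda>x. f x * c)"
  unfolding translation_continuous_def
proof (intro allI impI)
  fix e :: real assume e: "0 < e"
  have "0 < e / (\<bar>c\<bar> + 1)" using e by simp
  then obtain d where d: "0 < d" "\<And>y. norm y < d \<Longrightarrow> (LINT x|lborel. \<bar>f (x + y) - f x\<bar>) < e / (\<bar>c\<bar> + 1)"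
    using assms unfolding translation_continuous_def by blast
  show "\<exists>d>0. \<forall>y. norm y < d \<longrightarrow> (LINT x|lborel. \<bar>f (x + y) * c - f x * c\<bar>) < e"
  proof (intro exI[of _ d] conjI allI impI d(1))
    fix y :: 'a assume y: "norm y < d"
    have "(LINT x|lborel. \<bar>f (x + y) * c - f x * c\<bar>) = (LINT x|lborel. \<bar>f (x + y) - f x\<bar>) * \<bar>c\<bar>"
      by (simp add: abs_mult flip: left_diff_distrib)
    also have "\<dots> \<le> (LINT x|lborel. \<bar>f (x + y) - f x\<bar>) * (\<bar>c\<bar> + 1)" by (intro mult_left_mono) auto
    also have "\<dots> < e" using d(2)[OF y] by (simp add: pos_less_divide_eq add_nonneg_pos)
    finally show "(LINT x|lborel. \<bar>f (x + y) * c - f x * c\<bar>) < e" .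
  qed
qed

text \<open>Continuity of translations in \<open>L\<^sup>1\<close>, which makes mollifications converge.\<close>

lemma integrable_imp_translation_continuous:
  fixes f :: "'a::euclidean_space \<Rightarrow> real"
  assumes "integrable lborel f"
  shows "translation_continuous f"
  using assms
proof (induction rule: integrable_induct)
  case (base A c)
  then show ?case using translation_continuous_scale[OF translation_continuous_indicator, of A c] by simp
next
  case (add f g)
  then show ?case by (intro translation_continuous_add)
next
  case (lim f s)
  show ?case
  proof (rule translation_continuous_closed[OF lim.hyps(4)])
    fix e :: real assume e: "0 < e"
    have "(\<lambda>i. LINT x|lborel. \<bar>f x - s i x\<bar>) \<longlonglongrightarrow> (LINT x|(lborel :: 'a measure). 0)"
    proof (rule integral_dominated_convergence)
      show "integrable lborel (\<lambda>x. 3 * \<bar>f x\<bar>)" using lim.hyps(4) by simp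
      show "AE x in lborel. norm \<bar>f x - s i x\<bar> \<le> 3 * \<bar>f x\<bar>" for i
      proof (rule AE_I2)
        fix x
        have "\<bar>s i x\<bar> \<le> 2 * \<bar>f x\<bar>" using lim.hyps(3)[of x i] by simp
        then show "norm \<bar>f x - s i x\<bar> \<le> 3 * \<bar>f x\<bar>" using abs_triangle_ineq4[of "f x" "s i x"] by simp
      qed
      show "AE x in lborel. (\<lambda>i. \<bar>f x - s i x\<bar>) \<longlonglongrightarrow> 0"
      proof (rule AE_I2)
        fix x
        have "(\<lambda>i. \<bar>f x - s i x\<bar>) \<longlonglongrightarrow> \<bar>f x - f x\<bar>"
          using lim.hyps(2)[of x] by (intro tendsto_intros) auto
        then show "(\<lambda>i. \<bar>f x - s i x\<bar>) \<longlonglongrightarrow> 0" by simp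
      qed
    qed (use lim.hyps in auto)
    then have "\<forall>\<^sub>F i in sequentially. (LINT x|lborel. \<bar>f x - s i x\<bar>) < e"
      using e by (intro order_tendstoD(2)) auto
    then obtain i where "(LINT x|lborel. \<bar>f x - s i x\<bar>) < e" by (auto simp: eventually_sequentially)
    then show "\<exists>g. integrable lborel g \<and> translation_continuous g \<and> (LINT x|lborel. \<bar>f x - g x\<bar>) < e"
      using lim by blast
  qed
qed

section \<open>Integration by parts for test fields\<close>

lemma C1_compact_supportI:
  assumes "Ck_on 1 \<phi> UNIV" "compact K" "K \<subseteq> U" "\<And>x. x \<notin> K \<Longrightarrow> \<phi> x = 0"
  shows "C1_compact_support U \<phi>"
proof -
  have "closure {x. \<phi> x \<noteq> 0} \<subseteq> K"
    using assms(2,4) by (intro closure_minimal) (auto simp: compact_imp_closed)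
  then show ?thesis
    using assms(1-3) unfolding C1_compact_support_def
    by (auto simp: compact_eq_bounded_closed intro: bounded_subset)
qed

lemma C1_compact_supportE:
  assumes "C1_compact_support U \<phi>"
  obtains K where "Ck_on 1 \<phi> UNIV" "compact K" "K \<subseteq> U" "\<And>x. x \<notin> K \<Longrightarrow> \<phi> x = 0"
proof (rule that)
  show "Ck_on 1 \<phi> UNIV" "compact (closure {x. \<phi> x \<noteq> 0})" "closure {x. \<phi> x \<noteq> 0} \<subseteq> U"
    using assms by (auto simp: C1_compact_support_def)
  fix x assume "x \<notin> closure {x. \<phi> x \<noteq> 0}"
  then have "x \<notin> {x. \<phi> x \<noteq> 0}" using closure_subset[of "{x. \<phi> x \<noteq> 0}"] by blast
  then show "\<phi> x = 0" by simp
qed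

lemma frechet_derivative_outside_support:
  assumes "closed K" "\<And>x. x \<notin> K \<Longrightarrow> \<phi> x = 0" "x \<notin> K"
  shows "frechet_derivative \<phi> (at x) v = 0"
proof -
  have "(\<phi> has_derivative (\<lambda>_. 0)) (at x)"
    by (rule has_derivative_transform_within_open[OF has_derivative_const[of 0], of "- K"]) (use assms in auto)
  from frechet_derivative_at[OF this] show ?thesis by metis
qed

lemma continuous_compact_support_integrable:
  fixes f :: "'a::euclidean_space \<Rightarrow> real"
  assumes "continuous_on UNIV f" "compact K" "\<And>x. x \<notin> K \<Longrightarrow> f x = 0"
  shows "integrable lborel f"
proof -
  have "integrable lborel (\<lambda>x. indicator K x *\<^sub>R f x)"
    using assms by (intro borel_integrable_compact continuous_on_subset[OF assms(1)]) auto
  moreover have "(\<lambda>x. indicator K x *\<^sub>R f x) = f" using assms(3) by (auto simp: indicator_def fun_eq_iff)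
  ultimately show ?thesis by simp
qed

lemma continuous_compact_support_bounded:
  fixes f :: "'a::euclidean_space \<Rightarrow> 'b::real_normed_vector"
  assumes "continuous_on UNIV f" "compact K" "\<And>x. x \<notin> K \<Longrightarrow> f x = 0"
  obtains C where "0 \<le> C" "\<And>x. norm (f x) \<le> C"
proof -
  have "compact (f ` K)"
    using assms by (intro compact_continuous_image continuous_on_subset[OF assms(1)]) auto
  from compact_imp_bounded[OF this] obtain C where C: "\<And>x. x \<in> K \<Longrightarrow> norm (f x) \<le> C"
    unfolding bounded_iff by auto
  have "norm (f x) \<le> \<bar>C\<bar>" for x
    using C[of x] assms(3)[of x] by (cases "x \<in> K") auto
  then show ?thesis by (rule that[rotated]) simp
qed

lemma C1_compact_support_Lipschitz:
  fixes f :: "'a::euclidean_space \<Rightarrow> 'b::real_normed_vector"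
  assumes f: "Ck_on 1 f UNIV" and K: "compact K" "\<And>x. x \<notin> K \<Longrightarrow> f x = 0"
  obtains L where "0 \<le> L" "\<And>x y. norm (f x - f y) \<le> L * norm (x - y)"
proof -
  have "\<exists>C. \<forall>x. norm (frechet_derivative f (at x) b) \<le> C" for b
  proof -
    have "frechet_derivative f (at x) b = 0" if "x \<notin> K" for x
      by (rule frechet_derivative_outside_support[OF compact_imp_closed[OF K(1)] K(2) that])
    from continuous_compact_support_bounded[OF Ck_on_1_derivative_continuous[OF f] K(1) this]
    show ?thesis by blast
  qed
  then obtain C where C: "\<And>b x. norm (frechet_derivative f (at x) b) \<le> C b" by metis
  have "0 \<le> C b" for b using C[of undefined b] norm_ge_zero[of "frechet_derivative f (at undefined) b"] by linarith
  then have "0 \<le> (\<Sum>b\<in>Basis. C b)" by (simp add: sum_nonneg)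
  then show ?thesis
    by (rule that) (rule Lipschitz_of_bounded_partial_derivatives[OF f convex_UNIV C UNIV_I UNIV_I])
qed

lemma derivative_difference_quotient:
  fixes f :: "'a::real_normed_vector \<Rightarrow> 'b::real_normed_vector"
  assumes "(f has_derivative D) (at x)" and h: "\<And>n. h n \<noteq> (0::real)" "h \<longlonglongrightarrow> 0"
  shows "(\<lambda>n. (f (x + h n *\<^sub>R v) - f x) /\<^sub>R h n) \<longlonglongrightarrow> D v"
proof -
  have "((\<lambda>t. x + t *\<^sub>R v) has_derivative (\<lambda>t. t *\<^sub>R v)) (at 0)"
    by (auto intro!: derivative_eq_intros)
  then have "((\<lambda>t. f (x + t *\<^sub>R v)) has_derivative (\<lambda>t. D (t *\<^sub>R v))) (at 0)"
    by (rule has_derivative_compose[where f = "\<lambda>t. x + t *\<^sub>R v"]) (use assms(1) in simp)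
  moreover have "D (t *\<^sub>R v) = t *\<^sub>R D v" for t
    using has_derivative_linear[OF assms(1)] by (rule linear_cmul)
  ultimately have "(\<lambda>t. norm (f (x + t *\<^sub>R v) - f x - t *\<^sub>R D v) / norm t) \<midarrow>0\<rightarrow> 0"
    by (simp add: has_derivative_at)
  then have "((\<lambda>t. norm (f (x + t *\<^sub>R v) - f x - t *\<^sub>R D v) / norm t) \<circ> h) \<longlonglongrightarrow> 0"
    unfolding tendsto_at_iff_sequentially using h by blast
  moreover have "norm (f (x + h n *\<^sub>R v) - f x - h n *\<^sub>R D v) / norm (h n)
      = norm ((f (x + h n *\<^sub>R v) - f x) /\<^sub>R h n - D v)" for n
  proof -
    have "(f (x + h n *\<^sub>R v) - f x) /\<^sub>R h n - D v = (f (x + h n *\<^sub>R v) - f x - h n *\<^sub>R D v) /\<^sub>R h n"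
      using h(1)[of n] by (simp add: scaleR_diff_right)
    then show ?thesis by (simp add: divide_inverse mult.commute)
  qed
  ultimately have "(\<lambda>n. norm ((f (x + h n *\<^sub>R v) - f x) /\<^sub>R h n - D v)) \<longlonglongrightarrow> 0"
    by (simp add: o_def)
  then show ?thesis by (rule LIM_zero_cancel[OF tendsto_norm_zero_cancel])
qed

text \<open>By translation invariance the integrals of the difference quotients vanish, and these quotients converge
  dominatedly.\<close>

lemma integral_partial_derivative_eq_0:
  fixes f :: "'a::euclidean_space \<Rightarrow> real"
  assumes f: "Ck_on 1 f UNIV" and K: "compact K" "\<And>x. x \<notin> K \<Longrightarrow> f x = 0"
  shows "(LINT x|lborel. frechet_derivative f (at x) v) = 0"
proof -
  define h where "h n = 1 / real (Suc n)" for n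
  have h: "h n \<noteq> 0" "0 < h n" "h n \<le> 1" for n by (simp_all add: h_def)
  have h0: "h \<longlonglongrightarrow> 0" unfolding h_def by (rule LIMSEQ_Suc[OF lim_1_over_n])
  obtain L where L: "0 \<le> L" "\<And>x y. norm (f x - f y) \<le> L * norm (x - y)"
    using C1_compact_support_Lipschitz[OF f K] by blast
  obtain R where R: "\<And>x. x \<in> K \<Longrightarrow> norm x \<le> R" using compact_imp_bounded[OF K(1)] unfolding bounded_iff by blast
  have int: "integrable lborel f" by (rule continuous_compact_support_integrable[OF Ck_on_1_continuous[OF f] K])
  have "(\<lambda>n. LINT x|lborel. (f (x + h n *\<^sub>R v) - f x) /\<^sub>R h n) \<longlonglongrightarrow> (LINT x|lborel. frechet_derivative f (at x) v)"
  proof (rule integral_dominated_convergence)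
    show "integrable lborel (\<lambda>x. (L * norm v) * indicator (cball 0 (R + norm v)) x)"
      by (intro integrable_mult_right integrable_real_indicator emeasure_bounded_finite) auto
    show "AE x in lborel. norm ((f (x + h n *\<^sub>R v) - f x) /\<^sub>R h n) \<le> (L * norm v) * indicator (cball 0 (R + norm v)) x" for n
    proof (rule AE_I2)
      fix x
      show "norm ((f (x + h n *\<^sub>R v) - f x) /\<^sub>R h n) \<le> (L * norm v) * indicator (cball 0 (R + norm v)) x"
      proof (cases "x \<in> cball 0 (R + norm v)")
        case True
        have "norm (f (x + h n *\<^sub>R v) - f x) \<le> L * (h n * norm v)" using L(2)[of "x + h n *\<^sub>R v" x] h(2)[of n] by simp
        then show ?thesis using True h(2)[of n] by (simp add: field_simps)
      next
        case False
        have "norm (h n *\<^sub>R v) \<le> norm v" using h[of n] by (simp add: mult_left_le_one_le)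
        moreover have "R + norm v < norm x" using False by simp
        ultimately have "R < norm (x + h n *\<^sub>R v)" "R < norm x"
          using norm_diff_ineq[of x "h n *\<^sub>R v"] norm_ge_zero[of v] by linarith+
        then have "x + h n *\<^sub>R v \<notin> K" "x \<notin> K" using R by (meson not_le)+
        then show ?thesis using K(2) False by simp
      qed
    qed
    show "AE x in lborel. (\<lambda>n. (f (x + h n *\<^sub>R v) - f x) /\<^sub>R h n) \<longlonglongrightarrow> frechet_derivative f (at x) v"
      by (intro AE_I2 derivative_difference_quotient[OF Ck_on_1_has_derivative[OF f]] h h0)
    show "(\<lambda>x. frechet_derivative f (at x) v) \<in> borel_measurable lborel"
      using Ck_on_1_derivative_continuous[OF f] by (simp add: borel_measurable_continuous_onI)
    show "(\<lambda>x. (f (x + h n *\<^sub>R v) - f x) /\<^sub>R h n) \<in> borel_measurable lborel" for n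
      using integrable_translate(1)[OF int, of "h n *\<^sub>R v"] int by (auto dest: borel_measurable_integrable)
  qed
  moreover have "(LINT x|lborel. (f (x + h n *\<^sub>R v) - f x) /\<^sub>R h n) = 0" for n
    using integrable_translate[OF int, of "h n *\<^sub>R v"] int by simp
  ultimately have "(\<lambda>n::nat. 0) \<longlonglongrightarrow> (LINT x|lborel. frechet_derivative f (at x) v)" by (simp only:)
  from LIMSEQ_unique[OF this tendsto_const] show ?thesis .
qed

lemma divergence_continuous:
  assumes "Ck_on 1 \<phi> UNIV"
  shows "continuous_on UNIV (divergence \<phi>)"
  unfolding divergence_def[abs_def]
  by (intro continuous_intros Ck_on_1_derivative_continuous[OF assms])

lemma divergence_outside_support:
  assumes "closed K" "\<And>x. x \<notin> K \<Longrightarrow> \<phi> x = 0" "x \<notin> K"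
  shows "divergence \<phi> x = 0"
  unfolding divergence_def using frechet_derivative_outside_support[OF assms] by simp

lemma integral_divergence_eq_0:
  fixes \<phi> :: "'a::euclidean_space \<Rightarrow> 'a"
  assumes \<phi>: "Ck_on 1 \<phi> UNIV" and K: "compact K" "\<And>x. x \<notin> K \<Longrightarrow> \<phi> x = 0"
  shows "(LINT x|lborel. divergence \<phi> x) = 0"
proof -
  have D: "((\<lambda>x. \<phi> x \<bullet> b) has_derivative (\<lambda>v. frechet_derivative \<phi> (at x) v \<bullet> b)) (at x)" for b x
    by (intro has_derivative_inner_left Ck_on_1_has_derivative \<phi>)
  have C1: "Ck_on 1 (\<lambda>x. \<phi> x \<bullet> b) UNIV" for b
    by (rule Ck_on_1I[OF D]) (intro continuous_intros Ck_on_1_derivative_continuous \<phi>)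
  have eq: "frechet_derivative (\<lambda>x. \<phi> x \<bullet> b) (at x) = (\<lambda>v. frechet_derivative \<phi> (at x) v \<bullet> b)" for b x
    using frechet_derivative_at[OF D] by simp
  have "integrable lborel (\<lambda>x. frechet_derivative \<phi> (at x) b \<bullet> b)" for b
    using frechet_derivative_outside_support[OF compact_imp_closed[OF K(1)] K(2)]
    by (intro continuous_compact_support_integrable[OF _ K(1)] continuous_intros Ck_on_1_derivative_continuous \<phi>) simp
  then have "(LINT x|lborel. divergence \<phi> x) = (\<Sum>b\<in>Basis. LINT x|lborel. frechet_derivative \<phi> (at x) b \<bullet> b)"
    unfolding divergence_def by (intro Bochner_Integration.integral_sum)
  also have "\<dots> = 0"
    using integral_partial_derivative_eq_0[OF C1 K(1)] K(2) by (intro sum.neutral) (simp add: eq)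
  finally show ?thesis .
qed

lemma frechet_derivative_expand:
  fixes f :: "'a::euclidean_space \<Rightarrow> real"
  assumes "Ck_on 1 f UNIV"
  shows "frechet_derivative f (at x) v = (\<Sum>b\<in>Basis. (v \<bullet> b) * frechet_derivative f (at x) b)"
proof -
  have lin: "linear (frechet_derivative f (at x))"
    using Ck_on_1_has_derivative[OF assms] has_derivative_linear by blast
  have "frechet_derivative f (at x) v = frechet_derivative f (at x) (\<Sum>b\<in>Basis. (v \<bullet> b) *\<^sub>R b)"
    by (simp add: euclidean_representation)
  then show ?thesis by (simp add: linear_sum[OF lin] linear_cmul[OF lin])
qed

lemma divergence_scaleR:
  fixes f :: "'a::euclidean_space \<Rightarrow> real"
  assumes f: "Ck_on 1 f UNIV" and \<phi>: "Ck_on 1 \<phi> UNIV"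
  shows "divergence (\<lambda>x. f x *\<^sub>R \<phi> x) x = f x * divergence \<phi> x + frechet_derivative f (at x) (\<phi> x)"
proof -
  have "frechet_derivative (\<lambda>x. f x *\<^sub>R \<phi> x) (at x)
      = (\<lambda>v. f x *\<^sub>R frechet_derivative \<phi> (at x) v + frechet_derivative f (at x) v *\<^sub>R \<phi> x)"
    using frechet_derivative_at[OF has_derivative_scaleR[OF f[THEN Ck_on_1_has_derivative] \<phi>[THEN Ck_on_1_has_derivative], of x]]
    by simp
  then show ?thesis
    unfolding divergence_def frechet_derivative_expand[OF f, of x "\<phi> x"]
    by (simp add: inner_add_left sum.distrib sum_distrib_left mult.commute)
qed

lemma integral_mult_divergence:
  fixes f :: "'a::euclidean_space \<Rightarrow> real" and \<phi> :: "'a \<Rightarrow> 'a"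
  assumes f: "Ck_on 1 f UNIV" and \<phi>: "Ck_on 1 \<phi> UNIV" and K: "compact K" "\<And>x. x \<notin> K \<Longrightarrow> \<phi> x = 0"
  shows "integrable lborel (\<lambda>x. f x * divergence \<phi> x)"
    and "integrable lborel (\<lambda>x. frechet_derivative f (at x) (\<phi> x))"
    and "(LINT x|lborel. f x * divergence \<phi> x) = - (LINT x|lborel. frechet_derivative f (at x) (\<phi> x))"
proof -
  show 1: "integrable lborel (\<lambda>x. f x * divergence \<phi> x)"
    using divergence_outside_support[OF compact_imp_closed[OF K(1)] K(2)]
    by (intro continuous_compact_support_integrable[OF _ K(1)] continuous_intros Ck_on_1_continuous[OF f]
        divergence_continuous \<phi>) simp
  have "continuous_on UNIV (\<lambda>x. \<Sum>b\<in>Basis. (\<phi> x \<bullet> b) * frechet_derivative f (at x) b)"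
    by (intro continuous_intros Ck_on_1_continuous[OF \<phi>] Ck_on_1_derivative_continuous f)
  then show 2: "integrable lborel (\<lambda>x. frechet_derivative f (at x) (\<phi> x))"
    unfolding frechet_derivative_expand[OF f, of _ "\<phi> _"]
    by (rule continuous_compact_support_integrable[OF _ K(1)]) (simp add: K(2))
  have "(LINT x|lborel. divergence (\<lambda>x. f x *\<^sub>R \<phi> x) x) = 0"
    by (rule integral_divergence_eq_0[OF Ck_on_1_scaleR[OF f \<phi>] K(1)]) (simp add: K(2))
  then show "(LINT x|lborel. f x * divergence \<phi> x) = - (LINT x|lborel. frechet_derivative f (at x) (\<phi> x))"
    unfolding divergence_scaleR[OF f \<phi>] using 1 2 by simp
qed

section \<open>Mollification\<close>

text \<open>The squared positive part of \<open>\<delta>\<^sup>2 - |y|\<^sup>2\<close>, normalised.\<close>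

lemma mollifier_exists:
  fixes \<delta> :: real
  assumes \<delta>: "0 < \<delta>"
  obtains \<rho> :: "'a::euclidean_space \<Rightarrow> real" where "Ck_on 1 \<rho> UNIV" "\<And>y. 0 \<le> \<rho> y"
    "\<And>y. \<delta> \<le> norm y \<Longrightarrow> \<rho> y = 0" "(LINT y|lborel. \<rho> y) = 1"
proof -
  define k where "k y = (max (\<delta>\<^sup>2 - y \<bullet> y) 0)\<^sup>2" for y :: 'a
  have "((\<lambda>y::'a. \<delta>\<^sup>2 - y \<bullet> y) has_derivative (\<lambda>v. - (2 * (x \<bullet> v)))) (at x)" for x
    by (auto intro!: derivative_eq_intros simp: inner_commute)
  then have "Ck_on 1 (\<lambda>y::'a. \<delta>\<^sup>2 - y \<bullet> y) UNIV"
    by (rule Ck_on_1I) (intro continuous_intros)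
  then have C1: "Ck_on 1 k UNIV"
    unfolding k_def by (rule Ck_on_1_compose_real[OF _ DERIV_pos_part_power2]) (intro continuous_intros)
  have zero: "k y = 0" if "\<delta> \<le> norm y" for y
    using power_mono[OF that, of 2] \<delta> by (simp add: k_def dot_square_norm)
  have pos: "0 < k y" if "norm y < \<delta>" for y
    using power_strict_mono[OF that norm_ge_zero, of 2] by (simp add: k_def dot_square_norm)
  have k0: "0 \<le> k y" for y by (simp add: k_def)
  have int: "integrable lborel k"
    by (rule continuous_compact_support_integrable[OF Ck_on_1_continuous[OF C1] compact_cball[of 0 \<delta>]]) (simp add: zero)
  have "(LINT y|lborel. k y) \<noteq> 0"
  proof
    assume "(LINT y|lborel. k y) = 0"
    then have "AE y in lborel. k y = 0" using integral_nonneg_eq_0_iff_AE[OF int] k0 by simp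
    then have "AE y in lborel. y \<notin> ball (0::'a) \<delta>" by eventually_elim (use pos in force)
    then have "emeasure lborel (ball (0::'a) \<delta>) = 0"
      by (subst (asm) AE_iff_measurable[of "ball 0 \<delta>"]) auto
    moreover have "0 < unit_ball_vol (real DIM('a)) * \<delta> ^ DIM('a)" using \<delta> by simp
    ultimately show False using \<delta> by (simp add: emeasure_ball ennreal_eq_0_iff)
  qed
  moreover have "0 \<le> (LINT y|lborel. k y)" using k0 by simp
  ultimately have I: "0 < (LINT y|lborel. k y)" by linarith
  show ?thesis
  proof (rule that[of "\<lambda>y. k y * (1 / (LINT y|lborel. k y))"])
    show "Ck_on 1 (\<lambda>y. k y * (1 / (LINT y|lborel. k y))) UNIV"
      using Ck_on_1_scaleR[OF Ck_on_1_const C1, of "1 / (LINT y|lborel. k y)"] by (simp add: mult.commute)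
    show "(LINT y|lborel. k y * (1 / (LINT y|lborel. k y))) = 1" using I by simp
  qed (use I k0 zero in auto)
qed

lemma integrable_bounded_mult:
  fixes g f :: "'a::euclidean_space \<Rightarrow> real"
  assumes "integrable lborel f" "g \<in> borel_measurable borel" "\<And>x. \<bar>g x\<bar> \<le> C"
  shows "integrable lborel (\<lambda>x. g x * f x)"
proof (rule Bochner_Integration.integrable_bound)
  show "integrable lborel (\<lambda>x. C * f x)" using assms(1) by simp
  show "(\<lambda>x. g x * f x) \<in> borel_measurable lborel"
    using assms(1,2) by (auto dest: borel_measurable_integrable)
  show "AE x in lborel. norm (g x * f x) \<le> norm (C * f x)"
    using assms(3) by (intro AE_I2) (auto simp: abs_mult intro!: mult_right_mono intro: order_trans[OF _ abs_ge_self])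
qed

definition mollify :: "('a::euclidean_space \<Rightarrow> real) \<Rightarrow> ('a \<Rightarrow> real) \<Rightarrow> 'a \<Rightarrow> real" where
  "mollify \<rho> U x = (LINT z|lborel. \<rho> (z - x) * U z)"

context
  fixes \<rho> U :: "'a::euclidean_space \<Rightarrow> real" and \<delta> :: real
  assumes \<rho>: "Ck_on 1 \<rho> UNIV" "\<And>y. 0 \<le> \<rho> y" "\<And>y. \<delta> \<le> norm y \<Longrightarrow> \<rho> y = 0" "(LINT y|lborel. \<rho> y) = 1"
    and U: "integrable lborel U"
begin

lemma mollifier_outside: "y \<notin> cball 0 \<delta> \<Longrightarrow> \<rho> y = 0"
  using \<rho>(3) by simp

lemma mollifier_measurable [measurable]: "\<rho> \<in> borel_measurable borel"
  using Ck_on_1_continuous[OF \<rho>(1)] by (simp add: borel_measurable_continuous_onI)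

lemma mollified_measurable [measurable]: "U \<in> borel_measurable borel"
  using U by (auto dest: borel_measurable_integrable)

lemma mollifier_integrable: "integrable lborel \<rho>"
  by (rule continuous_compact_support_integrable[OF Ck_on_1_continuous[OF \<rho>(1)] compact_cball mollifier_outside])

lemma mollifier_bounded: "\<exists>C. \<forall>y. \<bar>\<rho> y\<bar> \<le> C"
proof -
  from continuous_compact_support_bounded[OF Ck_on_1_continuous[OF \<rho>(1)] compact_cball mollifier_outside]
  obtain C where "\<And>y. norm (\<rho> y) \<le> C" by blast
  then show ?thesis by auto
qed

lemma mollify_integrable: "integrable lborel (\<lambda>y. \<rho> (y - x) * U y)" "integrable lborel (\<lambda>y. \<rho> y * U (x + y))"
proof -
  obtain C where C: "\<And>y. \<bar>\<rho> y\<bar> \<le> C" using mollifier_bounded by blast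
  show "integrable lborel (\<lambda>y. \<rho> (y - x) * U y)"
    by (rule integrable_bounded_mult[OF U _ C]) measurable
  show "integrable lborel (\<lambda>y. \<rho> y * U (x + y))"
    using integrable_translate(1)[OF U, of x] by (intro integrable_bounded_mult[OF _ _ C]) (auto simp: add.commute)
qed

lemma mollify_shift: "mollify \<rho> U x = (LINT y|lborel. \<rho> y * U (x + y))"
  unfolding mollify_def using integrable_translate(2)[OF mollify_integrable(1)[of x], of x] by (simp add: add.commute)

text \<open>Differentiation under the integral. The Lipschitz constant of the kernel dominates the difference quotients.\<close>

lemma mollify_C1: "Ck_on 1 (mollify \<rho> U) UNIV"
proof -
  let ?D = "\<lambda>x v. LINT z|lborel. - frechet_derivative \<rho> (at (z - x)) v * U z"
  obtain L where L: "0 \<le> L" "\<And>x y. norm (\<rho> x - \<rho> y) \<le> L * norm (x - y)"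
    using C1_compact_support_Lipschitz[OF \<rho>(1) compact_cball mollifier_outside] by blast
  have lin: "linear (frechet_derivative \<rho> (at x))" for x
    using Ck_on_1_has_derivative[OF \<rho>(1)] has_derivative_linear by blast
  have der_meas [measurable]: "(\<lambda>x. frechet_derivative \<rho> (at x) v) \<in> borel_measurable borel" for v
    using Ck_on_1_derivative_continuous[OF \<rho>(1)] by (simp add: borel_measurable_continuous_onI)
  have bound: "\<bar>frechet_derivative \<rho> (at x) v\<bar> \<le> L * norm v" for x v
  proof -
    have quot: "norm ((\<rho> (x + h *\<^sub>R v) - \<rho> x) /\<^sub>R h) \<le> L * norm v" if "0 < h" for h
      using L(2)[of "x + h *\<^sub>R v" x] that by (simp add: field_simps)
    have "(\<lambda>n. norm ((\<rho> (x + (1 / real (Suc n)) *\<^sub>R v) - \<rho> x) /\<^sub>R (1 / real (Suc n)))) \<longlonglongrightarrow> norm (frechet_derivative \<rho> (at x) v)"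
      by (intro tendsto_norm derivative_difference_quotient[OF Ck_on_1_has_derivative[OF \<rho>(1)]] LIMSEQ_Suc[OF lim_1_over_n]) simp
    moreover have "norm ((\<rho> (x + (1 / real (Suc n)) *\<^sub>R v) - \<rho> x) /\<^sub>R (1 / real (Suc n))) \<le> L * norm v" for n
      by (rule quot) simp
    ultimately have "norm (frechet_derivative \<rho> (at x) v) \<le> L * norm v"
      by (intro tendsto_upperbound) (auto intro: always_eventually)
    then show ?thesis by simp
  qed
  have Dint: "integrable lborel (\<lambda>z. - frechet_derivative \<rho> (at (z - x)) v * U z)" for x v
    using bound by (intro integrable_bounded_mult[OF U, of _ "L * norm v"]) auto
  have "(mollify \<rho> U has_derivative ?D x) (at x)" for x
    unfolding has_derivative_at
  proof
    show "bounded_linear (?D x)"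
    proof (rule bounded_linear_intro[where K = "L * (LINT z|lborel. \<bar>U z\<bar>)"])
      show "?D x (v + w) = ?D x v + ?D x w" for v w
      proof -
        have "?D x (v + w) = (LINT z|lborel. - frechet_derivative \<rho> (at (z - x)) v * U z
            + - frechet_derivative \<rho> (at (z - x)) w * U z)"
          by (simp only: linear_add[OF lin] minus_add_distrib distrib_right)
        also have "\<dots> = ?D x v + ?D x w" by (rule Bochner_Integration.integral_add[OF Dint Dint])
        finally show ?thesis .
      qed
      show "?D x (c *\<^sub>R v) = c *\<^sub>R ?D x v" for c v
        by (simp add: linear_cmul[OF lin] mult.assoc)
      show "norm (?D x v) \<le> norm v * (L * (LINT z|lborel. \<bar>U z\<bar>))" for v
      proof -
        have "norm (?D x v) \<le> (LINT z|lborel. norm (- frechet_derivative \<rho> (at (z - x)) v * U z))"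
          by (rule integral_norm_bound)
        also have "\<dots> \<le> (LINT z|lborel. (L * norm v) * \<bar>U z\<bar>)"
          using bound U by (intro integral_mono integrable_norm Dint) (auto simp: abs_mult intro!: mult_right_mono)
        finally show ?thesis by (simp add: mult_ac)
      qed
    qed
    show "(\<lambda>h. norm (mollify \<rho> U (x + h) - mollify \<rho> U x - ?D x h) / norm h) \<midarrow>0\<rightarrow> 0"
      unfolding tendsto_at_iff_sequentially
    proof (intro allI impI)
      fix h :: "nat \<Rightarrow> 'a" assume hn: "\<forall>n. h n \<in> UNIV - {0}" and h0: "h \<longlonglongrightarrow> 0"
      have hne: "h n \<noteq> 0" for n using hn by simp
      let ?q = "\<lambda>n z. (\<rho> (z - x - h n) - \<rho> (z - x) + frechet_derivative \<rho> (at (z - x)) (h n)) / norm (h n)"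
      have "(\<lambda>n. LINT z|lborel. \<bar>?q n z * U z\<bar>) \<longlonglongrightarrow> (LINT z|(lborel :: 'a measure). 0)"
      proof (rule integral_dominated_convergence)
        show "integrable lborel (\<lambda>z. 2 * L * \<bar>U z\<bar>)" using U by simp
        show "AE z in lborel. norm \<bar>?q n z * U z\<bar> \<le> 2 * L * \<bar>U z\<bar>" for n
        proof (rule AE_I2)
          fix z
          have "\<bar>\<rho> (z - x - h n) - \<rho> (z - x) + frechet_derivative \<rho> (at (z - x)) (h n)\<bar> \<le> 2 * L * norm (h n)"
            using L(2)[of "z - x - h n" "z - x"] bound[of "z - x" "h n"] by simp
          then have "\<bar>?q n z\<bar> \<le> 2 * L" using hne[of n] by (simp add: field_simps)
          then have "\<bar>?q n z\<bar> * \<bar>U z\<bar> \<le> 2 * L * \<bar>U z\<bar>" by (rule mult_right_mono) simp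
          then show "norm \<bar>?q n z * U z\<bar> \<le> 2 * L * \<bar>U z\<bar>" by (simp only: abs_mult real_norm_def abs_abs)
        qed
        show "AE z in lborel. (\<lambda>n. \<bar>?q n z * U z\<bar>) \<longlonglongrightarrow> 0"
        proof (rule AE_I2)
          fix z
          have lim0: "(\<lambda>k. norm (\<rho> (z - x + k) - \<rho> (z - x) - frechet_derivative \<rho> (at (z - x)) k) / norm k) \<midarrow>0\<rightarrow> 0"
            using Ck_on_1_has_derivative[OF \<rho>(1), of "z - x"] unfolding has_derivative_at by blast
          have "(\<lambda>n. - h n) \<longlonglongrightarrow> 0" using tendsto_minus[OF h0] by simp
          then have "(\<lambda>n. norm (\<rho> (z - x + - h n) - \<rho> (z - x) - frechet_derivative \<rho> (at (z - x)) (- h n)) / norm (- h n)) \<longlonglongrightarrow> 0"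
            using lim0[unfolded tendsto_at_iff_sequentially o_def, THEN spec, of "\<lambda>n. - h n"] hne by simp
          then have "(\<lambda>n. \<bar>?q n z\<bar>) \<longlonglongrightarrow> 0" by (simp add: linear_neg[OF lin] abs_divide)
          then have "(\<lambda>n. \<bar>?q n z\<bar> * \<bar>U z\<bar>) \<longlonglongrightarrow> 0 * \<bar>U z\<bar>" by (intro tendsto_intros)
          then show "(\<lambda>n. \<bar>?q n z * U z\<bar>) \<longlonglongrightarrow> 0" by (simp add: abs_mult)
        qed
      qed measurable
      then have lim: "(\<lambda>n. LINT z|lborel. \<bar>?q n z * U z\<bar>) \<longlonglongrightarrow> 0" by simp
      have le: "norm (mollify \<rho> U (x + h n) - mollify \<rho> U x - ?D x (h n)) / norm (h n) \<le> (LINT z|lborel. \<bar>?q n z * U z\<bar>)" for n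
      proof -
        have "mollify \<rho> U (x + h n) - mollify \<rho> U x - ?D x (h n) = (LINT z|lborel. norm (h n) * (?q n z * U z))"
          unfolding mollify_def using mollify_integrable(1)[of "x + h n"] mollify_integrable(1)[of x] Dint[of x "h n"] hne[of n]
          by (simp flip: Bochner_Integration.integral_diff)
            (auto intro!: Bochner_Integration.integral_cong simp: algebra_simps)
        then have eq: "norm (mollify \<rho> U (x + h n) - mollify \<rho> U x - ?D x (h n)) / norm (h n) = \<bar>LINT z|lborel. ?q n z * U z\<bar>"
          using hne[of n] by (simp add: abs_mult)
        show ?thesis unfolding eq by (rule integral_abs_bound)
      qed
      show "((\<lambda>h. norm (mollify \<rho> U (x + h) - mollify \<rho> U x - ?D x h) / norm h) \<circ> h) \<longlonglongrightarrow> 0"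
        unfolding o_def by (rule Lim_null_comparison[OF _ lim]) (use le in auto)
    qed
  qed
  moreover have "continuous_on UNIV (\<lambda>x. ?D x v)" for v
    unfolding continuous_on_def tendsto_at_iff_sequentially
  proof (intro ballI allI impI)
    fix x and X :: "nat \<Rightarrow> 'a" assume X: "X \<longlonglongrightarrow> x"
    show "((\<lambda>x. ?D x v) \<circ> X) \<longlonglongrightarrow> ?D x v"
      unfolding o_def
    proof (rule integral_dominated_convergence)
      show "integrable lborel (\<lambda>z. L * norm v * \<bar>U z\<bar>)" using U by simp
      show "AE z in lborel. norm (- frechet_derivative \<rho> (at (z - X n)) v * U z) \<le> L * norm v * \<bar>U z\<bar>" for n
        using bound by (intro AE_I2) (auto simp: abs_mult intro!: mult_right_mono)
      show "AE z in lborel. (\<lambda>n. - frechet_derivative \<rho> (at (z - X n)) v * U z) \<longlonglongrightarrow> - frechet_derivative \<rho> (at (z - x)) v * U z"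
      proof (rule AE_I2)
        fix z
        have "(\<lambda>n. z - X n) \<longlonglongrightarrow> z - x" by (intro tendsto_intros X)
        from continuous_on_tendsto_compose[OF Ck_on_1_derivative_continuous[OF \<rho>(1)] this]
        show "(\<lambda>n. - frechet_derivative \<rho> (at (z - X n)) v * U z) \<longlonglongrightarrow> - frechet_derivative \<rho> (at (z - x)) v * U z"
          by (intro tendsto_intros) auto
      qed
    qed measurable
  qed
  ultimately show ?thesis by (rule Ck_on_1I)
qed

text \<open>A mollification is an average of translations by less than \<open>\<delta>\<close>, so its distance to \<open>U\<close> is at most the largest
  distance of such a translation.\<close>

lemma mollify_L1:
  assumes e: "\<And>y. norm y < \<delta> \<Longrightarrow> (LINT x|lborel. \<bar>U (x + y) - U x\<bar>) \<le> e"
  shows "integrable lborel (\<lambda>x. mollify \<rho> U x - U x)"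
    and "(LINT x|lborel. \<bar>mollify \<rho> U x - U x\<bar>) \<le> e"
proof -
  let ?G = "\<lambda>y x. \<rho> y * (U (x + y) - U x)"
  note \<rho>int = mollifier_integrable
  have inner: "(LINT x|lborel. norm (?G y x)) = \<rho> y * (LINT x|lborel. \<bar>U (x + y) - U x\<bar>)" for y
    using \<rho>(2)[of y] by (simp add: abs_mult)
  \<comment> \<open>Outside the support of the kernel both sides vanish.\<close>
  have le: "\<rho> y * (LINT x|lborel. \<bar>U (x + y) - U x\<bar>) \<le> \<rho> y * e" for y
    using e[of y] \<rho>(2)[of y] \<rho>(3)[of y] by (cases "norm y < \<delta>") (auto intro: mult_left_mono)
  have meas: "(\<lambda>p. case_prod ?G p) \<in> borel_measurable (lborel \<Otimes>\<^sub>M lborel)" by measurable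
  have intG: "integrable (lborel \<Otimes>\<^sub>M lborel) (case_prod ?G)"
  proof (rule lborel_pair.Fubini_integrable[OF meas])
    show "integrable lborel (\<lambda>y. LINT x|lborel. norm (case_prod ?G (y, x)))"
    proof (rule Bochner_Integration.integrable_bound)
      show "integrable lborel (\<lambda>y. \<rho> y * e)" using \<rho>int by simp
      show "AE y in lborel. norm (LINT x|lborel. norm (case_prod ?G (y, x))) \<le> norm (\<rho> y * e)"
      proof (rule AE_I2)
        fix y
        have "0 \<le> (LINT x|lborel. norm (?G y x))" by simp
        moreover have "(LINT x|lborel. norm (?G y x)) \<le> \<rho> y * e" using le[of y] inner[of y] by simp
        ultimately show "norm (LINT x|lborel. norm (case_prod ?G (y, x))) \<le> norm (\<rho> y * e)" by simp
      qed
    qed (use meas in measurable)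
    show "AE y in lborel. integrable lborel (\<lambda>x. case_prod ?G (y, x))"
      using integrable_translate(1)[OF U] U by (intro AE_I2) simp
  qed
  have eq: "(LINT y|lborel. ?G y x) = mollify \<rho> U x - U x" for x
  proof -
    have "(LINT y|lborel. ?G y x) = (LINT y|lborel. \<rho> y * U (x + y)) - (LINT y|lborel. \<rho> y * U x)"
      unfolding right_diff_distrib using mollify_integrable(2) \<rho>int
      by (intro Bochner_Integration.integral_diff) simp_all
    then show ?thesis using \<rho>(4) by (simp add: mollify_shift)
  qed
  show int: "integrable lborel (\<lambda>x. mollify \<rho> U x - U x)"
    using lborel_pair.integrable_snd[OF intG] by (simp add: eq)
  have intnorm: "integrable (lborel \<Otimes>\<^sub>M lborel) (case_prod (\<lambda>y x. norm (?G y x)))"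
    using integrable_norm[OF intG] by (simp add: case_prod_unfold)
  have "(LINT x|lborel. \<bar>mollify \<rho> U x - U x\<bar>) \<le> (LINT x|lborel. LINT y|lborel. norm (?G y x))"
  proof (rule integral_mono)
    show "integrable lborel (\<lambda>x. LINT y|lborel. norm (?G y x))" by (rule lborel_pair.integrable_snd[OF intnorm])
    show "\<bar>mollify \<rho> U x - U x\<bar> \<le> (LINT y|lborel. norm (?G y x))" for x
      using integral_norm_bound[of lborel "\<lambda>y. ?G y x"] by (simp add: eq)
  qed (use int in simp)
  also have "\<dots> = (LINT y|lborel. LINT x|lborel. norm (?G y x))"
    by (rule lborel_pair.Fubini_integral[OF intnorm])
  also have "\<dots> \<le> (LINT y|lborel. \<rho> y * e)"
  proof (rule integral_mono)
    show "integrable lborel (\<lambda>y. LINT x|lborel. norm (?G y x))" using lborel_pair.integrable_fst[OF intnorm] by simp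
    show "integrable lborel (\<lambda>y. \<rho> y * e)" using \<rho>int by simp
    show "(LINT x|lborel. norm (?G y x)) \<le> \<rho> y * e" for y using le[of y] unfolding inner .
  qed
  also have "\<dots> = e" using \<rho>(4) by simp
  finally show "(LINT x|lborel. \<bar>mollify \<rho> U x - U x\<bar>) \<le> e" .
qed

text \<open>Pairing with a mollification is averaging the pairings with the translated functions \<open>g\<close>.\<close>

lemma mollify_pairing_le:
  assumes g: "continuous_on UNIV g" "\<And>x. \<bar>g x\<bar> \<le> C"
    and A: "\<And>y. norm y < \<delta> \<Longrightarrow> (LINT x|lborel. U x * g (x - y)) \<le> A"
  shows "(LINT x|lborel. mollify \<rho> U x * g x) \<le> A"
proof -
  have [measurable]: "g \<in> borel_measurable borel" using g(1) by (simp add: borel_measurable_continuous_onI)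
  let ?G = "\<lambda>y x. \<rho> y * (U (x + y) * g x)"
  note \<rho>int = mollifier_integrable
  have Ug: "integrable lborel (\<lambda>x. U (x + y) * g x)" for y
    using integrable_bounded_mult[OF integrable_translate(1)[OF U, of y], where g = g and C = C] g(2) by (simp add: mult.commute)
  have meas: "(\<lambda>p. case_prod ?G p) \<in> borel_measurable (lborel \<Otimes>\<^sub>M lborel)" by measurable
  have intG: "integrable (lborel \<Otimes>\<^sub>M lborel) (case_prod ?G)"
  proof (rule lborel_pair.Fubini_integrable[OF meas])
    show "integrable lborel (\<lambda>y. LINT x|lborel. norm (case_prod ?G (y, x)))"
    proof (rule Bochner_Integration.integrable_bound)
      show "integrable lborel (\<lambda>y. \<rho> y * (C * (LINT x|lborel. \<bar>U x\<bar>)))" using \<rho>int by simp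
      show "AE y in lborel. norm (LINT x|lborel. norm (case_prod ?G (y, x))) \<le> norm (\<rho> y * (C * (LINT x|lborel. \<bar>U x\<bar>)))"
      proof (rule AE_I2)
        fix y
        have "(LINT x|lborel. \<bar>U (x + y) * g x\<bar>) \<le> (LINT x|lborel. C * \<bar>U (x + y)\<bar>)"
        proof (rule integral_mono)
          show "integrable lborel (\<lambda>x. \<bar>U (x + y) * g x\<bar>)" by (rule integrable_abs[OF Ug])
          show "integrable lborel (\<lambda>x. C * \<bar>U (x + y)\<bar>)" using integrable_translate(1)[OF U, of y] by simp
          show "\<bar>U (x + y) * g x\<bar> \<le> C * \<bar>U (x + y)\<bar>" for x
            using mult_right_mono[OF g(2), of "\<bar>U (x + y)\<bar>"] by (simp add: abs_mult mult.commute)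
        qed
        also have "\<dots> = C * (LINT x|lborel. \<bar>U x\<bar>)"
          using integrable_translate(2)[of "\<lambda>x. \<bar>U x\<bar>" y] U by simp
        finally have "\<rho> y * (LINT x|lborel. \<bar>U (x + y) * g x\<bar>) \<le> \<rho> y * (C * (LINT x|lborel. \<bar>U x\<bar>))"
          using \<rho>(2) by (intro mult_left_mono)
        moreover have "(LINT x|lborel. norm (case_prod ?G (y, x))) = \<rho> y * (LINT x|lborel. \<bar>U (x + y) * g x\<bar>)"
          using \<rho>(2)[of y] by (simp add: abs_mult)
        moreover have "0 \<le> (LINT x|lborel. norm (case_prod ?G (y, x)))" by simp
        ultimately show "norm (LINT x|lborel. norm (case_prod ?G (y, x))) \<le> norm (\<rho> y * (C * (LINT x|lborel. \<bar>U x\<bar>)))"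
          by simp
      qed
    qed (use meas in measurable)
    show "AE y in lborel. integrable lborel (\<lambda>x. case_prod ?G (y, x))"
      using Ug by (intro AE_I2) simp
  qed
  have "(LINT x|lborel. mollify \<rho> U x * g x) = (LINT x|lborel. LINT y|lborel. ?G y x)"
    by (simp add: mollify_shift mult.assoc flip: integral_mult_left_zero)
  also have "\<dots> = (LINT y|lborel. LINT x|lborel. ?G y x)"
    by (rule lborel_pair.Fubini_integral[OF intG])
  also have "\<dots> \<le> (LINT y|lborel. \<rho> y * A)"
  proof (rule integral_mono)
    show "integrable lborel (\<lambda>y. LINT x|lborel. ?G y x)" using lborel_pair.integrable_fst[OF intG] by simp
    show "integrable lborel (\<lambda>y. \<rho> y * A)" using \<rho>int by simp
    fix y
    show "(LINT x|lborel. ?G y x) \<le> \<rho> y * A"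
    proof (cases "norm y < \<delta>")
      case True
      have "(LINT x|lborel. U (x + y) * g x) = (LINT x|lborel. U x * g (x - y))"
        using integrable_translate(2)[of "\<lambda>x. U x * g (x - y)" y]
          integrable_bounded_mult[OF U, where g = "\<lambda>x. g (x - y)" and C = C] g(2) by (simp add: mult.commute)
      then have "(LINT x|lborel. ?G y x) = \<rho> y * (LINT x|lborel. U x * g (x - y))" by simp
      also have "\<dots> \<le> \<rho> y * A" using A[OF True] \<rho>(2) by (intro mult_left_mono)
      finally show ?thesis .
    next
      case False
      then show ?thesis using \<rho>(3)[of y] by simp
    qed
  qed
  also have "\<dots> = A" using \<rho>(4) by simp
  finally show ?thesis .
qed

end

section \<open>Submodularity of the total variation\<close>

lemma divergence_translate:
  assumes "Ck_on 1 \<phi> UNIV"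
  shows "Ck_on 1 (\<lambda>x. \<phi> (x - y)) UNIV" "divergence (\<lambda>x. \<phi> (x - y)) x = divergence \<phi> (x - y)"
proof -
  have D: "((\<lambda>x. \<phi> (x - y)) has_derivative frechet_derivative \<phi> (at (x - y))) (at x)" for x
  proof -
    have "((\<lambda>x. x - y) has_derivative (\<lambda>v. v)) (at x)" by (auto intro!: derivative_eq_intros)
    from has_derivative_compose[OF this Ck_on_1_has_derivative[OF assms]] show ?thesis .
  qed
  show "Ck_on 1 (\<lambda>x. \<phi> (x - y)) UNIV"
    by (rule Ck_on_1I[OF D])
       (intro continuous_on_compose2[OF Ck_on_1_derivative_continuous[OF assms]] continuous_intros, auto)
  show "divergence (\<lambda>x. \<phi> (x - y)) x = divergence \<phi> (x - y)"
    unfolding divergence_def using frechet_derivative_at[OF D, of x] by simp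
qed

lemma norm_convex_combination_le:
  fixes a b :: "'a::real_normed_vector"
  assumes "norm a \<le> 1" "norm b \<le> 1" "0 \<le> l" "l \<le> 1"
  shows "norm (l *\<^sub>R a + (1 - l) *\<^sub>R b) \<le> 1"
proof -
  have "norm (l *\<^sub>R a + (1 - l) *\<^sub>R b) \<le> l * norm a + (1 - l) * norm b"
    using norm_triangle_ineq[of "l *\<^sub>R a" "(1 - l) *\<^sub>R b"] assms by simp
  also have "\<dots> \<le> l * 1 + (1 - l) * 1" using assms by (intro add_mono mult_left_mono) auto
  finally show ?thesis by simp
qed

text \<open>The submodularity inequality for continuously differentiable functions \<open>a\<close> and \<open>b\<close>, in dual form and
  with the maximum replaced by \<open>b + \<beta> (a - b)\<close>, where \<open>\<beta>\<close> is a smooth approximation of the positive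
  part. The gradients of the smoothed maximum and minimum are convex combinations of those of \<open>a\<close> and \<open>b\<close>
  with swapped weights, so the weights may be moved over to the test fields.\<close>

lemma smooth_submodularity:
  fixes a b :: "'a::euclidean_space \<Rightarrow> real" and \<phi> \<psi> :: "'a \<Rightarrow> 'a"
  assumes \<eta>: "0 < \<eta>" and a: "Ck_on 1 a UNIV" and b: "Ck_on 1 b UNIV"
    and \<phi>: "Ck_on 1 \<phi> UNIV" "\<And>x. norm (\<phi> x) \<le> 1" and \<psi>: "Ck_on 1 \<psi> UNIV" "\<And>x. norm (\<psi> x) \<le> 1"
    and K: "compact K" "\<And>x. x \<notin> K \<Longrightarrow> \<phi> x = 0" "\<And>x. x \<notin> K \<Longrightarrow> \<psi> x = 0"
  obtains \<Phi> \<Psi> where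
    "Ck_on 1 \<Phi> UNIV" "\<And>x. norm (\<Phi> x) \<le> 1" "\<And>x. x \<notin> K \<Longrightarrow> \<Phi> x = 0"
    "Ck_on 1 \<Psi> UNIV" "\<And>x. norm (\<Psi> x) \<le> 1" "\<And>x. x \<notin> K \<Longrightarrow> \<Psi> x = 0"
    "(LINT x|lborel. (b x + smooth_pos \<eta> (a x - b x)) * divergence \<psi> x)
      + (LINT x|lborel. (a x - smooth_pos \<eta> (a x - b x)) * divergence \<phi> x)
      = (LINT x|lborel. a x * divergence \<Phi> x) + (LINT x|lborel. b x * divergence \<Psi> x)"
proof -
  define s where "s x = a x - b x" for x
  define l where "l x = smooth_pos' \<eta> (s x)" for x
  define \<Phi> where "\<Phi> x = l x *\<^sub>R \<psi> x + (1 - l x) *\<^sub>R \<phi> x" for x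
  define \<Psi> where "\<Psi> x = (1 - l x) *\<^sub>R \<psi> x + l x *\<^sub>R \<phi> x" for x
  define M where "M x = b x + smooth_pos \<eta> (s x)" for x
  define m where "m x = a x - smooth_pos \<eta> (s x)" for x
  have neg: "Ck_on 1 (\<lambda>x. - f x) UNIV" if "Ck_on 1 f UNIV" for f :: "'a \<Rightarrow> real"
    using Ck_on_1_scaleR[OF Ck_on_1_const that, of "-1"] by simp
  have s: "Ck_on 1 s UNIV" unfolding s_def using Ck_on_1_add[OF a neg[OF b]] by simp
  have l: "Ck_on 1 l UNIV"
    unfolding l_def by (rule Ck_on_1_compose_real[OF s DERIV_smooth_pos'[OF \<eta>] continuous_smooth_pos''[OF \<eta>]])
  have l1: "Ck_on 1 (\<lambda>x. 1 - l x) UNIV" using Ck_on_1_add[OF Ck_on_1_const neg[OF l], of 1] by simp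
  have lb: "0 \<le> l x" "l x \<le> 1" for x unfolding l_def by (rule smooth_pos'_bounds[OF \<eta>])+
  have \<beta>: "Ck_on 1 (\<lambda>x. smooth_pos \<eta> (s x)) UNIV"
    by (rule Ck_on_1_compose_real[OF s DERIV_smooth_pos[OF \<eta>] continuous_smooth_pos'[OF \<eta>]])
  have M: "Ck_on 1 M UNIV" unfolding M_def by (rule Ck_on_1_add[OF b \<beta>])
  have m: "Ck_on 1 m UNIV" unfolding m_def using Ck_on_1_add[OF a neg[OF \<beta>]] by simp
  have \<Phi>: "Ck_on 1 \<Phi> UNIV" unfolding \<Phi>_def by (intro Ck_on_1_add Ck_on_1_scaleR l l1 \<phi> \<psi>)
  have \<Psi>: "Ck_on 1 \<Psi> UNIV" unfolding \<Psi>_def by (intro Ck_on_1_add Ck_on_1_scaleR l l1 \<phi> \<psi>)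
  have K': "\<Phi> x = 0" "\<Psi> x = 0" if "x \<notin> K" for x using K(2,3)[OF that] by (simp_all add: \<Phi>_def \<Psi>_def)
  let ?d = "\<lambda>f x v. frechet_derivative f (at x) v"
  have ds: "(s has_derivative (\<lambda>v. ?d a x v - ?d b x v)) (at x)" for x
    unfolding s_def by (intro has_derivative_diff Ck_on_1_has_derivative a b)
  have d\<beta>: "((\<lambda>x. smooth_pos \<eta> (s x)) has_derivative (\<lambda>v. l x * (?d a x v - ?d b x v))) (at x)" for x
    using has_derivative_compose_real[OF s DERIV_smooth_pos[OF \<eta>], of x]
    by (simp add: l_def frechet_derivative_at[OF ds, symmetric])
  have dM: "?d M x v = l x * ?d a x v + (1 - l x) * ?d b x v" for x v
  proof -
    have "(M has_derivative (\<lambda>v. ?d b x v + l x * (?d a x v - ?d b x v))) (at x)"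
      unfolding M_def by (intro has_derivative_add d\<beta> Ck_on_1_has_derivative b)
    from fun_cong[OF frechet_derivative_at[OF this], of v]
    have "?d M x v = ?d b x v + l x * (?d a x v - ?d b x v)" by (rule sym)
    also have "\<dots> = l x * ?d a x v + (1 - l x) * ?d b x v" by (simp add: right_diff_distrib left_diff_distrib)
    finally show ?thesis .
  qed
  have dm: "?d m x v = (1 - l x) * ?d a x v + l x * ?d b x v" for x v
  proof -
    have "(m has_derivative (\<lambda>v. ?d a x v - l x * (?d a x v - ?d b x v))) (at x)"
      unfolding m_def by (intro has_derivative_diff d\<beta> Ck_on_1_has_derivative a)
    from fun_cong[OF frechet_derivative_at[OF this], of v]
    have "?d m x v = ?d a x v - l x * (?d a x v - ?d b x v)" by (rule sym)
    also have "\<dots> = (1 - l x) * ?d a x v + l x * ?d b x v" by (simp add: right_diff_distrib left_diff_distrib)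
    finally show ?thesis .
  qed
  have lin: "?d f x (c *\<^sub>R u + e *\<^sub>R v) = c * ?d f x u + e * ?d f x v" if "Ck_on 1 f UNIV" for f :: "'a \<Rightarrow> real" and x c u e v
  proof -
    have "linear (frechet_derivative f (at x))"
      using Ck_on_1_has_derivative[OF that] has_derivative_linear by blast
    then show ?thesis by (simp add: linear_add linear_cmul)
  qed
  note parts\<psi> = integral_mult_divergence[OF M \<psi>(1) K(1,3)] and parts\<phi> = integral_mult_divergence[OF m \<phi>(1) K(1,2)]
  note parts\<Phi> = integral_mult_divergence[OF a \<Phi> K(1) K'(1)] and parts\<Psi> = integral_mult_divergence[OF b \<Psi> K(1) K'(2)]
  \<comment> \<open>Shifting the weights from the gradients to the test fields.\<close>
  have "?d M x (\<psi> x) + ?d m x (\<phi> x) = ?d a x (\<Phi> x) + ?d b x (\<Psi> x)" for x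
    unfolding \<Phi>_def \<Psi>_def lin[OF a] lin[OF b] dM dm by (simp add: algebra_simps)
  then have "(LINT x|lborel. ?d M x (\<psi> x) + ?d m x (\<phi> x)) = (LINT x|lborel. ?d a x (\<Phi> x) + ?d b x (\<Psi> x))" by simp
  then have eq: "(LINT x|lborel. M x * divergence \<psi> x) + (LINT x|lborel. m x * divergence \<phi> x)
      = (LINT x|lborel. a x * divergence \<Phi> x) + (LINT x|lborel. b x * divergence \<Psi> x)"
    using parts\<psi> parts\<phi> parts\<Phi> parts\<Psi> by simp
  show ?thesis
  proof (rule that[OF \<Phi> _ K'(1) \<Psi> _ K'(2)])
    show "norm (\<Phi> x) \<le> 1" for x unfolding \<Phi>_def by (intro norm_convex_combination_le \<phi>(2) \<psi>(2) lb)
    show "norm (\<Psi> x) \<le> 1" for x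
      unfolding \<Psi>_def using norm_convex_combination_le[OF \<phi>(2) \<psi>(2) lb, of x x x] by (simp add: add.commute)
  qed (use eq in \<open>simp_all add: M_def m_def s_def\<close>)
qed

text \<open>Mollification commutes with the divergence up to translating the test field, so that mollifying does
  not increase the total variation as long as the translated supports stay inside \<open>\<Omega>\<close>.\<close>

lemma submodularity_test_fields:
  fixes U V :: "'a::euclidean_space \<Rightarrow> real"
  assumes \<Omega>: "open \<Omega>" and U: "integrable lborel U" and V: "integrable lborel V"
    and A: "\<And>\<phi>. C1_compact_support \<Omega> \<phi> \<Longrightarrow> (\<forall>x. norm (\<phi> x) \<le> 1) \<Longrightarrow> (LINT x|lborel. U x * divergence \<phi> x) \<le> A"
    and B: "\<And>\<phi>. C1_compact_support \<Omega> \<phi> \<Longrightarrow> (\<forall>x. norm (\<phi> x) \<le> 1) \<Longrightarrow> (LINT x|lborel. V x * divergence \<phi> x) \<le> B"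
    and \<phi>: "C1_compact_support \<Omega> \<phi>" "\<And>x. norm (\<phi> x) \<le> 1" and \<psi>: "C1_compact_support \<Omega> \<psi>" "\<And>x. norm (\<psi> x) \<le> 1"
  shows "(LINT x|lborel. max (U x) (V x) * divergence \<psi> x) + (LINT x|lborel. min (U x) (V x) * divergence \<phi> x) \<le> A + B"
proof -
  obtain K1 where K1: "Ck_on 1 \<phi> UNIV" "compact K1" "K1 \<subseteq> \<Omega>" "\<And>x. x \<notin> K1 \<Longrightarrow> \<phi> x = 0"
    using C1_compact_supportE[OF \<phi>(1)] by metis
  obtain K2 where K2: "Ck_on 1 \<psi> UNIV" "compact K2" "K2 \<subseteq> \<Omega>" "\<And>x. x \<notin> K2 \<Longrightarrow> \<psi> x = 0"
    using C1_compact_supportE[OF \<psi>(1)] by metis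
  define K where "K = K1 \<union> K2"
  have K: "compact K" "K \<subseteq> \<Omega>" "\<And>x. x \<notin> K \<Longrightarrow> \<phi> x = 0" "\<And>x. x \<notin> K \<Longrightarrow> \<psi> x = 0"
    using K1 K2 by (auto simp: K_def)
  note closedK = compact_imp_closed[OF K(1)]
  obtain d0 where d0: "0 < d0" "\<And>x y. x \<in> K \<Longrightarrow> y \<in> - \<Omega> \<Longrightarrow> d0 \<le> dist x y"
    using separate_compact_closed[of K "- \<Omega>"] K(1,2) \<Omega> by blast
  obtain C where C: "0 \<le> C" "\<And>x. \<bar>divergence \<phi> x\<bar> \<le> C" "\<And>x. \<bar>divergence \<psi> x\<bar> \<le> C"
  proof -
    from continuous_compact_support_bounded[OF divergence_continuous[OF K1(1)] K(1) divergence_outside_support[OF closedK K(3)]]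
    obtain C1 where C1: "\<And>x. norm (divergence \<phi> x) \<le> C1" by blast
    from continuous_compact_support_bounded[OF divergence_continuous[OF K2(1)] K(1) divergence_outside_support[OF closedK K(4)]]
    obtain C2 where C2: "\<And>x. norm (divergence \<psi> x) \<le> C2" by blast
    have "0 \<le> C1" "0 \<le> C2"
      using C1[of undefined] C2[of undefined] norm_ge_zero[of "divergence \<phi> undefined"] norm_ge_zero[of "divergence \<psi> undefined"]
      by linarith+
    then show ?thesis using C1 C2 by (intro that[of "C1 + C2"]) (auto intro: add_increasing add_increasing2)
  qed
  define \<mu> where "\<mu> = measure lborel K"
  have indK: "integrable lborel (indicator K :: 'a \<Rightarrow> real)"
    using K(1) by (intro integrable_real_indicator emeasure_compact_finite) (auto simp: compact_imp_closed)
  have translated: "(LINT x|lborel. W x * divergence \<Phi> (x - y)) \<le> D"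
    if W: "\<And>\<phi>. C1_compact_support \<Omega> \<phi> \<Longrightarrow> (\<forall>x. norm (\<phi> x) \<le> 1) \<Longrightarrow> (LINT x|lborel. W x * divergence \<phi> x) \<le> D"
      and \<Phi>: "Ck_on 1 \<Phi> UNIV" "\<And>x. norm (\<Phi> x) \<le> 1" "\<And>x. x \<notin> K \<Longrightarrow> \<Phi> x = 0" and y: "norm y < d0" for W D \<Phi> y
  proof -
    have "C1_compact_support \<Omega> (\<lambda>x. \<Phi> (x - y))"
    proof (rule C1_compact_supportI[OF divergence_translate(1)[OF \<Phi>(1)]])
      show "compact ((\<lambda>x. x + y) ` K)" using K(1) by (intro compact_continuous_image continuous_intros)
      show "(\<lambda>x. x + y) ` K \<subseteq> \<Omega>"
      proof
        fix z assume "z \<in> (\<lambda>x. x + y) ` K"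
        then obtain x where "x \<in> K" "z = x + y" by auto
        then show "z \<in> \<Omega>" using d0(2)[of x z] y by (auto simp: dist_norm)
      qed
      show "\<Phi> (x - y) = 0" if "x \<notin> (\<lambda>x. x + y) ` K" for x
        using that by (intro \<Phi>(3)) (auto simp: image_iff)
    qed
    from W[OF this] \<Phi>(2) show ?thesis by (simp add: divergence_translate(2)[OF \<Phi>(1)])
  qed
  have approx: "(LINT x|lborel. max (U x) (V x) * divergence \<psi> x) + (LINT x|lborel. min (U x) (V x) * divergence \<phi> x)
      \<le> A + B + 2 * C * (e + e + e * \<mu>)" if e: "0 < e" for e
  proof -
    obtain d1 where d1: "0 < d1" "\<And>y. norm y < d1 \<Longrightarrow> (LINT x|lborel. \<bar>U (x + y) - U x\<bar>) < e"
      using integrable_imp_translation_continuous[OF U] e unfolding translation_continuous_def by blast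
    obtain d2 where d2: "0 < d2" "\<And>y. norm y < d2 \<Longrightarrow> (LINT x|lborel. \<bar>V (x + y) - V x\<bar>) < e"
      using integrable_imp_translation_continuous[OF V] e unfolding translation_continuous_def by blast
    define \<delta> where "\<delta> = min d0 (min d1 d2)"
    have \<delta>: "0 < \<delta>" "\<delta> \<le> d0" "\<delta> \<le> d1" "\<delta> \<le> d2" using d0 d1 d2 by (auto simp: \<delta>_def)
    obtain \<rho> :: "'a \<Rightarrow> real" where \<rho>: "Ck_on 1 \<rho> UNIV" "\<And>y. 0 \<le> \<rho> y"
        "\<And>y. \<delta> \<le> norm y \<Longrightarrow> \<rho> y = 0" "(LINT y|lborel. \<rho> y) = 1"
      using mollifier_exists[OF \<delta>(1)] by blast
    define a where "a = mollify \<rho> U"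
    define b where "b = mollify \<rho> V"
    have a: "Ck_on 1 a UNIV" unfolding a_def by (rule mollify_C1[OF \<rho> U])
    have b: "Ck_on 1 b UNIV" unfolding b_def by (rule mollify_C1[OF \<rho> V])
    have oscU: "(LINT x|lborel. \<bar>U (x + y) - U x\<bar>) \<le> e" if "norm y < \<delta>" for y
      using d1(2)[of y] that \<delta> by simp
    have aU1: "integrable lborel (\<lambda>x. a x - U x)"
      unfolding a_def by (rule mollify_L1(1)[where \<delta> = \<delta> and e = e]) (use \<rho> U oscU in auto)
    have aU2: "(LINT x|lborel. \<bar>a x - U x\<bar>) \<le> e"
      unfolding a_def by (rule mollify_L1(2)[where \<delta> = \<delta>]) (use \<rho> U oscU in auto)
    note aU = aU1 aU2
    have oscV: "(LINT x|lborel. \<bar>V (x + y) - V x\<bar>) \<le> e" if "norm y < \<delta>" for y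
      using d2(2)[of y] that \<delta> by simp
    have bV1: "integrable lborel (\<lambda>x. b x - V x)"
      unfolding b_def by (rule mollify_L1(1)[where \<delta> = \<delta> and e = e]) (use \<rho> V oscV in auto)
    have bV2: "(LINT x|lborel. \<bar>b x - V x\<bar>) \<le> e"
      unfolding b_def by (rule mollify_L1(2)[where \<delta> = \<delta>]) (use \<rho> V oscV in auto)
    note bV = bV1 bV2
    obtain \<Phi> \<Psi> where \<Phi>: "Ck_on 1 \<Phi> UNIV" "\<And>x. norm (\<Phi> x) \<le> 1" "\<And>x. x \<notin> K \<Longrightarrow> \<Phi> x = 0"
      and \<Psi>: "Ck_on 1 \<Psi> UNIV" "\<And>x. norm (\<Psi> x) \<le> 1" "\<And>x. x \<notin> K \<Longrightarrow> \<Psi> x = 0"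
      and eq: "(LINT x|lborel. (b x + smooth_pos e (a x - b x)) * divergence \<psi> x)
        + (LINT x|lborel. (a x - smooth_pos e (a x - b x)) * divergence \<phi> x)
        = (LINT x|lborel. a x * divergence \<Phi> x) + (LINT x|lborel. b x * divergence \<Psi> x)"
      using smooth_submodularity[OF e a b K1(1) \<phi>(2) K2(1) \<psi>(2) K(1,3,4)] by blast
    have pairing: "(LINT x|lborel. mollify \<rho> W x * divergence \<Theta> x) \<le> D"
      if W: "integrable lborel W" "\<And>\<phi>. C1_compact_support \<Omega> \<phi> \<Longrightarrow> (\<forall>x. norm (\<phi> x) \<le> 1) \<Longrightarrow> (LINT x|lborel. W x * divergence \<phi> x) \<le> D"
        and \<Theta>: "Ck_on 1 \<Theta> UNIV" "\<And>x. norm (\<Theta> x) \<le> 1" "\<And>x. x \<notin> K \<Longrightarrow> \<Theta> x = 0" for W D \<Theta>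
    proof -
      from continuous_compact_support_bounded[OF divergence_continuous[OF \<Theta>(1)] K(1) divergence_outside_support[OF closedK \<Theta>(3)]]
      obtain C' where "\<And>x. norm (divergence \<Theta> x) \<le> C'" by blast
      then have C': "\<bar>divergence \<Theta> x\<bar> \<le> C'" for x by simp
      show ?thesis
      proof (rule mollify_pairing_le[where \<delta> = \<delta> and C = C'])
        show "(LINT x|lborel. W x * divergence \<Theta> (x - y)) \<le> D" if "norm y < \<delta>" for y
          using that \<delta> W(2) \<Theta> by (intro translated[of W D \<Theta>]) auto
      qed (use \<rho> W(1) C' divergence_continuous[OF \<Theta>(1)] in auto)
    qed
    have le: "(LINT x|lborel. a x * divergence \<Phi> x) + (LINT x|lborel. b x * divergence \<Psi> x) \<le> A + B"
      unfolding a_def b_def by (intro add_mono pairing[OF U A \<Phi>] pairing[OF V B \<Psi>])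
    have close: "\<bar>P - (u + smooth_pos e (v - u))\<bar> \<le> \<bar>v - U'\<bar> + \<bar>u - V'\<bar> + e" if "P = max U' V'" for P u v U' V'
    proof -
      have "\<bar>P - (u + max (v - u) 0)\<bar> \<le> \<bar>v - U'\<bar> + \<bar>u - V'\<bar>" using that by (auto simp: max_def)
      then show ?thesis using smooth_pos_approx[OF e, of "v - u"] e unfolding abs_le_iff by linarith
    qed
    have close': "\<bar>P - (v - smooth_pos e (v - u))\<bar> \<le> \<bar>v - U'\<bar> + \<bar>u - V'\<bar> + e" if "P = min U' V'" for P u v U' V'
    proof -
      have "\<bar>P - (v - max (v - u) 0)\<bar> \<le> \<bar>v - U'\<bar> + \<bar>u - V'\<bar>" using that by (auto simp: max_def min_def)
      then show ?thesis using smooth_pos_approx[OF e, of "v - u"] e unfolding abs_le_iff by linarith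
    qed
    let ?E = "\<lambda>x. (\<bar>a x - U x\<bar> + \<bar>b x - V x\<bar> + e * indicator K x)"
    have Eint: "integrable lborel ?E" using aU(1) bV(1) indK by simp
    have Eval: "(LINT x|lborel. ?E x) \<le> e + e + e * \<mu>"
      using aU bV indK by (simp add: \<mu>_def)
    have compare: "(LINT x|lborel. P x * divergence \<theta> x) \<le> (LINT x|lborel. Q x * divergence \<theta> x) + C * (e + e + e * \<mu>)"
      if P: "integrable lborel P" and Q: "integrable lborel (\<lambda>x. Q x * divergence \<theta> x)"
        and PQ: "\<And>x. \<bar>P x - Q x\<bar> \<le> \<bar>a x - U x\<bar> + \<bar>b x - V x\<bar> + e"
        and \<theta>: "Ck_on 1 \<theta> UNIV" "\<And>x. x \<notin> K \<Longrightarrow> \<theta> x = 0" "\<And>x. \<bar>divergence \<theta> x\<bar> \<le> C" for P Q \<theta>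
    proof -
      have Pint: "integrable lborel (\<lambda>x. P x * divergence \<theta> x)"
        using integrable_bounded_mult[OF P _ \<theta>(3)] divergence_continuous[OF \<theta>(1)]
        by (simp add: borel_measurable_continuous_onI mult.commute)
      have "(LINT x|lborel. P x * divergence \<theta> x) \<le> (LINT x|lborel. Q x * divergence \<theta> x + C * ?E x)"
      proof (rule integral_mono)
        fix x
        show "P x * divergence \<theta> x \<le> Q x * divergence \<theta> x + C * ?E x"
        proof (cases "x \<in> K")
          case True
          have "(P x - Q x) * divergence \<theta> x \<le> \<bar>P x - Q x\<bar> * \<bar>divergence \<theta> x\<bar>" by (metis abs_ge_self abs_mult)
          also have "\<dots> \<le> ?E x * C" using PQ[of x] \<theta>(3)[of x] True by (intro mult_mono) auto
          finally show ?thesis by (simp add: algebra_simps)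
        next
          case False
          then show ?thesis using divergence_outside_support[OF closedK \<theta>(2) False] C(1) by simp
        qed
      qed (use Pint Q Eint in simp_all)
      also have "\<dots> = (LINT x|lborel. Q x * divergence \<theta> x) + C * (LINT x|lborel. ?E x)"
        using Q Eint by simp
      also have "\<dots> \<le> (LINT x|lborel. Q x * divergence \<theta> x) + C * (e + e + e * \<mu>)"
        using Eval C(1) by (intro add_left_mono mult_left_mono)
      finally show ?thesis .
    qed
    have s: "Ck_on 1 (\<lambda>x. a x - b x) UNIV"
      using Ck_on_1_add[OF a Ck_on_1_scaleR[OF Ck_on_1_const b], of "-1"] by simp
    have \<beta>: "Ck_on 1 (\<lambda>x. smooth_pos e (a x - b x)) UNIV"
      by (rule Ck_on_1_compose_real[OF s DERIV_smooth_pos[OF e] continuous_smooth_pos'[OF e]])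
    have m: "Ck_on 1 (\<lambda>x. a x - smooth_pos e (a x - b x)) UNIV"
      using Ck_on_1_add[OF a Ck_on_1_scaleR[OF Ck_on_1_const \<beta>], of "-1"] by simp
    have "(LINT x|lborel. max (U x) (V x) * divergence \<psi> x)
        \<le> (LINT x|lborel. (b x + smooth_pos e (a x - b x)) * divergence \<psi> x) + C * (e + e + e * \<mu>)"
      by (rule compare[OF _ integral_mult_divergence(1)[OF Ck_on_1_add[OF b \<beta>] K2(1) K(1,4)] close K2(1) K(4) C(3)])
         (use U V in auto)
    moreover have "(LINT x|lborel. min (U x) (V x) * divergence \<phi> x)
        \<le> (LINT x|lborel. (a x - smooth_pos e (a x - b x)) * divergence \<phi> x) + C * (e + e + e * \<mu>)"
      by (rule compare[OF _ integral_mult_divergence(1)[OF m K1(1) K(1,3)] close' K1(1) K(3) C(2)])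
         (use U V in auto)
    ultimately show ?thesis using eq le by (simp add: algebra_simps)
  qed
  have "((\<lambda>e. A + B + 2 * C * (e + e + e * \<mu>)) \<longlongrightarrow> A + B + 2 * C * (0 + 0 + 0 * \<mu>)) (at_right 0)"
    by (intro tendsto_intros)
  then have lim: "((\<lambda>e. A + B + 2 * C * (e + e + e * \<mu>)) \<longlongrightarrow> A + B) (at_right 0)" by simp
  have "\<forall>\<^sub>F e in at_right 0. (LINT x|lborel. max (U x) (V x) * divergence \<psi> x)
      + (LINT x|lborel. min (U x) (V x) * divergence \<phi> x) \<le> A + B + 2 * C * (e + e + e * \<mu>)"
    using eventually_at_right_less[of "0::real"] by eventually_elim (rule approx)
  then show ?thesis by (rule tendsto_lowerbound[OF lim]) simp
qed

text \<open>Fubini's theorem is applied to products of Borel measures, so functions on the domain are first replaced by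
  Borel functions on the whole space.\<close>

lemma integrable_lebesgue_on_borel_representative:
  fixes w :: "'a::euclidean_space \<Rightarrow> real"
  assumes S: "S \<in> sets lebesgue" and w: "integrable (lebesgue_on S) w"
  obtains U where "integrable lborel U" "AE x in lebesgue. x \<in> S \<longrightarrow> w x = U x"
proof -
  let ?w = "\<lambda>x. indicator S x *\<^sub>R w x"
  have int: "integrable lebesgue ?w" using w S by (simp add: integrable_restrict_space)
  obtain U where U: "U \<in> borel_measurable lborel" "AE x in lborel. ?w x = U x"
    using completion_ex_borel_measurable_real[OF borel_measurable_integrable[OF int]] by blast
  have AE: "AE x in lebesgue. ?w x = U x" using U(2) by (rule AE_completion)
  have "integrable lebesgue U"
    using int AE U(1) by (subst integrable_cong_AE[of _ _ ?w]) (auto intro: measurable_completion elim: eventually_mono)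
  then have "integrable lborel U" using U(1) by (simp add: integrable_completion)
  moreover have "AE x in lebesgue. x \<in> S \<longrightarrow> w x = U x" using AE by eventually_elim (auto simp: indicator_def)
  ultimately show ?thesis by (rule that)
qed

lemma pairing_eq_lborel:
  fixes w U :: "'a::euclidean_space \<Rightarrow> real"
  assumes \<Omega>: "\<Omega> \<in> sets lebesgue" and w: "w \<in> borel_measurable (lebesgue_on \<Omega>)" and U: "U \<in> borel_measurable lborel"
    and eq: "AE x in lebesgue. x \<in> \<Omega> \<longrightarrow> w x = U x" and \<phi>: "C1_compact_support \<Omega> \<phi>"
  shows "(LINT x|lebesgue_on \<Omega>. w x * divergence \<phi> x) = (LINT x|lborel. U x * divergence \<phi> x)"
proof -
  obtain K where K: "Ck_on 1 \<phi> UNIV" "compact K" "K \<subseteq> \<Omega>" "\<And>x. x \<notin> K \<Longrightarrow> \<phi> x = 0"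
    using C1_compact_supportE[OF \<phi>] by metis
  have div: "divergence \<phi> \<in> borel_measurable lborel"
    using divergence_continuous[OF K(1)] by (simp add: borel_measurable_continuous_onI)
  have zero: "divergence \<phi> x = 0" if "x \<notin> \<Omega>" for x
    using that K by (intro divergence_outside_support[OF compact_imp_closed[OF K(2)] K(4)]) auto
  have "(LINT x|lebesgue_on \<Omega>. w x * divergence \<phi> x) = (LINT x|lebesgue. indicator \<Omega> x *\<^sub>R (w x * divergence \<phi> x))"
    using \<Omega> by (simp add: integral_restrict_space)
  also have "\<dots> = (LINT x|lebesgue. U x * divergence \<phi> x)"
  proof (rule integral_cong_AE)
    have "(\<lambda>x. w x * divergence \<phi> x) \<in> borel_measurable (lebesgue_on \<Omega>)"
      by (rule borel_measurable_times[OF w measurable_restrict_space1[OF measurable_completion[OF div]]])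
    then show "(\<lambda>x. indicator \<Omega> x *\<^sub>R (w x * divergence \<phi> x)) \<in> borel_measurable lebesgue"
      using \<Omega> by (subst (asm) borel_measurable_restrict_space_iff) auto
    show "(\<lambda>x. U x * divergence \<phi> x) \<in> borel_measurable lebesgue"
      using U div by (intro measurable_completion borel_measurable_times)
    show "AE x in lebesgue. indicator \<Omega> x *\<^sub>R (w x * divergence \<phi> x) = U x * divergence \<phi> x"
      using eq by eventually_elim (auto simp: indicator_def zero)
  qed
  also have "\<dots> = (LINT x|lborel. U x * divergence \<phi> x)"
    using U div by (intro integral_completion) auto
  finally show ?thesis .
qed

lemma C1_compact_support_zero: "C1_compact_support \<Omega> (\<lambda>x. 0)"
  by (rule C1_compact_supportI[OF Ck_on_1_const, of "{}"]) auto

text \<open>The dual inequality bounds the sum of the pairings with two independent test fields; taking the suprema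
  separately gives the total variations. With one field equal to zero it shows that minimum and maximum have
  bounded variation at all.\<close>

lemma total_variation_min_max:
  fixes u v :: "'a::euclidean_space \<Rightarrow> real"
  assumes \<Omega>: "open \<Omega>" and u: "u \<in> BV \<Omega>" and v: "v \<in> BV \<Omega>"
  shows "(\<lambda>x. min (u x) (v x)) \<in> BV \<Omega>" "(\<lambda>x. max (u x) (v x)) \<in> BV \<Omega>"
    and "total_variation \<Omega> (\<lambda>x. min (u x) (v x)) + total_variation \<Omega> (\<lambda>x. max (u x) (v x))
      \<le> total_variation \<Omega> u + total_variation \<Omega> v"
proof -
  have \<Omega>s: "\<Omega> \<in> sets lebesgue" using \<Omega> by auto
  have ui: "integrable (lebesgue_on \<Omega>) u" and ub: "bdd_above (variation_set \<Omega> u)" using u by (auto simp: BV_def)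
  have vi: "integrable (lebesgue_on \<Omega>) v" and vb: "bdd_above (variation_set \<Omega> v)" using v by (auto simp: BV_def)
  obtain U where U: "integrable lborel U" "AE x in lebesgue. x \<in> \<Omega> \<longrightarrow> u x = U x"
    using integrable_lebesgue_on_borel_representative[OF \<Omega>s ui] by blast
  obtain V where V: "integrable lborel V" "AE x in lebesgue. x \<in> \<Omega> \<longrightarrow> v x = V x"
    using integrable_lebesgue_on_borel_representative[OF \<Omega>s vi] by blast
  have mini: "integrable (lebesgue_on \<Omega>) (\<lambda>x. min (u x) (v x))" and maxi: "integrable (lebesgue_on \<Omega>) (\<lambda>x. max (u x) (v x))"
    using ui vi by auto
  note eq = pairing_eq_lborel[OF \<Omega>s]
  have mem: "(LINT x|lebesgue_on \<Omega>. w x * divergence \<phi> x) \<in> variation_set \<Omega> w"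
    if "C1_compact_support \<Omega> \<phi>" "\<forall>x. norm (\<phi> x) \<le> 1" for w \<phi>
    using that unfolding variation_set_def by blast
  have U': "(LINT x|lborel. U x * divergence \<phi> x) \<le> total_variation \<Omega> u"
    if "C1_compact_support \<Omega> \<phi>" "\<forall>x. norm (\<phi> x) \<le> 1" for \<phi>
    using cSup_upper[OF mem[OF that] ub] eq[OF borel_measurable_integrable[OF ui] borel_measurable_integrable[OF U(1)] U(2) that(1)]
    by (simp add: total_variation_def)
  have V': "(LINT x|lborel. V x * divergence \<phi> x) \<le> total_variation \<Omega> v"
    if "C1_compact_support \<Omega> \<phi>" "\<forall>x. norm (\<phi> x) \<le> 1" for \<phi>
    using cSup_upper[OF mem[OF that] vb] eq[OF borel_measurable_integrable[OF vi] borel_measurable_integrable[OF V(1)] V(2) that(1)]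
    by (simp add: total_variation_def)
  have sum: "(LINT x|lebesgue_on \<Omega>. max (u x) (v x) * divergence \<psi> x) + (LINT x|lebesgue_on \<Omega>. min (u x) (v x) * divergence \<phi> x)
      \<le> total_variation \<Omega> u + total_variation \<Omega> v"
    if \<psi>: "C1_compact_support \<Omega> \<psi>" "\<forall>x. norm (\<psi> x) \<le> 1" and \<phi>: "C1_compact_support \<Omega> \<phi>" "\<forall>x. norm (\<phi> x) \<le> 1" for \<phi> \<psi>
  proof -
    have AE: "AE x in lebesgue. x \<in> \<Omega> \<longrightarrow> max (u x) (v x) = max (U x) (V x)"
      "AE x in lebesgue. x \<in> \<Omega> \<longrightarrow> min (u x) (v x) = min (U x) (V x)"
      using U(2) V(2) by (eventually_elim, simp)+
    have meas: "(\<lambda>x. max (U x) (V x)) \<in> borel_measurable lborel" "(\<lambda>x. min (U x) (V x)) \<in> borel_measurable lborel"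
      using U(1) V(1) by (auto dest: borel_measurable_integrable)
    show ?thesis
      unfolding eq[OF borel_measurable_integrable[OF maxi] meas(1) AE(1) \<psi>(1)] eq[OF borel_measurable_integrable[OF mini] meas(2) AE(2) \<phi>(1)]
      using \<phi> \<psi> by (intro submodularity_test_fields[OF \<Omega> U(1) V(1) U' V']) auto
  qed
  have zero: "(LINT x|lebesgue_on \<Omega>. w x * divergence (\<lambda>x. 0) x) = 0" for w :: "'a \<Rightarrow> real"
  proof -
    have "divergence (\<lambda>x::'a. 0) = (\<lambda>x. 0)"
      using divergence_outside_support[of "{}" "\<lambda>x::'a. 0"] by auto
    then show ?thesis by simp
  qed
  have nonempty: "variation_set \<Omega> w \<noteq> {}" for w
    using mem[OF C1_compact_support_zero] by force
  have "bdd_above (variation_set \<Omega> (\<lambda>x. min (u x) (v x)))"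
    unfolding variation_set_def
    using sum[OF C1_compact_support_zero] by (intro bdd_aboveI[of _ "total_variation \<Omega> u + total_variation \<Omega> v"]) (auto simp: zero)
  with mini show "(\<lambda>x. min (u x) (v x)) \<in> BV \<Omega>" by (simp add: BV_def)
  have "bdd_above (variation_set \<Omega> (\<lambda>x. max (u x) (v x)))"
    unfolding variation_set_def
    using sum[OF _ _ C1_compact_support_zero] by (intro bdd_aboveI[of _ "total_variation \<Omega> u + total_variation \<Omega> v"]) (auto simp: zero)
  with maxi show "(\<lambda>x. max (u x) (v x)) \<in> BV \<Omega>" by (simp add: BV_def)
  let ?S = "total_variation \<Omega> u + total_variation \<Omega> v"
  have "b \<le> ?S - a" if a: "a \<in> variation_set \<Omega> (\<lambda>x. min (u x) (v x))" and b: "b \<in> variation_set \<Omega> (\<lambda>x. max (u x) (v x))" for a b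
    using a b sum unfolding variation_set_def by fastforce
  then have "total_variation \<Omega> (\<lambda>x. max (u x) (v x)) \<le> ?S - a" if "a \<in> variation_set \<Omega> (\<lambda>x. min (u x) (v x))" for a
    unfolding total_variation_def[of \<Omega> "\<lambda>x. max (u x) (v x)"] using nonempty that by (intro cSup_least)
  then have "a \<le> ?S - total_variation \<Omega> (\<lambda>x. max (u x) (v x))" if "a \<in> variation_set \<Omega> (\<lambda>x. min (u x) (v x))" for a
    using that by (simp add: algebra_simps) 
  then have "total_variation \<Omega> (\<lambda>x. min (u x) (v x)) \<le> ?S - total_variation \<Omega> (\<lambda>x. max (u x) (v x))"
    unfolding total_variation_def[of \<Omega> "\<lambda>x. min (u x) (v x)"] using nonempty by (intro cSup_least)
  then show "total_variation \<Omega> (\<lambda>x. min (u x) (v x)) + total_variation \<Omega> (\<lambda>x. max (u x) (v x)) \<le> ?S" by simp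
qed

section \<open>Traces\<close>

text \<open>An operation that is Lipschitz with constant one in the sum of the distances preserves one-sided
  approximate limits in the mean.\<close>

lemma has_trace_lattice:
  fixes F :: "real \<Rightarrow> real \<Rightarrow> real"
  assumes \<Omega>: "open \<Omega>"
    and w: "integrable (lebesgue_on \<Omega>) w1" "integrable (lebesgue_on \<Omega>) w2" "integrable (lebesgue_on \<Omega>) (\<lambda>x. F (w1 x) (w2 x))"
    and tr: "has_trace \<Omega> w1 g1" "has_trace \<Omega> w2 g2"
    and g: "integrable (boundary_measure \<Omega>) (\<lambda>x. F (g1 x) (g2 x))"
    and F: "\<And>a b c d. \<bar>F a b - F c d\<bar> \<le> \<bar>a - c\<bar> + \<bar>b - d\<bar>"
  shows "has_trace \<Omega> (\<lambda>x. F (w1 x) (w2 x)) (\<lambda>x. F (g1 x) (g2 x))"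
proof -
  have int: "set_integrable lebesgue (\<Omega> \<inter> ball x r) (\<lambda>y. \<bar>w y - c\<bar>)" if "integrable (lebesgue_on \<Omega>) w" for w :: "'a \<Rightarrow> real" and c x r
  proof -
    have "\<Omega> \<in> sets lebesgue" using \<Omega> by auto
    then have "set_integrable lebesgue \<Omega> w"
      using that by (simp add: set_integrable_def integrable_restrict_space)
    then have 1: "set_integrable lebesgue (\<Omega> \<inter> ball x r) w"
      by (rule set_integrable_subset) (use \<Omega> in auto)
    have "\<Omega> \<inter> ball x r \<in> lmeasurable"
      using \<Omega> by (intro bounded_set_imp_lmeasurable bounded_Int) auto
    then have "set_integrable lebesgue (\<Omega> \<inter> ball x r) (\<lambda>_. c)"
      unfolding set_integrable_def by (intro integrable_scaleR_left integrable_real_indicator) (auto simp: fmeasurable_def)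
    from set_integrable_abs[OF set_integral_diff(1)[OF 1 this]] show ?thesis .
  qed
  have "AE x in boundary_measure \<Omega>.
      ((\<lambda>r. (LINT y:\<Omega> \<inter> ball x r|lebesgue. \<bar>F (w1 y) (w2 y) - F (g1 x) (g2 x)\<bar>) / r ^ DIM('a)) \<longlongrightarrow> 0) (at_right 0)"
    using tr[unfolded has_trace_def, THEN conjunct2]
  proof eventually_elim
    case (elim x)
    let ?I = "\<lambda>w c r. LINT y:\<Omega> \<inter> ball x r|lebesgue. \<bar>w y - c\<bar>"
    have le: "?I (\<lambda>y. F (w1 y) (w2 y)) (F (g1 x) (g2 x)) r \<le> ?I w1 (g1 x) r + ?I w2 (g2 x) r" for r
    proof -
      have "?I (\<lambda>y. F (w1 y) (w2 y)) (F (g1 x) (g2 x)) r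
          \<le> (LINT y:\<Omega> \<inter> ball x r|lebesgue. \<bar>w1 y - g1 x\<bar> + \<bar>w2 y - g2 x\<bar>)"
        by (rule set_integral_mono[OF int[OF w(3)] set_integral_add(1)[OF int[OF w(1)] int[OF w(2)]]]) (rule F)
      also have "\<dots> = ?I w1 (g1 x) r + ?I w2 (g2 x) r"
        by (rule set_integral_add(2)[OF int[OF w(1)] int[OF w(2)]])
      finally show ?thesis .
    qed
    have nonneg: "0 \<le> ?I (\<lambda>y. F (w1 y) (w2 y)) (F (g1 x) (g2 x)) r" for r
      unfolding set_lebesgue_integral_def by (intro Bochner_Integration.integral_nonneg) auto
    show ?case
    proof (rule Lim_null_comparison)
      show "((\<lambda>r. ?I w1 (g1 x) r / r ^ DIM('a) + ?I w2 (g2 x) r / r ^ DIM('a)) \<longlongrightarrow> 0) (at_right 0)"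
        using tendsto_add[OF elim] by simp
      show "\<forall>\<^sub>F r in at_right 0. norm (?I (\<lambda>y. F (w1 y) (w2 y)) (F (g1 x) (g2 x)) r / r ^ DIM('a))
          \<le> ?I w1 (g1 x) r / r ^ DIM('a) + ?I w2 (g2 x) r / r ^ DIM('a)"
        using eventually_at_right_less[of "0::real"]
      proof eventually_elim
        case (elim r)
        have "?I (\<lambda>y. F (w1 y) (w2 y)) (F (g1 x) (g2 x)) r / r ^ DIM('a) \<le> (?I w1 (g1 x) r + ?I w2 (g2 x) r) / r ^ DIM('a)"
          using le[of r] elim by (intro divide_right_mono) auto
        then show ?case using nonneg[of r] elim
          by (simp add: add_divide_distrib)
      qed
    qed
  qed
  with g show ?thesis unfolding has_trace_def by blast
qed

section \<open>The comparison estimate at a fixed time\<close>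

text \<open>The condition that the weak formulation imposes at one instant. Here \<open>p\<close> and \<open>q\<close> stand for the time derivative
  minus the source in the domain and on the boundary, \<open>g\<close> for the trace of \<open>u\<close>, and \<open>G\<close> for the surface gradient
  of the boundary function \<open>v\<close>.\<close>

definition variational_inequality ::
    "real \<Rightarrow> 'a::euclidean_space set \<Rightarrow> ('a \<Rightarrow> real) \<Rightarrow> ('a \<Rightarrow> real) \<Rightarrow> ('a \<Rightarrow> real) \<Rightarrow> ('a \<Rightarrow> real) \<Rightarrow>
     ('a \<Rightarrow> real) \<Rightarrow> ('a \<Rightarrow> 'a) \<Rightarrow> bool" where
  "variational_inequality \<epsilon> \<Omega> p q u g v G \<longleftrightarrow>
     (\<forall>z z\<^sub>\<Gamma> h Z.
        z \<in> BV \<Omega> \<inter> L2 (lebesgue_on \<Omega>) \<longrightarrow> has_trace \<Omega> z h \<longrightarrow>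
        z\<^sub>\<Gamma> \<in> H1_boundary \<Omega> \<longrightarrow> has_surface_gradient \<Omega> z\<^sub>\<Gamma> Z \<longrightarrow>
        (LINT x|lebesgue_on \<Omega>. p x * (u x - z x))
          + total_variation \<Omega> u
          + (LINT x|boundary_measure \<Omega>. \<bar>g x - v x\<bar>)
          + (LINT x|boundary_measure \<Omega>. q x * (v x - z\<^sub>\<Gamma> x))
          + \<epsilon>\<^sup>2 * (LINT x|boundary_measure \<Omega>. G x \<bullet> (G x - Z x))
        \<le> total_variation \<Omega> z + (LINT x|boundary_measure \<Omega>. \<bar>h x - z\<^sub>\<Gamma> x\<bar>))"

text \<open>T-monotonicity of the convex energy. The first solution is tested with the minimum, the second with the
  maximum; the total variations, the boundary mismatches and the surface energies of minimum and maximum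
  together do not exceed those of the two solutions.\<close>

lemma variational_inequality_comparison:
  fixes \<Omega> :: "'a::euclidean_space set"
  assumes \<Omega>: "smooth_bounded_domain \<Omega>"
    and u1: "u1 \<in> BV \<Omega>" "u1 \<in> L2 (lebesgue_on \<Omega>)" "has_trace \<Omega> u1 g1" "has_surface_gradient \<Omega> v1 G1"
    and u2: "u2 \<in> BV \<Omega>" "u2 \<in> L2 (lebesgue_on \<Omega>)" "has_trace \<Omega> u2 g2" "has_surface_gradient \<Omega> v2 G2"
    and p: "p1 \<in> L2 (lebesgue_on \<Omega>)" "p2 \<in> L2 (lebesgue_on \<Omega>)"
    and q: "q1 \<in> L2 (boundary_measure \<Omega>)" "q2 \<in> L2 (boundary_measure \<Omega>)"
    and VI1: "variational_inequality \<epsilon> \<Omega> p1 q1 u1 g1 v1 G1"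
    and VI2: "variational_inequality \<epsilon> \<Omega> p2 q2 u2 g2 v2 G2"
  shows "(LINT x|lebesgue_on \<Omega>. (p1 x - p2 x) * max (u1 x - u2 x) 0)
    + (LINT x|boundary_measure \<Omega>. (q1 x - q2 x) * max (v1 x - v2 x) 0) \<le> 0"
proof -
  let ?M = "lebesgue_on \<Omega>" and ?N = "boundary_measure \<Omega>"
  have op: "open \<Omega>" using \<Omega> by (simp add: smooth_bounded_domain_def)
  have fin: "finite_measure ?N" by (rule finite_boundary_measure[OF \<Omega>])
  interpret N: finite_measure ?N by (rule fin)
  have v: "v1 \<in> L2 ?N" "v2 \<in> L2 ?N" and G: "G1 \<in> L2 ?N" "G2 \<in> L2 ?N"
    using has_surface_gradient_L2 u1(4) u2(4) by blast+
  have vi: "integrable ?N v1" "integrable ?N v2"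
    using v by (auto simp: L2_def intro!: N.square_integrable_imp_integrable)
  have gi: "integrable ?N g1" "integrable ?N g2" using u1(3) u2(3) by (auto simp: has_trace_def)
  have ui: "integrable ?M u1" "integrable ?M u2" using u1(1) u2(1) by (auto simp: BV_def)
  define w where "w x = max (u1 x - u2 x) 0" for x
  define w\<^sub>\<Gamma> where "w\<^sub>\<Gamma> x = max (v1 x - v2 x) 0" for x
  define P where "P x = ((1 + sgn (v1 x - v2 x)) / 2) *\<^sub>R (G1 x - G2 x)" for x
  have w: "w \<in> L2 ?M" unfolding w_def using u1(2) u2(2) by (intro L2_pos L2_diff)
  have wG: "w\<^sub>\<Gamma> \<in> L2 ?N" unfolding w\<^sub>\<Gamma>_def using v by (intro L2_pos L2_diff)
  have "has_surface_gradient \<Omega> (\<lambda>x. v1 x - v2 x) (\<lambda>x. G1 x - G2 x)"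
    using has_surface_gradient_add_scaled[OF u1(4) u2(4), of "-1"] by simp
  then have P: "has_surface_gradient \<Omega> w\<^sub>\<Gamma> P"
    unfolding w\<^sub>\<Gamma>_def[abs_def] P_def[abs_def] by (rule has_surface_gradient_pos[OF fin])
  have PL2: "P \<in> L2 ?N" using has_surface_gradient_L2(2)[OF P] .
  have min: "has_surface_gradient \<Omega> (\<lambda>x. min (v1 x) (v2 x)) (\<lambda>x. G1 x - P x)"
  proof -
    have "(\<lambda>x. v1 x + (-1) * w\<^sub>\<Gamma> x) = (\<lambda>x. min (v1 x) (v2 x))" by (auto simp: w\<^sub>\<Gamma>_def)
    then show ?thesis using has_surface_gradient_add_scaled[OF u1(4) P, of "-1"] by simp
  qed
  have max: "has_surface_gradient \<Omega> (\<lambda>x. max (v1 x) (v2 x)) (\<lambda>x. G2 x + P x)"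
  proof -
    have "(\<lambda>x. v2 x + 1 * w\<^sub>\<Gamma> x) = (\<lambda>x. max (v1 x) (v2 x))" by (auto simp: w\<^sub>\<Gamma>_def)
    then show ?thesis using has_surface_gradient_add_scaled[OF u2(4) P, of 1] by simp
  qed
  note tv = total_variation_min_max[OF op u1(1) u2(1)]
  have trmin: "has_trace \<Omega> (\<lambda>x. min (u1 x) (u2 x)) (\<lambda>x. min (g1 x) (g2 x))"
  proof (rule has_trace_lattice[OF op ui _ u1(3) u2(3)])
    show "\<bar>min a b - min c d\<bar> \<le> \<bar>a - c\<bar> + \<bar>b - d\<bar>" for a b c d :: real by (auto simp: min_def)
  qed (use ui gi in auto)
  have trmax: "has_trace \<Omega> (\<lambda>x. max (u1 x) (u2 x)) (\<lambda>x. max (g1 x) (g2 x))"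
  proof (rule has_trace_lattice[OF op ui _ u1(3) u2(3)])
    show "\<bar>max a b - max c d\<bar> \<le> \<bar>a - c\<bar> + \<bar>b - d\<bar>" for a b c d :: real by (auto simp: max_def)
  qed (use ui gi in auto)
  have I1: "(LINT x|?M. p1 x * (u1 x - min (u1 x) (u2 x))) + total_variation \<Omega> u1
      + (LINT x|?N. \<bar>g1 x - v1 x\<bar>) + (LINT x|?N. q1 x * (v1 x - min (v1 x) (v2 x)))
      + \<epsilon>\<^sup>2 * (LINT x|?N. G1 x \<bullet> (G1 x - (G1 x - P x)))
      \<le> total_variation \<Omega> (\<lambda>x. min (u1 x) (u2 x)) + (LINT x|?N. \<bar>min (g1 x) (g2 x) - min (v1 x) (v2 x)\<bar>)"
    using VI1 tv(1) L2_min[OF u1(2) u2(2)] trmin min unfolding variational_inequality_def H1_boundary_def by blast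
  have I2: "(LINT x|?M. p2 x * (u2 x - max (u1 x) (u2 x))) + total_variation \<Omega> u2
      + (LINT x|?N. \<bar>g2 x - v2 x\<bar>) + (LINT x|?N. q2 x * (v2 x - max (v1 x) (v2 x)))
      + \<epsilon>\<^sup>2 * (LINT x|?N. G2 x \<bullet> (G2 x - (G2 x + P x)))
      \<le> total_variation \<Omega> (\<lambda>x. max (u1 x) (u2 x)) + (LINT x|?N. \<bar>max (g1 x) (g2 x) - max (v1 x) (v2 x)\<bar>)"
    using VI2 tv(2) L2_max[OF u1(2) u2(2)] trmax max unfolding variational_inequality_def H1_boundary_def by blast
  have mismatch: "(LINT x|?N. \<bar>min (g1 x) (g2 x) - min (v1 x) (v2 x)\<bar>) + (LINT x|?N. \<bar>max (g1 x) (g2 x) - max (v1 x) (v2 x)\<bar>)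
      \<le> (LINT x|?N. \<bar>g1 x - v1 x\<bar>) + (LINT x|?N. \<bar>g2 x - v2 x\<bar>)"
  proof -
    have "(LINT x|?N. \<bar>min (g1 x) (g2 x) - min (v1 x) (v2 x)\<bar> + \<bar>max (g1 x) (g2 x) - max (v1 x) (v2 x)\<bar>)
        \<le> (LINT x|?N. \<bar>g1 x - v1 x\<bar> + \<bar>g2 x - v2 x\<bar>)"
    proof (rule integral_mono)
      show "\<bar>min (g1 x) (g2 x) - min (v1 x) (v2 x)\<bar> + \<bar>max (g1 x) (g2 x) - max (v1 x) (v2 x)\<bar>
          \<le> \<bar>g1 x - v1 x\<bar> + \<bar>g2 x - v2 x\<bar>" for x by (auto simp: min_def max_def)
    qed (use gi vi in auto)
    then show ?thesis using gi vi by simp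
  qed
  have energy: "0 \<le> (LINT x|?N. G1 x \<bullet> P x) - (LINT x|?N. G2 x \<bullet> P x)"
  proof -
    have "0 \<le> (LINT x|?N. (G1 x - G2 x) \<bullet> P x)"
      unfolding P_def by (intro Bochner_Integration.integral_nonneg) (auto simp: sgn_real_def)
    then show ?thesis using G PL2 by (simp add: inner_diff_left L2_inner_integrable)
  qed
  have 1: "(\<lambda>x. u1 x - min (u1 x) (u2 x)) = w" "(\<lambda>x. u2 x - max (u1 x) (u2 x)) = (\<lambda>x. - w x)"
    "(\<lambda>x. v1 x - min (v1 x) (v2 x)) = w\<^sub>\<Gamma>" "(\<lambda>x. v2 x - max (v1 x) (v2 x)) = (\<lambda>x. - w\<^sub>\<Gamma> x)"
    by (auto simp: w_def w\<^sub>\<Gamma>_def)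
  note 2 = 1[THEN fun_cong]
  have "(LINT x|?M. p1 x * w x) - (LINT x|?M. p2 x * w x) + ((LINT x|?N. q1 x * w\<^sub>\<Gamma> x) - (LINT x|?N. q2 x * w\<^sub>\<Gamma> x))
      + \<epsilon>\<^sup>2 * ((LINT x|?N. G1 x \<bullet> P x) - (LINT x|?N. G2 x \<bullet> P x)) \<le> 0"
    using I1 I2 tv(3) mismatch unfolding 2 by (simp add: right_diff_distrib)
  moreover have "0 \<le> \<epsilon>\<^sup>2 * ((LINT x|?N. G1 x \<bullet> P x) - (LINT x|?N. G2 x \<bullet> P x))"
    using energy by (intro mult_nonneg_nonneg) auto
  moreover have "(LINT x|?M. (p1 x - p2 x) * w x) = (LINT x|?M. p1 x * w x) - (LINT x|?M. p2 x * w x)"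
    using p w by (simp add: left_diff_distrib L2_mult_integrable)
  moreover have "(LINT x|?N. (q1 x - q2 x) * w\<^sub>\<Gamma> x) = (LINT x|?N. q1 x * w\<^sub>\<Gamma> x) - (LINT x|?N. q2 x * w\<^sub>\<Gamma> x)"
    using q wG by (simp add: left_diff_distrib L2_mult_integrable)
  ultimately show ?thesis by (simp add: w_def w\<^sub>\<Gamma>_def)
qed

section \<open>Comparison of weak solutions\<close>

lemma L2_Bochner_diff:
  fixes v w :: "real \<Rightarrow> 'a \<Rightarrow> real"
  assumes v: "L2_Bochner T M v" and w: "L2_Bochner T M w"
  shows "L2_Bochner T M (\<lambda>t x. v t x - w t x)"
  unfolding L2_Bochner_def
proof
  show sm: "strongly_measurable {0<..<T} (L2 M) (L2_dist M) (\<lambda>t x. v t x - w t x)"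
    using v w by (intro strongly_measurable_L2_diff) (auto simp: L2_Bochner_def)
  show "integrable (lebesgue_on {0<..<T}) (\<lambda>t. (L2_norm M (\<lambda>x. v t x - w t x))\<^sup>2)"
  proof (rule Bochner_Integration.integrable_bound)
    show "integrable (lebesgue_on {0<..<T}) (\<lambda>t. 2 * (L2_norm M (v t))\<^sup>2 + 2 * (L2_norm M (w t))\<^sup>2)"
      using v w by (auto simp: L2_Bochner_def)
    show "(\<lambda>t. (L2_norm M (\<lambda>x. v t x - w t x))\<^sup>2) \<in> borel_measurable (lebesgue_on {0<..<T})"
      by (rule strongly_measurable_L2_norm_power2[OF sm]) simp
    show "AE t in lebesgue_on {0<..<T}. norm ((L2_norm M (\<lambda>x. v t x - w t x))\<^sup>2)
        \<le> norm (2 * (L2_norm M (v t))\<^sup>2 + 2 * (L2_norm M (w t))\<^sup>2)"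
      using L2_Bochner_AE[OF v] L2_Bochner_AE[OF w]
    proof eventually_elim
      case (elim t)
      have "L2_norm M (\<lambda>x. v t x - w t x) \<le> L2_norm M (v t) + L2_norm M (\<lambda>x. (- 1) *\<^sub>R w t x)"
        using L2_norm_triangle[OF elim(1) L2_scale[OF elim(2), of "-1"]] by simp
      also have "L2_norm M (\<lambda>x. (- 1) *\<^sub>R w t x) = L2_norm M (w t)" unfolding L2_norm_scale by simp
      finally have "(L2_norm M (\<lambda>x. v t x - w t x))\<^sup>2 \<le> (L2_norm M (v t) + L2_norm M (w t))\<^sup>2"
        by (intro power_mono) (auto simp: L2_norm_nonneg)
      also have "\<dots> \<le> 2 * (L2_norm M (v t))\<^sup>2 + 2 * (L2_norm M (w t))\<^sup>2"
        using sum_squares_bound[of "L2_norm M (v t)" "L2_norm M (w t)"] by (simp add: power2_sum)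
      finally show ?case by simp
    qed
  qed
qed

lemma L2_Bochner_pos:
  fixes v :: "real \<Rightarrow> 'a \<Rightarrow> real"
  assumes v: "L2_Bochner T M v"
  shows "L2_Bochner T M (\<lambda>t x. max (v t x) 0)"
  unfolding L2_Bochner_def
proof
  show sm: "strongly_measurable {0<..<T} (L2 M) (L2_dist M) (\<lambda>t x. max (v t x) 0)"
    using v by (intro strongly_measurable_L2_pos) (auto simp: L2_Bochner_def)
  show "integrable (lebesgue_on {0<..<T}) (\<lambda>t. (L2_norm M (\<lambda>x. max (v t x) 0))\<^sup>2)"
  proof (rule Bochner_Integration.integrable_bound)
    show "integrable (lebesgue_on {0<..<T}) (\<lambda>t. (L2_norm M (v t))\<^sup>2)" using v by (simp add: L2_Bochner_def)
    show "(\<lambda>t. (L2_norm M (\<lambda>x. max (v t x) 0))\<^sup>2) \<in> borel_measurable (lebesgue_on {0<..<T})"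
      by (rule strongly_measurable_L2_norm_power2[OF sm]) simp
    show "AE t in lebesgue_on {0<..<T}. norm ((L2_norm M (\<lambda>x. max (v t x) 0))\<^sup>2) \<le> norm ((L2_norm M (v t))\<^sup>2)"
      using L2_Bochner_AE[OF v]
    proof eventually_elim
      case (elim t)
      have "L2_norm M (\<lambda>x. max (v t x) 0) \<le> L2_norm M (v t)"
        using L2_measurable[OF L2_pos[OF elim]] elim by (rule L2_norm_mono) auto
      then have "(L2_norm M (\<lambda>x. max (v t x) 0))\<^sup>2 \<le> (L2_norm M (v t))\<^sup>2"
        by (intro power_mono) (auto simp: L2_norm_nonneg)
      then show ?case by simp
    qed
  qed
qed

text \<open>The chain rule applied to the difference of two solutions. The pairing identities are linear, so they are
  subtracted instead of showing that the difference has a weak derivative.\<close>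

lemma W12_pos_part_of_difference:
  fixes u1 u2 u1' u2' :: "real \<Rightarrow> 'a \<Rightarrow> real"
  assumes u1: "W12_with_derivative T M u1 u1'" and u2: "W12_with_derivative T M u2 u2'"
  defines "p \<equiv> \<lambda>t x. max (u1 t x - u2 t x) 0"
  shows "continuous_on {0..T} (\<lambda>t. (L2_norm M (p t))\<^sup>2)"
    and "(\<lambda>r. LINT x|M. (u1' r x - u2' r x) * p r x) absolutely_integrable_on {0..T}"
    and "\<And>s t. 0 \<le> s \<Longrightarrow> s \<le> t \<Longrightarrow> t \<le> T \<Longrightarrow> (L2_norm M (p t))\<^sup>2 - (L2_norm M (p s))\<^sup>2
      \<le> 2 * integral {s..t} (\<lambda>r. LINT x|M. (u1' r x - u2' r x) * p r x)"
proof -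
  let ?w = "\<lambda>t x. u1 t x - u2 t x" and ?w' = "\<lambda>t x. u1' t x - u2' t x"
  have L2: "u1 t \<in> L2 M" "u2 t \<in> L2 M" if "t \<in> {0..T}" for t
    using u1 u2 that by (auto simp: W12_with_derivative_def)
  have w: "?w t \<in> L2 M" if "t \<in> {0..T}" for t using L2[OF that] by (intro L2_diff)
  have cont: "((\<lambda>s. L2_dist M (?w s) (?w t)) \<longlongrightarrow> 0) (at t within {0..T})" if t: "t \<in> {0..T}" for t
  proof (rule Lim_null_comparison)
    show "((\<lambda>s. L2_dist M (u1 s) (u1 t) + L2_dist M (u2 s) (u2 t)) \<longlongrightarrow> 0) (at t within {0..T})"
      using u1 u2 t by (intro tendsto_add_zero) (auto simp: W12_with_derivative_def)
    show "\<forall>\<^sub>F s in at t within {0..T}. norm (L2_dist M (?w s) (?w t)) \<le> L2_dist M (u1 s) (u1 t) + L2_dist M (u2 s) (u2 t)"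
      unfolding eventually_at_filter
    proof (intro always_eventually allI impI)
      fix s assume s: "s \<in> {0..T}"
      show "norm (L2_dist M (?w s) (?w t)) \<le> L2_dist M (u1 s) (u1 t) + L2_dist M (u2 s) (u2 t)"
        using L2_dist_diff[OF L2[OF s] L2[OF t]] by (simp add: L2_dist_nonneg)
    qed
  qed
  have Bw: "L2_Bochner T M ?w" and Bw': "L2_Bochner T M ?w'"
    using u1 u2 by (auto intro!: L2_Bochner_diff simp: W12_with_derivative_def)
  have wm: "strongly_measurable {0<..<T} (L2 M) (L2_dist M) ?w" and w'm: "strongly_measurable {0<..<T} (L2 M) (L2_dist M) ?w'"
    using Bw Bw' by (auto simp: L2_Bochner_def)
  have w'int: "(\<lambda>r. L2_norm M (?w' r)) absolutely_integrable_on {0..T}"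
    unfolding absolutely_integrable_Icc_iff_lebesgue_on by (rule L2_norm_integrable_in_time[OF Bw'])
  have primitive: "(LINT x|M. (?w t x - ?w s x) * \<psi> x) = integral {s..t} (\<lambda>r. LINT x|M. ?w' r x * \<psi> x)"
    if \<psi>: "\<psi> \<in> L2 M" and st: "0 \<le> s" "s \<le> t" "t \<le> T" for \<psi> s t
  proof -
    have sT: "s \<in> {0..T}" and tT: "t \<in> {0..T}" using st by auto
    have int: "(\<lambda>r. LINT x|M. v r x * \<psi> x) integrable_on {s..t}" if v: "L2_Bochner T M v" for v
      using L2_inner_integrable_in_time[OF v \<psi>] st
      by (intro absolutely_integrable_subinterval(2)) (auto simp: absolutely_integrable_Icc_iff_lebesgue_on)
    have u': "L2_Bochner T M u1'" "L2_Bochner T M u2'" using u1 u2 by (auto simp: W12_with_derivative_def)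
    have "(LINT x|M. (?w t x - ?w s x) * \<psi> x)
        = ((LINT x|M. u1 t x * \<psi> x) - (LINT x|M. u1 s x * \<psi> x)) - ((LINT x|M. u2 t x * \<psi> x) - (LINT x|M. u2 s x * \<psi> x))"
      using L2[OF sT] L2[OF tT] \<psi> by (simp add: left_diff_distrib L2_mult_integrable)
    also have "\<dots> = integral {s..t} (\<lambda>r. LINT x|M. u1' r x * \<psi> x) - integral {s..t} (\<lambda>r. LINT x|M. u2' r x * \<psi> x)"
      unfolding W12_inner_primitive[OF u1 \<psi> st] W12_inner_primitive[OF u2 \<psi> st] ..
    also have "\<dots> = integral {s..t} (\<lambda>r. (LINT x|M. u1' r x * \<psi> x) - (LINT x|M. u2' r x * \<psi> x))"
      by (rule Henstock_Kurzweil_Integration.integral_diff[OF int[OF u'(1)] int[OF u'(2)], symmetric])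
    also have "\<dots> = integral {s..t} (\<lambda>r. LINT x|M. ?w' r x * \<psi> x)"
    proof -
      have AE: "AE r in lebesgue_on {0<..<T}. (LINT x|M. u1' r x * \<psi> x) - (LINT x|M. u2' r x * \<psi> x) = (LINT x|M. ?w' r x * \<psi> x)"
        using L2_Bochner_AE[OF u'(1)] L2_Bochner_AE[OF u'(2)]
        by eventually_elim (simp add: left_diff_distrib L2_mult_integrable \<psi>)
      then obtain N where N: "N \<in> null_sets lebesgue"
        "{r. \<not> (r \<in> {0<..<T} \<longrightarrow> (LINT x|M. u1' r x * \<psi> x) - (LINT x|M. u2' r x * \<psi> x) = (LINT x|M. ?w' r x * \<psi> x))} \<subseteq> N"
        by (subst (asm) AE_restrict_space_iff) (auto simp: eventually_ae_filter)
      show ?thesis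
      proof (rule integral_spike)
        show "negligible (N \<union> {0, T})" using N(1) by (simp add: negligible_iff_null_sets[symmetric])
        show "(LINT x|M. ?w' r x * \<psi> x) = (LINT x|M. u1' r x * \<psi> x) - (LINT x|M. u2' r x * \<psi> x)"
          if "r \<in> {s..t} - (N \<union> {0, T})" for r
        proof -
          have "r \<in> {0<..<T}" "r \<notin> N" using that st by auto
          then show ?thesis using N(2) by auto
        qed
      qed
    qed
    finally show ?thesis .
  qed
  note chain = L2_pos_part_chain_integrable[OF w cont wm w'm w'int primitive]
    L2_pos_part_chain_le[OF w cont wm w'm w'int primitive]
  show "(\<lambda>r. LINT x|M. ?w' r x * p r x) absolutely_integrable_on {0..T}"
    unfolding p_def by (rule chain(1))
  show "(L2_norm M (p t))\<^sup>2 - (L2_norm M (p s))\<^sup>2 \<le> 2 * integral {s..t} (\<lambda>r. LINT x|M. ?w' r x * p r x)"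
    if "0 \<le> s" "s \<le> t" "t \<le> T" for s t
    unfolding p_def by (rule chain(2)) (use that in simp_all)
  show "continuous_on {0..T} (\<lambda>t. (L2_norm M (p t))\<^sup>2)"
    unfolding continuous_on_def
  proof
    fix t assume t: "t \<in> {0..T}"
    have ev: "\<forall>\<^sub>F s in at t within {0..T}. p s \<in> L2 M"
      unfolding eventually_at_filter p_def using w by (intro always_eventually) (auto intro: L2_pos)
    have "((\<lambda>s. L2_dist M (p s) (p t)) \<longlongrightarrow> 0) (at t within {0..T})"
    proof (rule Lim_null_comparison[OF _ cont[OF t]])
      show "\<forall>\<^sub>F s in at t within {0..T}. norm (L2_dist M (p s) (p t)) \<le> L2_dist M (?w s) (?w t)"
        unfolding eventually_at_filter p_def
        using L2_dist_pos[OF w w[OF t]] by (intro always_eventually) (simp add: L2_dist_nonneg)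
    qed
    then show "((\<lambda>t. (L2_norm M (p t))\<^sup>2) \<longlongrightarrow> (L2_norm M (p t))\<^sup>2) (at t within {0..T})"
      using ev t w by (intro tendsto_power tendsto_L2_norm) (auto simp: p_def intro: L2_pos)
  qed
qed

text \<open>Only the positive part of the source difference counts against a nonnegative function; Young's inequality
  then produces the rate one in the exponential.\<close>

lemma L2_inner_pos_le:
  fixes f g :: "'a \<Rightarrow> real"
  assumes f: "f \<in> L2 M" and g: "g \<in> L2 M"
  shows "(LINT x|M. f x * max (g x) 0) \<le> ((L2_norm M (\<lambda>x. max (f x) 0))\<^sup>2 + (L2_norm M (\<lambda>x. max (g x) 0))\<^sup>2) / 2"
proof -
  have "(LINT x|M. f x * max (g x) 0) \<le> (LINT x|M. (max (f x) 0 * max (f x) 0 + max (g x) 0 * max (g x) 0) / 2)"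
  proof (rule integral_mono)
    fix x
    have "f x * max (g x) 0 \<le> max (f x) 0 * max (g x) 0" by (intro mult_right_mono) auto
    also have "\<dots> \<le> (max (f x) 0 * max (f x) 0 + max (g x) 0 * max (g x) 0) / 2"
      using sum_squares_bound[of "max (f x) 0" "max (g x) 0"] by (simp add: power2_eq_square)
    finally show "f x * max (g x) 0 \<le> (max (f x) 0 * max (f x) 0 + max (g x) 0 * max (g x) 0) / 2" .
  qed (use L2_pos[OF f] L2_pos[OF g] f in \<open>auto intro!: L2_mult_integrable\<close>)
  also have "\<dots> = ((L2_norm M (\<lambda>x. max (f x) 0))\<^sup>2 + (L2_norm M (\<lambda>x. max (g x) 0))\<^sup>2) / 2"
    using L2_pos[OF f] L2_pos[OF g] by (simp add: L2_norm_mult L2_mult_integrable)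
  finally show ?thesis .
qed

lemma L2_norm_cong_AE:
  assumes "f \<in> L2 M" "g \<in> L2 M" "AE x in M. f x = g x"
  shows "L2_norm M f = L2_norm M g"
proof -
  have "(LINT x|M. (norm (f x))\<^sup>2) = (LINT x|M. (norm (g x))\<^sup>2)"
    using assms by (intro integral_cong_AE) (auto simp: L2_def elim: eventually_mono)
  then show ?thesis by (simp add: L2_norm_def)
qed

theorem theoremB:
  fixes \<Omega> :: "'a::euclidean_space set"
    and \<epsilon> T :: real
    and u\<^sub>0\<^sub>1 u\<^sub>0\<^sub>2 u\<^sub>\<Gamma>\<^sub>0\<^sub>1 u\<^sub>\<Gamma>\<^sub>0\<^sub>2 :: "'a \<Rightarrow> real"
    and \<theta>\<^sub>1 \<theta>\<^sub>2 \<theta>\<^sub>\<Gamma>\<^sub>1 \<theta>\<^sub>\<Gamma>\<^sub>2 u\<^sub>1 u\<^sub>2 u\<^sub>\<Gamma>\<^sub>1 u\<^sub>\<Gamma>\<^sub>2 :: "real \<Rightarrow> 'a \<Rightarrow> real"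
  assumes "DIM('a) > 1" and "\<epsilon> > 0" and "T > 0"
    and "smooth_bounded_domain \<Omega>"
    and "u\<^sub>0\<^sub>1 \<in> BV \<Omega> \<inter> L2 (lebesgue_on \<Omega>)" and "u\<^sub>\<Gamma>\<^sub>0\<^sub>1 \<in> H1_boundary \<Omega>"
    and "u\<^sub>0\<^sub>2 \<in> BV \<Omega> \<inter> L2 (lebesgue_on \<Omega>)" and "u\<^sub>\<Gamma>\<^sub>0\<^sub>2 \<in> H1_boundary \<Omega>"
    and "L2_Bochner T (lebesgue_on \<Omega>) \<theta>\<^sub>1" and "L2_Bochner T (boundary_measure \<Omega>) \<theta>\<^sub>\<Gamma>\<^sub>1"
    and "L2_Bochner T (lebesgue_on \<Omega>) \<theta>\<^sub>2" and "L2_Bochner T (boundary_measure \<Omega>) \<theta>\<^sub>\<Gamma>\<^sub>2"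
    and "weak_solution \<epsilon> T \<Omega> u\<^sub>0\<^sub>1 u\<^sub>\<Gamma>\<^sub>0\<^sub>1 \<theta>\<^sub>1 \<theta>\<^sub>\<Gamma>\<^sub>1 u\<^sub>1 u\<^sub>\<Gamma>\<^sub>1"
    and "weak_solution \<epsilon> T \<Omega> u\<^sub>0\<^sub>2 u\<^sub>\<Gamma>\<^sub>0\<^sub>2 \<theta>\<^sub>2 \<theta>\<^sub>\<Gamma>\<^sub>2 u\<^sub>2 u\<^sub>\<Gamma>\<^sub>2"
  shows "\<forall>t\<in>{0..T}.
      (L2_norm (lebesgue_on \<Omega>) (\<lambda>x. max (u\<^sub>1 t x - u\<^sub>2 t x) 0))\<^sup>2
        + (L2_norm (boundary_measure \<Omega>) (\<lambda>x. max (u\<^sub>\<Gamma>\<^sub>1 t x - u\<^sub>\<Gamma>\<^sub>2 t x) 0))\<^sup>2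
      \<le> exp t *
          ((L2_norm (lebesgue_on \<Omega>) (\<lambda>x. max (u\<^sub>0\<^sub>1 x - u\<^sub>0\<^sub>2 x) 0))\<^sup>2
            + (L2_norm (boundary_measure \<Omega>) (\<lambda>x. max (u\<^sub>\<Gamma>\<^sub>0\<^sub>1 x - u\<^sub>\<Gamma>\<^sub>0\<^sub>2 x) 0))\<^sup>2)
        + (LINT \<tau>:{0..t}|lebesgue. exp (t - \<tau>) *
            ((L2_norm (lebesgue_on \<Omega>) (\<lambda>x. max (\<theta>\<^sub>1 \<tau> x - \<theta>\<^sub>2 \<tau> x) 0))\<^sup>2
              + (L2_norm (boundary_measure \<Omega>) (\<lambda>x. max (\<theta>\<^sub>\<Gamma>\<^sub>1 \<tau> x - \<theta>\<^sub>\<Gamma>\<^sub>2 \<tau> x) 0))\<^sup>2))"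
proof -
  let ?M = "lebesgue_on \<Omega>" and ?N = "boundary_measure \<Omega>"
  note \<Omega> = assms(4)
  note \<theta> = assms(9-12)
  have weak: "\<exists>u' u\<^sub>\<Gamma>' G. W12_with_derivative T ?M u u' \<and> W12_with_derivative T ?N u\<^sub>\<Gamma> u\<^sub>\<Gamma>' \<and>
      (AE t in lebesgue_on {0<..<T}. u t \<in> BV \<Omega> \<and> has_surface_gradient \<Omega> (u\<^sub>\<Gamma> t) (G t) \<and>
        (\<exists>g. has_trace \<Omega> (u t) g \<and> variational_inequality \<epsilon> \<Omega> (\<lambda>x. u' t x - \<theta> t x) (\<lambda>x. u\<^sub>\<Gamma>' t x - \<theta>\<^sub>\<Gamma> t x) (u t) g (u\<^sub>\<Gamma> t) (G t)))"
    if sol: "weak_solution \<epsilon> T \<Omega> u\<^sub>0 u\<^sub>\<Gamma>\<^sub>0 \<theta> \<theta>\<^sub>\<Gamma> u u\<^sub>\<Gamma>" for u\<^sub>0 u\<^sub>\<Gamma>\<^sub>0 \<theta> \<theta>\<^sub>\<Gamma> u u\<^sub>\<Gamma>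
  proof -
    obtain u' u\<^sub>\<Gamma>' G where W: "W12_with_derivative T ?M u u'" "W12_with_derivative T ?N u\<^sub>\<Gamma> u\<^sub>\<Gamma>'"
      and G: "Linfty_H1_boundary T \<Omega> u\<^sub>\<Gamma> G"
      and VI: "AE t in lebesgue_on {0<..<T}. \<exists>g. has_trace \<Omega> (u t) g \<and>
        variational_inequality \<epsilon> \<Omega> (\<lambda>x. u' t x - \<theta> t x) (\<lambda>x. u\<^sub>\<Gamma>' t x - \<theta>\<^sub>\<Gamma> t x) (u t) g (u\<^sub>\<Gamma> t) (G t)"
      using sol unfolding weak_solution_def variational_inequality_def by blast
    have "AE t in lebesgue_on {0<..<T}. u t \<in> BV \<Omega>" using sol by (simp add: weak_solution_def)
    moreover have "AE t in lebesgue_on {0<..<T}. has_surface_gradient \<Omega> (u\<^sub>\<Gamma> t) (G t)"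
      using G strongly_measurable_AE[of "{0<..<T}" "H1_boundary_pairs \<Omega>" "H1_dist \<Omega>" "\<lambda>t. (u\<^sub>\<Gamma> t, G t)"]
      by (simp add: Linfty_H1_boundary_def H1_boundary_pairs_def)
    ultimately have "AE t in lebesgue_on {0<..<T}. u t \<in> BV \<Omega> \<and> has_surface_gradient \<Omega> (u\<^sub>\<Gamma> t) (G t) \<and>
        (\<exists>g. has_trace \<Omega> (u t) g \<and> variational_inequality \<epsilon> \<Omega> (\<lambda>x. u' t x - \<theta> t x) (\<lambda>x. u\<^sub>\<Gamma>' t x - \<theta>\<^sub>\<Gamma> t x) (u t) g (u\<^sub>\<Gamma> t) (G t))"
      using VI by eventually_elim blast
    with W show ?thesis by blast
  qed
  obtain u1' v1' G1 where W1: "W12_with_derivative T ?M u\<^sub>1 u1'" "W12_with_derivative T ?N u\<^sub>\<Gamma>\<^sub>1 v1'"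
    and VI1: "AE t in lebesgue_on {0<..<T}. u\<^sub>1 t \<in> BV \<Omega> \<and> has_surface_gradient \<Omega> (u\<^sub>\<Gamma>\<^sub>1 t) (G1 t) \<and>
        (\<exists>g. has_trace \<Omega> (u\<^sub>1 t) g \<and> variational_inequality \<epsilon> \<Omega> (\<lambda>x. u1' t x - \<theta>\<^sub>1 t x) (\<lambda>x. v1' t x - \<theta>\<^sub>\<Gamma>\<^sub>1 t x) (u\<^sub>1 t) g (u\<^sub>\<Gamma>\<^sub>1 t) (G1 t))"
    using weak[OF assms(13)] by blast
  obtain u2' v2' G2 where W2: "W12_with_derivative T ?M u\<^sub>2 u2'" "W12_with_derivative T ?N u\<^sub>\<Gamma>\<^sub>2 v2'"
    and VI2: "AE t in lebesgue_on {0<..<T}. u\<^sub>2 t \<in> BV \<Omega> \<and> has_surface_gradient \<Omega> (u\<^sub>\<Gamma>\<^sub>2 t) (G2 t) \<and>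
        (\<exists>g. has_trace \<Omega> (u\<^sub>2 t) g \<and> variational_inequality \<epsilon> \<Omega> (\<lambda>x. u2' t x - \<theta>\<^sub>2 t x) (\<lambda>x. v2' t x - \<theta>\<^sub>\<Gamma>\<^sub>2 t x) (u\<^sub>2 t) g (u\<^sub>\<Gamma>\<^sub>2 t) (G2 t))"
    using weak[OF assms(14)] by blast
  define F where "F t = (L2_norm ?M (\<lambda>x. max (u\<^sub>1 t x - u\<^sub>2 t x) 0))\<^sup>2 + (L2_norm ?N (\<lambda>x. max (u\<^sub>\<Gamma>\<^sub>1 t x - u\<^sub>\<Gamma>\<^sub>2 t x) 0))\<^sup>2" for t
  define f where "f t = (L2_norm ?M (\<lambda>x. max (\<theta>\<^sub>1 t x - \<theta>\<^sub>2 t x) 0))\<^sup>2 + (L2_norm ?N (\<lambda>x. max (\<theta>\<^sub>\<Gamma>\<^sub>1 t x - \<theta>\<^sub>\<Gamma>\<^sub>2 t x) 0))\<^sup>2" for t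
  define D where "D r = (LINT x|?M. (u1' r x - u2' r x) * max (u\<^sub>1 r x - u\<^sub>2 r x) 0)" for r
  define D\<^sub>\<Gamma> where "D\<^sub>\<Gamma> r = (LINT x|?N. (v1' r x - v2' r x) * max (u\<^sub>\<Gamma>\<^sub>1 r x - u\<^sub>\<Gamma>\<^sub>2 r x) 0)" for r
  note bulk = W12_pos_part_of_difference[OF W1(1) W2(1), folded D_def]
    and surface = W12_pos_part_of_difference[OF W1(2) W2(2), folded D\<^sub>\<Gamma>_def]
  have Fcont: "continuous_on {0..T} F"
    unfolding F_def by (intro continuous_on_add bulk(1) surface(1))
  have fint: "f absolutely_integrable_on {0..T}"
    unfolding absolutely_integrable_Icc_iff_lebesgue_on f_def
    using L2_Bochner_pos[OF L2_Bochner_diff[OF \<theta>(1,3)]] L2_Bochner_pos[OF L2_Bochner_diff[OF \<theta>(2,4)]]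
    by (intro Bochner_Integration.integrable_add) (auto simp: L2_Bochner_def)
  have Fint: "F absolutely_integrable_on {0..T}" by (rule absolutely_integrable_continuous_real[OF Fcont])
  \<comment> \<open>The comparison at a fixed time, with the source terms moved to the right by Young's inequality.\<close>
  have dissipation: "AE r in lebesgue_on {0<..<T}. 2 * (D r + D\<^sub>\<Gamma> r) \<le> F r + f r"
  proof -
    have der: "L2_Bochner T ?M u1'" "L2_Bochner T ?M u2'" "L2_Bochner T ?N v1'" "L2_Bochner T ?N v2'"
      using W1 W2 by (auto simp: W12_with_derivative_def)
    have sol: "u\<^sub>1 r \<in> L2 ?M" "u\<^sub>2 r \<in> L2 ?M" "u\<^sub>\<Gamma>\<^sub>1 r \<in> L2 ?N" "u\<^sub>\<Gamma>\<^sub>2 r \<in> L2 ?N" if "r \<in> {0<..<T}" for r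
      using W1 W2 that by (auto simp: W12_with_derivative_def)
    have "AE r in lebesgue_on {0<..<T}. r \<in> {0<..<T}" by (rule AE_I2) simp
    then show ?thesis
      using VI1 VI2 der[THEN L2_Bochner_AE] \<theta>[THEN L2_Bochner_AE]
    proof eventually_elim
      case (elim r)
      note sol = sol[OF elim(1)]
      obtain g1 where g1: "has_trace \<Omega> (u\<^sub>1 r) g1"
          "variational_inequality \<epsilon> \<Omega> (\<lambda>x. u1' r x - \<theta>\<^sub>1 r x) (\<lambda>x. v1' r x - \<theta>\<^sub>\<Gamma>\<^sub>1 r x) (u\<^sub>1 r) g1 (u\<^sub>\<Gamma>\<^sub>1 r) (G1 r)"
        using elim(2) by blast
      obtain g2 where g2: "has_trace \<Omega> (u\<^sub>2 r) g2"
          "variational_inequality \<epsilon> \<Omega> (\<lambda>x. u2' r x - \<theta>\<^sub>2 r x) (\<lambda>x. v2' r x - \<theta>\<^sub>\<Gamma>\<^sub>2 r x) (u\<^sub>2 r) g2 (u\<^sub>\<Gamma>\<^sub>2 r) (G2 r)"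
        using elim(3) by blast
      let ?w = "\<lambda>x. max (u\<^sub>1 r x - u\<^sub>2 r x) 0" and ?w\<^sub>\<Gamma> = "\<lambda>x. max (u\<^sub>\<Gamma>\<^sub>1 r x - u\<^sub>\<Gamma>\<^sub>2 r x) 0"
      have w: "?w \<in> L2 ?M" "?w\<^sub>\<Gamma> \<in> L2 ?N" using sol by (auto intro!: L2_pos L2_diff)
      have "(LINT x|?M. ((u1' r x - \<theta>\<^sub>1 r x) - (u2' r x - \<theta>\<^sub>2 r x)) * ?w x)
          + (LINT x|?N. ((v1' r x - \<theta>\<^sub>\<Gamma>\<^sub>1 r x) - (v2' r x - \<theta>\<^sub>\<Gamma>\<^sub>2 r x)) * ?w\<^sub>\<Gamma> x) \<le> 0"
        using elim sol by (intro variational_inequality_comparison[OF \<Omega> _ _ g1(1) _ _ _ g2(1) _ _ _ _ _ g1(2) g2(2)] L2_diff) auto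
      moreover have "(LINT x|?M. ((u1' r x - \<theta>\<^sub>1 r x) - (u2' r x - \<theta>\<^sub>2 r x)) * ?w x) = D r - (LINT x|?M. (\<theta>\<^sub>1 r x - \<theta>\<^sub>2 r x) * ?w x)"
      proof -
        have "(\<lambda>x. ((u1' r x - \<theta>\<^sub>1 r x) - (u2' r x - \<theta>\<^sub>2 r x)) * ?w x) = (\<lambda>x. (u1' r x - u2' r x) * ?w x - (\<theta>\<^sub>1 r x - \<theta>\<^sub>2 r x) * ?w x)"
          by (simp add: algebra_simps)
        then show ?thesis
          using elim w by (simp only: D_def) (intro Bochner_Integration.integral_diff L2_mult_integrable L2_diff; simp)
      qed
      moreover have "(LINT x|?N. ((v1' r x - \<theta>\<^sub>\<Gamma>\<^sub>1 r x) - (v2' r x - \<theta>\<^sub>\<Gamma>\<^sub>2 r x)) * ?w\<^sub>\<Gamma> x) = D\<^sub>\<Gamma> r - (LINT x|?N. (\<theta>\<^sub>\<Gamma>\<^sub>1 r x - \<theta>\<^sub>\<Gamma>\<^sub>2 r x) * ?w\<^sub>\<Gamma> x)"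
      proof -
        have "(\<lambda>x. ((v1' r x - \<theta>\<^sub>\<Gamma>\<^sub>1 r x) - (v2' r x - \<theta>\<^sub>\<Gamma>\<^sub>2 r x)) * ?w\<^sub>\<Gamma> x) = (\<lambda>x. (v1' r x - v2' r x) * ?w\<^sub>\<Gamma> x - (\<theta>\<^sub>\<Gamma>\<^sub>1 r x - \<theta>\<^sub>\<Gamma>\<^sub>2 r x) * ?w\<^sub>\<Gamma> x)"
          by (simp add: algebra_simps)
        then show ?thesis
          using elim w by (simp only: D\<^sub>\<Gamma>_def) (intro Bochner_Integration.integral_diff L2_mult_integrable L2_diff; simp)
      qed
      moreover have "(LINT x|?M. (\<theta>\<^sub>1 r x - \<theta>\<^sub>2 r x) * ?w x)
          \<le> ((L2_norm ?M (\<lambda>x. max (\<theta>\<^sub>1 r x - \<theta>\<^sub>2 r x) 0))\<^sup>2 + (L2_norm ?M ?w)\<^sup>2) / 2"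
        using elim sol by (intro L2_inner_pos_le L2_diff) auto
      moreover have "(LINT x|?N. (\<theta>\<^sub>\<Gamma>\<^sub>1 r x - \<theta>\<^sub>\<Gamma>\<^sub>2 r x) * ?w\<^sub>\<Gamma> x)
          \<le> ((L2_norm ?N (\<lambda>x. max (\<theta>\<^sub>\<Gamma>\<^sub>1 r x - \<theta>\<^sub>\<Gamma>\<^sub>2 r x) 0))\<^sup>2 + (L2_norm ?N ?w\<^sub>\<Gamma>)\<^sup>2) / 2"
        using elim sol by (intro L2_inner_pos_le L2_diff) auto
      moreover have "2 * (d + d') \<le> (c + c') + (b + b')"
        if "x + x' \<le> 0" "x = d - y" "x' = d' - y'" "y \<le> (b + c) / 2" "y' \<le> (b' + c') / 2"
        for x x' d d' y y' b b' c c' :: real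
        using that by argo
      ultimately show ?case unfolding F_def f_def by blast
    qed
  qed
  have increment: "F t - F s \<le> integral {s..t} (\<lambda>r. F r + f r)" if st: "0 \<le> s" "s \<le> t" "t \<le> T" for s t
  proof -
    have "F t - F s \<le> 2 * integral {s..t} D + 2 * integral {s..t} D\<^sub>\<Gamma>"
      using bulk(3)[OF st] surface(3)[OF st] unfolding F_def by linarith
    also have "\<dots> = integral {s..t} (\<lambda>r. 2 * (D r + D\<^sub>\<Gamma> r))"
      using absolutely_integrable_subinterval(2)[OF bulk(2) st(1,3)] absolutely_integrable_subinterval(2)[OF surface(2) st(1,3)]
      by (simp add: Henstock_Kurzweil_Integration.integral_add)
    also have "\<dots> \<le> integral {s..t} (\<lambda>r. F r + f r)"
      using bulk(2) surface(2) Fint fint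
      by (intro integral_mono_AE_subinterval[OF _ _ dissipation st(1,3)] set_integrable_mult_right set_integral_add(1)) auto
    finally show ?thesis .
  qed
  have F0: "F 0 = (L2_norm ?M (\<lambda>x. max (u\<^sub>0\<^sub>1 x - u\<^sub>0\<^sub>2 x) 0))\<^sup>2 + (L2_norm ?N (\<lambda>x. max (u\<^sub>\<Gamma>\<^sub>0\<^sub>1 x - u\<^sub>\<Gamma>\<^sub>0\<^sub>2 x) 0))\<^sup>2"
  proof -
    have init: "AE x in ?M. u\<^sub>1 0 x = u\<^sub>0\<^sub>1 x" "AE x in ?M. u\<^sub>2 0 x = u\<^sub>0\<^sub>2 x"
      "AE x in ?N. u\<^sub>\<Gamma>\<^sub>1 0 x = u\<^sub>\<Gamma>\<^sub>0\<^sub>1 x" "AE x in ?N. u\<^sub>\<Gamma>\<^sub>2 0 x = u\<^sub>\<Gamma>\<^sub>0\<^sub>2 x"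
      using assms(13,14) by (auto simp: weak_solution_def)
    have L2: "u\<^sub>1 0 \<in> L2 ?M" "u\<^sub>2 0 \<in> L2 ?M" "u\<^sub>\<Gamma>\<^sub>1 0 \<in> L2 ?N" "u\<^sub>\<Gamma>\<^sub>2 0 \<in> L2 ?N"
      using W1 W2 \<open>T > 0\<close> by (auto simp: W12_with_derivative_def)
    have L20: "u\<^sub>0\<^sub>1 \<in> L2 ?M" "u\<^sub>0\<^sub>2 \<in> L2 ?M" "u\<^sub>\<Gamma>\<^sub>0\<^sub>1 \<in> L2 ?N" "u\<^sub>\<Gamma>\<^sub>0\<^sub>2 \<in> L2 ?N"
      using assms(5-8) has_surface_gradient_L2(1) by (auto simp: H1_boundary_def)
    have "L2_norm ?M (\<lambda>x. max (u\<^sub>1 0 x - u\<^sub>2 0 x) 0) = L2_norm ?M (\<lambda>x. max (u\<^sub>0\<^sub>1 x - u\<^sub>0\<^sub>2 x) 0)"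
      by (intro L2_norm_cong_AE L2_pos L2_diff L2 L20) (use init(1,2) in eventually_elim, simp)
    moreover have "L2_norm ?N (\<lambda>x. max (u\<^sub>\<Gamma>\<^sub>1 0 x - u\<^sub>\<Gamma>\<^sub>2 0 x) 0) = L2_norm ?N (\<lambda>x. max (u\<^sub>\<Gamma>\<^sub>0\<^sub>1 x - u\<^sub>\<Gamma>\<^sub>0\<^sub>2 x) 0)"
      by (intro L2_norm_cong_AE L2_pos L2_diff L2 L20) (use init(3,4) in eventually_elim, simp)
    ultimately show ?thesis by (simp add: F_def)
  qed
  show ?thesis
  proof
    fix t assume "t \<in> {0..T}"
    then have t: "0 \<le> t" "t \<le> T" by auto
    have "F t \<le> exp t * F 0 + integral {0..t} (\<lambda>r. exp (t - r) * f r)"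
      by (rule Gronwall_integral_inequality[OF Fcont _ fint _ increment t]) (auto simp: F_def f_def)
    also have "integral {0..t} (\<lambda>r. exp (t - r) * f r) = (LINT r:{0..t}|lebesgue. exp (t - r) * f r)"
    proof (rule set_lebesgue_integral_eq_integral(2)[symmetric])
      show "(\<lambda>r. exp (t - r) * f r) absolutely_integrable_on {0..t}"
        using absolutely_integrable_subinterval(1)[OF fint _ t(2), of 0]
        by (intro absolutely_integrable_bounded_measurable_product_real compact_imp_bounded
            compact_continuous_image continuous_imp_measurable_on_sets_lebesgue)
          (auto intro!: continuous_intros)
    qed
    finally show "(L2_norm ?M (\<lambda>x. max (u\<^sub>1 t x - u\<^sub>2 t x) 0))\<^sup>2
        + (L2_norm ?N (\<lambda>x. max (u\<^sub>\<Gamma>\<^sub>1 t x - u\<^sub>\<Gamma>\<^sub>2 t x) 0))\<^sup>2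
      \<le> exp t * ((L2_norm ?M (\<lambda>x. max (u\<^sub>0\<^sub>1 x - u\<^sub>0\<^sub>2 x) 0))\<^sup>2
            + (L2_norm ?N (\<lambda>x. max (u\<^sub>\<Gamma>\<^sub>0\<^sub>1 x - u\<^sub>\<Gamma>\<^sub>0\<^sub>2 x) 0))\<^sup>2)
        + (LINT \<tau>:{0..t}|lebesgue. exp (t - \<tau>) *
            ((L2_norm ?M (\<lambda>x. max (\<theta>\<^sub>1 \<tau> x - \<theta>\<^sub>2 \<tau> x) 0))\<^sup>2
              + (L2_norm ?N (\<lambda>x. max (\<theta>\<^sub>\<Gamma>\<^sub>1 \<tau> x - \<theta>\<^sub>\<Gamma>\<^sub>2 \<tau> x) 0))\<^sup>2))"
      unfolding F0 unfolding F_def f_def .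
  qed
qed

end
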